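(* Let $D$ be a 2-dimensional regular local ring and let $\mathcal U=\{\alpha_1,\ldots,\alpha_n\}$, $n\geq 1$, be a finite subset of $Q(D)$ such that there are no inclusion relations among the (distinct) rings $\alpha_i$. Then $\mathcal O_{\mathcal U}=\bigcap_{i=1}^n\alpha_i$ is a regular Noetherian domain with precisely $n$ maximal ideals. The maximal ideals of $\mathcal O_{\mathcal U}$ may be labeled as $\{\mathfrak m_i\}_{i=1}^n$ such that $(\mathcal O_{\mathcal U})_{\mathfrak m_i}=\alpha_i$ for each $i\in\{1,\ldots,n\}$. Therefore $\mathcal U$ defines an irredundant essential representation of $\mathcal O_{\mathcal U}$.
   Context: $D$ is a 2-dimensional regular local ring with quotient field $F$. For a 2-dimensional regular local ring $S$ with maximal ideal $\mathfrak m_S$, a local quadratic transform of $S$ is a localization of $S[\mathfrak m_S/a]$ (with $a\in\mathfrak m_S\setminus\mathfrak m_S^2$) at a height 2 maximal ideal. $Q(D)$ is the set of all rings obtained from $D$ by a finite (possibly zero) number of successive local quadratic transforms; it is the set of all 2-dimensional regular local rings with quotient field $F$ that dominate $D$. For $\mathcal U\subseteq Q(D)$, $\mathcal O_{\mathcal U}=\bigcap_{\alpha\in\mathcal U}\alpha$ (intersection inside $F$, an empty intersection being $F$). $\mathcal U$ defines an essential representation of $\mathcal O_{\mathcal U}$ if each $\alpha\in\mathcal U$ is a localization of $\mathcal O_{\mathcal U}$; the representation is irredundant if $\mathcal O_{\mathcal U}\subsetneq\mathcal O_{\mathcal U\setminus\{\alpha\}}$ for each $\alpha\in\mathcal U$.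 *)

theory Defs
  imports
    "HOL-Algebra.Ring_Divisibility"
    "HOL-Algebra.Ideal_Product"
    "HOL-Algebra.Generated_Rings"
    "HOL-Library.Extended_Nat"
begin

definition prime_chain :: "('a, 'b) ring_scheme \<Rightarrow> nat \<Rightarrow> (nat \<Rightarrow> 'a set) \<Rightarrow> bool" where
  "prime_chain R n c \<longleftrightarrow> (\<forall>i\<le>n. primeideal (c i) R) \<and> (\<forall>i<n. c i \<subset> c (Suc i))"

definition krull_dim :: "('a, 'b) ring_scheme \<Rightarrow> enat" where
  "krull_dim R = (SUP n\<in>{n. \<exists>c. prime_chain R n c}. enat n)"

definition height :: "('a, 'b) ring_scheme \<Rightarrow> 'a set \<Rightarrow> enat" where
  "height R P = (SUP n\<in>{n. \<exists>c. prime_chain R n c \<and> c n = P}. enat n)"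

definition regular_local_ring :: "('a, 'b) ring_scheme \<Rightarrow> bool" where
  "regular_local_ring R \<longleftrightarrow>
     cring R \<and> noetherian_ring R \<and> (\<exists>!M. maximalideal M R) \<and>
     (\<exists>G\<subseteq>carrier R. finite G \<and> maximalideal (genideal R G) R \<and> enat (card G) = krull_dim R)"

text \<open>
  All rings below are subrings of a fixed field \<open>F\<close>; a subring is represented by its carrier
  set \<open>S\<close>, and regarded as a ring it is \<open>F\<lparr>carrier := S\<rparr>\<close>. Localizations are formed
  inside \<open>F\<close>, so that equalities and inclusions between rings are literal.
\<close>

definition fractions :: "('a, 'b) ring_scheme \<Rightarrow> 'a set \<Rightarrow> 'a set \<Rightarrow> 'a set" where
  "fractions F S M = {a \<otimes>\<^bsub>F\<^esub> inv\<^bsub>F\<^esub> b | a b. a \<in> S \<and> b \<in> M}"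

definition localization_at :: "('a, 'b) ring_scheme \<Rightarrow> 'a set \<Rightarrow> 'a set \<Rightarrow> 'a set" where
  "localization_at F S P = fractions F S (S - P)"

definition is_localization_of :: "('a, 'b) ring_scheme \<Rightarrow> 'a set \<Rightarrow> 'a set \<Rightarrow> bool" where
  "is_localization_of F T S \<longleftrightarrow>
     (\<exists>M. submonoid M (F\<lparr>carrier := S\<rparr>) \<and> \<zero>\<^bsub>F\<^esub> \<notin> M \<and> T = fractions F S M)"

definition has_quotient_field :: "('a, 'b) ring_scheme \<Rightarrow> 'a set \<Rightarrow> bool" where
  "has_quotient_field F S \<longleftrightarrow> subring S F \<and> fractions F S (S - {\<zero>\<^bsub>F\<^esub>}) = carrier F"

definition regular_noetherian_domain :: "('a, 'b) ring_scheme \<Rightarrow> 'a set \<Rightarrow> bool" where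
  "regular_noetherian_domain F S \<longleftrightarrow>
     subring S F \<and> noetherian_domain (F\<lparr>carrier := S\<rparr>) \<and>
     (\<forall>P. primeideal P (F\<lparr>carrier := S\<rparr>) \<longrightarrow>
        regular_local_ring (F\<lparr>carrier := localization_at F S P\<rparr>))"

definition two_dim_regular_local_ring :: "('a, 'b) ring_scheme \<Rightarrow> 'a set \<Rightarrow> bool" where
  "two_dim_regular_local_ring F S \<longleftrightarrow>
     subring S F \<and> regular_local_ring (F\<lparr>carrier := S\<rparr>) \<and> krull_dim (F\<lparr>carrier := S\<rparr>) = 2"

text \<open>The ring \<open>S[\<mm>/a]\<close> generated by \<open>S\<close> and all quotients \<open>x / a\<close> with \<open>x \<in> \<mm>\<close>.\<close>

definition blowup_chart :: "('a, 'b) ring_scheme \<Rightarrow> 'a set \<Rightarrow> 'a set \<Rightarrow> 'a \<Rightarrow> 'a set" where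
  "blowup_chart F S \<mm> a = generate_ring F (S \<union> {x \<otimes>\<^bsub>F\<^esub> inv\<^bsub>F\<^esub> a | x. x \<in> \<mm>})"

definition local_quadratic_transform :: "('a, 'b) ring_scheme \<Rightarrow> 'a set \<Rightarrow> 'a set \<Rightarrow> bool" where
  "local_quadratic_transform F S T \<longleftrightarrow>
     (\<exists>\<mm> a P. maximalideal \<mm> (F\<lparr>carrier := S\<rparr>) \<and>
        a \<in> \<mm> - ideal_prod (F\<lparr>carrier := S\<rparr>) \<mm> \<mm> \<and>
        maximalideal P (F\<lparr>carrier := blowup_chart F S \<mm> a\<rparr>) \<and>
        height (F\<lparr>carrier := blowup_chart F S \<mm> a\<rparr>) P = 2 \<and>
        T = localization_at F (blowup_chart F S \<mm> a) P)"

inductive_set quadratic_tree :: "('a, 'b) ring_scheme \<Rightarrow> 'a set \<Rightarrow> 'a set set"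
  for F :: "('a, 'b) ring_scheme" and D :: "'a set" where
  base: "D \<in> quadratic_tree F D"
| step: "S \<in> quadratic_tree F D \<Longrightarrow> local_quadratic_transform F S T \<Longrightarrow> T \<in> quadratic_tree F D"

text \<open>Intersecting with \<open>carrier F\<close> makes the intersection of the empty family equal to \<open>F\<close>.\<close>

definition ring_inter :: "('a, 'b) ring_scheme \<Rightarrow> 'a set set \<Rightarrow> 'a set" where
  "ring_inter F U = carrier F \<inter> \<Inter>U"

definition essential_representation :: "('a, 'b) ring_scheme \<Rightarrow> 'a set set \<Rightarrow> bool" where
  "essential_representation F U \<longleftrightarrow> (\<forall>\<alpha>\<in>U. is_localization_of F \<alpha> (ring_inter F U))"

definition irredundant_representation :: "('a, 'b) ring_scheme \<Rightarrow> 'a set set \<Rightarrow> bool" where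
  "irredundant_representation F U \<longleftrightarrow> (\<forall>\<alpha>\<in>U. ring_inter F U \<subset> ring_inter F (U - {\<alpha>}))"

end

theory Submission
  imports Defs
begin

text \<open>
  Let \<open>S\<close> be a two-dimensional Noetherian local domain with maximal ideal \<open>(x, y)\<close>. An ascending-chain
  argument shows that every element outside \<open>xS\<close> is congruent modulo \<open>x\<close> to a unit times a power of
  \<open>y\<close>, and no power of \<open>y\<close> lies in \<open>xS\<close>. This makes \<open>xS\<close> prime, makes every
  height-one prime principal, and survives a quadratic transform: by the relation \<open>at = b\<close>, the chart
  \<open>S[t]\<close> with \<open>t = b/a\<close> is modulo \<open>a\<close> a polynomial ring over the residue field, so a maximal ideal
  over \<open>a\<close> is generated by \<open>a\<close> and a monic polynomial in \<open>t\<close>.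

  A local ring dominates at most one quadratic transform of \<open>S\<close>, so \<open>Q(D)\<close> is a tree and every finite antichain
  arises from \<open>{D}\<close> by repeatedly replacing some \<open>\<beta>\<close> by finitely many of its quadratic transforms. One such
  replacement preserves the property that each member is a localization of the intersection. Indeed, let \<open>p\<close> be the
  centre of \<open>\<beta>\<close> on the old intersection. It becomes principal in all new members, and homogeneous prime
  avoidance provides, for some \<open>r \<ge> 1\<close>, an element \<open>c\<close> that generates \<open>p\<^sup>r\<close> in all of them; the
  fractions with numerator in \<open>p\<^sup>r\<close> and denominator \<open>c\<close> then lie in the new intersection. Once all members are localizations, the
  remaining claims follow as for any finite intersection of local rings.
\<close>

text \<open>The exponent r is forced by residue fields: over a finite residue field every degree-one
  candidate may become divisible by something in the maximal ideal of some new member, so an element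
  of p itself need not generate p in all of them, and a form of higher degree is sought. Dimension
  is detected by a single prime strictly between zero and a maximal ideal with two generators.
  Two-dimensionality and regularity of a quadratic transform then need no dimension formula: the
  exceptional prime, generated by a, is the required witness. Quotient rings are never formed.
  Everything lives in subsets of the field, congruences are equations with an explicit remainder,
  and polynomials in b/a are values in the field, so their degree and leading coefficient must be
  controlled through a t = b. The relation \<open>quadratic\<close> forgets chart and height and
  keeps domination, strictness and a generation property. These suffice for uniqueness of the next
  step in the tree and for the replacement step. In the induction the parent of a deepest member is
  put back, so every member above this parent is exactly one step away from it.\<close>

lemma krull_dim_eqI:
  assumes "prime_chain A n c" and "\<And>c. \<not> prime_chain A (Suc n) c"
  shows "krull_dim A = enat n"
proof -
  have le: "m \<le> n" if "prime_chain A m d" for m d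
  proof (rule ccontr)
    assume "\<not> m \<le> n"
    \<comment> \<open>An initial segment of a chain is a chain, so excluding the single length
      \<open>Suc n\<close> excludes all longer ones.\<close>
    hence "prime_chain A (Suc n) d" using that by (auto simp: prime_chain_def)
    thus False using assms(2) by blast
  qed
  show ?thesis
    unfolding krull_dim_def
  proof (rule antisym)
    show "(SUP n\<in>{n. \<exists>c. prime_chain A n c}. enat n) \<le> enat n" using le by (auto intro!: SUP_least)
    show "enat n \<le> (SUP n\<in>{n. \<exists>c. prime_chain A n c}. enat n)" using assms(1) by (auto intro!: SUP_upper)
  qed
qed

text \<open>Recovers an actual chain of length at least two from a dimension or a height that is
  known only as the supremum 2.\<close>

lemma le_enat_SUP_imp:
  assumes "enat (Suc n) \<le> (SUP m\<in>{m. P m}. enat m)"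
  shows "\<exists>m>n. P m"
proof (rule ccontr)
  assume n: "\<not> (\<exists>m>n. P m)"
  have "(SUP m\<in>{m. P m}. enat m) \<le> enat n" using n by (auto intro!: SUP_least simp: not_less)
  hence "enat (Suc n) \<le> enat n" using assms by (rule order_trans[rotated])
  thus False by simp
qed

context field
begin

subsection \<open>Ideals of subrings of a field\<close>

text \<open>The notions below speak of carrier sets inside the field, so all computations use the
  field operations. Closure under negation is not demanded: for a subring it comes from
  multiplication by minus one.\<close>

definition ideal_in :: "'a set \<Rightarrow> 'a set \<Rightarrow> bool" where
  "ideal_in S I \<longleftrightarrow> I \<subseteq> S \<and> \<zero> \<in> I \<and> (\<forall>x\<in>I. \<forall>y\<in>I. x \<oplus> y \<in> I) \<and> (\<forall>s\<in>S. \<forall>x\<in>I. s \<otimes> x \<in> I)"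

definition prime_in :: "'a set \<Rightarrow> 'a set \<Rightarrow> bool" where
  "prime_in S P \<longleftrightarrow> ideal_in S P \<and> \<one> \<notin> P \<and> (\<forall>x\<in>S. \<forall>y\<in>S. x \<otimes> y \<in> P \<longrightarrow> x \<in> P \<or> y \<in> P)"

definition maximal_in :: "'a set \<Rightarrow> 'a set \<Rightarrow> bool" where
  "maximal_in S M \<longleftrightarrow> ideal_in S M \<and> \<one> \<notin> M \<and> (\<forall>J. ideal_in S J \<and> M \<subseteq> J \<and> \<one> \<notin> J \<longrightarrow> J = M)"

definition noetherian_in :: "'a set \<Rightarrow> bool" where
  "noetherian_in S \<longleftrightarrow> (\<forall>I. ideal_in S I \<longrightarrow>
     (\<exists>A. finite A \<and> A \<subseteq> I \<and> (\<forall>J. ideal_in S J \<and> A \<subseteq> J \<longrightarrow> I \<subseteq> J)))"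

text \<open>Zero is listed separately because nothing is known about the value of
  \<open>inv \<zero>\<close>.\<close>

definition nonunits :: "'a set \<Rightarrow> 'a set" where
  "nonunits S = {x \<in> S. x = \<zero> \<or> inv x \<notin> S}"

text \<open>Stating locality through nonunits makes the maximal ideal an explicit set, and
  domination of local rings becomes inclusion of the sets of nonunits.\<close>

definition local_in :: "'a set \<Rightarrow> bool" where
  "local_in S \<longleftrightarrow> subring S R \<and> ideal_in S (nonunits S)"

definition multiples :: "'a set \<Rightarrow> 'a \<Rightarrow> 'a set" where
  "multiples S x = {x \<otimes> s | s. s \<in> S}"

section \<open>Cancellation rules for computing in the field\<close>

lemma inv_carrier [simp, intro]: "x \<in> carrier R \<Longrightarrow> x \<noteq> \<zero> \<Longrightarrow> inv x \<in> carrier R"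
  by (simp add: field_Units)

lemma mult_inv [simp]:
  assumes "x \<in> carrier R" "x \<noteq> \<zero>"
  shows "x \<otimes> inv x = \<one>" "inv x \<otimes> x = \<one>"
  using assms by (simp_all add: field_Units)

lemma inv_nonzero [simp]: "x \<in> carrier R \<Longrightarrow> x \<noteq> \<zero> \<Longrightarrow> inv x \<noteq> \<zero>"
  by (metis mult_inv(1) r_null zero_not_one)

lemma inv_inv_nonzero [simp]: "x \<in> carrier R \<Longrightarrow> x \<noteq> \<zero> \<Longrightarrow> inv (inv x) = x"
  by (simp add: field_Units)

lemma mult_nonzero [simp]:
  "x \<in> carrier R \<Longrightarrow> y \<in> carrier R \<Longrightarrow> x \<otimes> y = \<zero> \<longleftrightarrow> x = \<zero> \<or> y = \<zero>"
  using integral_iff by blast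

lemma inv_mult_nonzero:
  assumes "x \<in> carrier R" "y \<in> carrier R" "x \<noteq> \<zero>" "y \<noteq> \<zero>"
  shows "inv (x \<otimes> y) = inv x \<otimes> inv y"
proof -
  have "(x \<otimes> y) \<otimes> (inv x \<otimes> inv y) = (x \<otimes> inv x) \<otimes> (y \<otimes> inv y)"
    using assms by (simp del: mult_inv add: m_ac)
  thus ?thesis using assms by (intro comm_inv_char) auto
qed

lemma mult_inv_cancel:
  assumes "x \<in> carrier R" "x \<noteq> \<zero>" "y \<in> carrier R"
  shows "x \<otimes> (inv x \<otimes> y) = y" "inv x \<otimes> (x \<otimes> y) = y" "x \<otimes> (y \<otimes> inv x) = y" "inv x \<otimes> (y \<otimes> x) = y"
    "(x \<otimes> y) \<otimes> inv x = y" "(y \<otimes> x) \<otimes> inv x = y" "(y \<otimes> inv x) \<otimes> x = y"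
proof -
  have i: "inv x \<in> carrier R" using assms by simp
  show "x \<otimes> (inv x \<otimes> y) = y" "inv x \<otimes> (x \<otimes> y) = y"
    using assms i by (simp_all add: m_assoc [symmetric])
  thus "x \<otimes> (y \<otimes> inv x) = y" "inv x \<otimes> (y \<otimes> x) = y" "(x \<otimes> y) \<otimes> inv x = y"
    "(y \<otimes> x) \<otimes> inv x = y" "(y \<otimes> inv x) \<otimes> x = y"
    using assms i by (simp_all add: m_ac)
qed

text \<open>Once terms are ordered by associativity and commutativity, an element and its inverse
  may end up separated by other factors. This rule and its variants, also those for sums below,
  cancel such separated pairs.\<close>

lemma mult_inv_cancel2:
  assumes "x \<in> carrier R" "x \<noteq> \<zero>" "y \<in> carrier R" "z \<in> carrier R"
  shows "x \<otimes> (y \<otimes> (inv x \<otimes> z)) = y \<otimes> z" "x \<otimes> (y \<otimes> (z \<otimes> inv x)) = y \<otimes> z"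
proof -
  have i: "inv x \<in> carrier R" using assms by simp
  have "x \<otimes> (y \<otimes> (inv x \<otimes> z)) = (x \<otimes> inv x) \<otimes> (y \<otimes> z)"
    using assms i by (simp del: mult_inv add: m_ac)
  thus "x \<otimes> (y \<otimes> (inv x \<otimes> z)) = y \<otimes> z" using assms by simp
  thus "x \<otimes> (y \<otimes> (z \<otimes> inv x)) = y \<otimes> z" using assms i by (simp add: m_ac)
qed

lemma mult_inv_cancel3:
  assumes "x \<in> carrier R" "x \<noteq> \<zero>" "y \<in> carrier R" "z \<in> carrier R" "w \<in> carrier R"
  shows "x \<otimes> (y \<otimes> (z \<otimes> (inv x \<otimes> w))) = y \<otimes> (z \<otimes> w)"
  using mult_inv_cancel2(1)[of x "y \<otimes> z" w] assms by (simp add: m_assoc)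

lemma add_minus_cancel:
  assumes "x \<in> carrier R" "y \<in> carrier R" "z \<in> carrier R" "w \<in> carrier R" "v \<in> carrier R"
  shows "x \<oplus> (y \<oplus> \<ominus> x) = y" "x \<oplus> (y \<oplus> (\<ominus> x \<oplus> z)) = y \<oplus> z"
    "x \<oplus> (y \<oplus> (z \<oplus> \<ominus> x)) = y \<oplus> z" "x \<oplus> (y \<oplus> (z \<oplus> (\<ominus> x \<oplus> w))) = y \<oplus> (z \<oplus> w)"
    "x \<oplus> (y \<oplus> (z \<oplus> (w \<oplus> \<ominus> x))) = y \<oplus> (z \<oplus> w)"
    "x \<oplus> (y \<oplus> (z \<oplus> (w \<oplus> (\<ominus> x \<oplus> v)))) = y \<oplus> (z \<oplus> (w \<oplus> v))"
proof -
  have *: "x \<oplus> (y \<oplus> (\<ominus> x \<oplus> z)) = y \<oplus> z" if "y \<in> carrier R" "z \<in> carrier R" for y z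
  proof -
    have "x \<oplus> (y \<oplus> (\<ominus> x \<oplus> z)) = x \<oplus> (\<ominus> x \<oplus> (y \<oplus> z))"
      using that assms(1) by (simp del: r_neg r_neg1 r_neg2 add: a_ac)
    thus ?thesis using that assms(1) by (simp add: r_neg2)
  qed
  show "x \<oplus> (y \<oplus> (\<ominus> x \<oplus> z)) = y \<oplus> z" using * assms by simp
  show "x \<oplus> (y \<oplus> \<ominus> x) = y" using *[of y \<zero>] assms by simp
  show "x \<oplus> (y \<oplus> (z \<oplus> \<ominus> x)) = y \<oplus> z" using *[of "y \<oplus> z" \<zero>] assms by (simp add: a_assoc)
  show "x \<oplus> (y \<oplus> (z \<oplus> (\<ominus> x \<oplus> w))) = y \<oplus> (z \<oplus> w)"
    using *[of "y \<oplus> z" w] assms by (simp add: a_assoc)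
  show "x \<oplus> (y \<oplus> (z \<oplus> (w \<oplus> \<ominus> x))) = y \<oplus> (z \<oplus> w)"
    using *[of "y \<oplus> (z \<oplus> w)" \<zero>] assms by (simp add: a_assoc)
  show "x \<oplus> (y \<oplus> (z \<oplus> (w \<oplus> (\<ominus> x \<oplus> v)))) = y \<oplus> (z \<oplus> (w \<oplus> v))"
    using *[of "y \<oplus> (z \<oplus> w)" v] assms by (simp add: a_assoc)
qed

lemmas field_arith = cring_simprules add_minus_cancel mult_inv_cancel mult_inv_cancel2 inv_mult_nonzero

lemma subring_carrier: "subring S R \<Longrightarrow> x \<in> S \<Longrightarrow> x \<in> carrier R"
  using subringE(1) by blast

lemmas subring_closed = subringE(2,3,5,6,7) subring_carrier

lemma subring_pow: "subring S R \<Longrightarrow> x \<in> S \<Longrightarrow> x [^] (n::nat) \<in> S"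
  by (induction n) (auto simp: subring_closed)

lemma subring_simps:
  assumes "subring S R"
  shows "\<zero> \<in> S" "\<one> \<in> S" "x \<in> S \<Longrightarrow> \<ominus> x \<in> S" "x \<in> S \<Longrightarrow> y \<in> S \<Longrightarrow> x \<otimes> y \<in> S"
    "x \<in> S \<Longrightarrow> y \<in> S \<Longrightarrow> x \<oplus> y \<in> S" "x \<in> S \<Longrightarrow> y \<in> S \<Longrightarrow> x \<ominus> y \<in> S"
    "x \<in> S \<Longrightarrow> x [^] (n::nat) \<in> S" "x \<in> S \<Longrightarrow> x \<in> carrier R"
  using assms by (auto simp: subring_closed subring_pow a_minus_def)

lemma ideal_in_D:
  assumes "ideal_in S I"
  shows "I \<subseteq> S" "x \<in> I \<Longrightarrow> x \<in> S" "\<zero> \<in> I" "x \<in> I \<Longrightarrow> y \<in> I \<Longrightarrow> x \<oplus> y \<in> I"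
    "s \<in> S \<Longrightarrow> x \<in> I \<Longrightarrow> s \<otimes> x \<in> I"
  using assms unfolding ideal_in_def by auto

lemma ideal_in_r:
  assumes "subring S R" "ideal_in S I" "x \<in> I" "s \<in> S"
  shows "x \<otimes> s \<in> I"
proof -
  have "x \<otimes> s = s \<otimes> x"
    using assms ideal_in_D(2)[OF assms(2,3)] by (simp add: m_comm subring_carrier[OF assms(1)])
  thus ?thesis using ideal_in_D(5)[OF assms(2,4,3)] by simp
qed

lemma ideal_in_minus:
  assumes "subring S R" "ideal_in S I" "x \<in> I"
  shows "\<ominus> x \<in> I"
proof -
  have "\<ominus> x = (\<ominus> \<one>) \<otimes> x"
    using assms ideal_in_D(2)[OF assms(2,3)] by (simp add: l_minus subring_carrier[OF assms(1)])
  thus ?thesis using ideal_in_D(5)[OF assms(2) _ assms(3), of "\<ominus> \<one>"] subring_simps[OF assms(1)] by simp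
qed

lemma ideal_in_simps:
  assumes "subring S R" "ideal_in S I"
  shows "x \<in> I \<Longrightarrow> x \<in> S" "\<zero> \<in> I" "x \<in> I \<Longrightarrow> y \<in> I \<Longrightarrow> x \<oplus> y \<in> I"
    "s \<in> S \<Longrightarrow> x \<in> I \<Longrightarrow> s \<otimes> x \<in> I" "s \<in> S \<Longrightarrow> x \<in> I \<Longrightarrow> x \<otimes> s \<in> I" "x \<in> I \<Longrightarrow> \<ominus> x \<in> I"
    "x \<in> I \<Longrightarrow> y \<in> I \<Longrightarrow> x \<ominus> y \<in> I" "x \<in> I \<Longrightarrow> x \<in> carrier R"
  using assms ideal_in_D[of S I] ideal_in_r[of S I] ideal_in_minus[of S I] subring_carrier[of S]
  by (auto simp: a_minus_def)

lemma ideal_in_add_cancel: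
  assumes "subring S R" "ideal_in S I" "x \<oplus> y \<in> I" "y \<in> I" "x \<in> S"
  shows "x \<in> I"
proof -
  have "y \<in> carrier R" "x \<in> carrier R" using assms ideal_in_simps(8) subring_carrier by auto
  hence "x = (x \<oplus> y) \<oplus> \<ominus> y" by (simp add: a_assoc r_neg)
  thus ?thesis using assms ideal_in_simps(3,6) by metis
qed

lemma ideal_in_one: "subring S R \<Longrightarrow> ideal_in S I \<Longrightarrow> \<one> \<in> I \<Longrightarrow> I = S"
  using ideal_in_simps(1,4)[of S I] subring_carrier[of S] by (auto; metis r_one)

section \<open>Translation between ring-theoretic notions and carrier sets\<close>

lemma ideal_iff:
  assumes S: "subring S R"
  shows "ideal I (R\<lparr>carrier := S\<rparr>) \<longleftrightarrow> ideal_in S I"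
proof
  assume I: "ideal I (R\<lparr>carrier := S\<rparr>)"
  note a = ideal.axioms(1)[OF I]
  show "ideal_in S I"
    unfolding ideal_in_def
    using additive_subgroup.a_subset[OF a] additive_subgroup.a_closed[OF a] ideal.I_l_closed[OF I]
      additive_subgroup.zero_closed[OF a] by auto
next
  have S': "ring (R\<lparr>carrier := S\<rparr>)" using subring_is_ring[OF S] .
  assume I: "ideal_in S I"
  note i = ideal_in_simps[OF S I]
  have "subgroup I (add_monoid (R\<lparr>carrier := S\<rparr>))"
  proof (rule group.subgroupI)
    show "group (add_monoid (R\<lparr>carrier := S\<rparr>))"
      by (rule abelian_group.a_group[OF ring.is_abelian_group[OF S']])
    show "I \<noteq> {}" using i(2) by blast
  next
    fix x assume x: "x \<in> I"
    have "inv\<^bsub>add_monoid (R\<lparr>carrier := S\<rparr>)\<^esub> x = \<ominus> x"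
      using abelian_group.minus_equality[OF ring.is_abelian_group[OF S'], of "\<ominus> x" x]
        x i(1)[of x] i(8)[of x] subring_simps[OF S] by (simp add: a_inv_def[of "R\<lparr>carrier := S\<rparr>"] l_neg)
    thus "inv\<^bsub>add_monoid (R\<lparr>carrier := S\<rparr>)\<^esub> x \<in> I" using x i(6) by simp
  qed (use i in auto)
  thus "ideal I (R\<lparr>carrier := S\<rparr>)"
    using i by (intro idealI S') auto
qed

lemma cring_sub: "subring S R \<Longrightarrow> cring (R\<lparr>carrier := S\<rparr>)"
  using subcringI' subcring_iff subringE(1) by blast

lemma domain_sub: "subring S R \<Longrightarrow> domain (R\<lparr>carrier := S\<rparr>)"
  by (intro domain.intro[OF cring_sub] domain_axioms.intro) (auto simp: subring_simps)

lemma primeideal_iff: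
  assumes S: "subring S R"
  shows "primeideal P (R\<lparr>carrier := S\<rparr>) \<longleftrightarrow> prime_in S P"
proof
  assume p: "primeideal P (R\<lparr>carrier := S\<rparr>)"
  have P: "ideal_in S P" using primeideal.axioms(1)[OF p] ideal_iff[OF S] by blast
  show "prime_in S P"
    unfolding prime_in_def using P primeideal.I_notcarr[OF p] primeideal.I_prime[OF p] ideal_in_one[OF S P] by auto
next
  assume P: "prime_in S P"
  hence i: "ideal_in S P" by (simp add: prime_in_def)
  show "primeideal P (R\<lparr>carrier := S\<rparr>)"
    using P i ideal_iff[OF S] subring_simps[OF S]
    by (intro primeidealI cring_sub S) (auto simp: prime_in_def)
qed

lemma maximalideal_iff:
  assumes S: "subring S R"
  shows "maximalideal M (R\<lparr>carrier := S\<rparr>) \<longleftrightarrow> maximal_in S M"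
proof
  assume p: "maximalideal M (R\<lparr>carrier := S\<rparr>)"
  have M: "ideal_in S M" using maximalideal.axioms(1)[OF p] ideal_iff[OF S] by blast
  show "maximal_in S M"
    unfolding maximal_in_def
  proof (intro conjI allI impI M)
    show "\<one> \<notin> M" using ideal_in_one[OF S M] maximalideal.I_notcarr[OF p] by auto
    fix J assume J: "ideal_in S J \<and> M \<subseteq> J \<and> \<one> \<notin> J"
    have "ideal J (R\<lparr>carrier := S\<rparr>)" using J ideal_iff[OF S] by blast
    hence "J = M \<or> J = S" using maximalideal.I_maximal[OF p] J ideal_in_D(1)[of S J] by auto
    thus "J = M" using J subring_simps(2)[OF S] by auto
  qed
next
  assume M: "maximal_in S M"
  hence i: "ideal_in S M" by (simp add: maximal_in_def)
  show "maximalideal M (R\<lparr>carrier := S\<rparr>)"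
  proof (rule maximalidealI)
    show "ideal M (R\<lparr>carrier := S\<rparr>)" using i ideal_iff[OF S] by blast
    show "carrier (R\<lparr>carrier := S\<rparr>) \<noteq> M"
      using M subring_simps(2)[OF S] by (auto simp: maximal_in_def)
    fix J assume J: "ideal J (R\<lparr>carrier := S\<rparr>)" "M \<subseteq> J"
    hence J': "ideal_in S J" using ideal_iff[OF S] by blast
    show "J = M \<or> J = carrier (R\<lparr>carrier := S\<rparr>)"
      using M J J' ideal_in_one[OF S J'] by (auto simp: maximal_in_def)
  qed
qed

lemma noetherian_iff:
  assumes S: "subring S R"
  shows "noetherian_ring (R\<lparr>carrier := S\<rparr>) \<longleftrightarrow> noetherian_in S"
proof -
  have S': "ring (R\<lparr>carrier := S\<rparr>)" using subring_is_ring[OF S] .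
  have *: "(I = genideal (R\<lparr>carrier := S\<rparr>) A) \<longleftrightarrow> A \<subseteq> I \<and> (\<forall>J. ideal_in S J \<and> A \<subseteq> J \<longrightarrow> I \<subseteq> J)"
    if I: "ideal_in S I" and A: "A \<subseteq> S" for I A
  proof
    assume "I = genideal (R\<lparr>carrier := S\<rparr>) A"
    thus "A \<subseteq> I \<and> (\<forall>J. ideal_in S J \<and> A \<subseteq> J \<longrightarrow> I \<subseteq> J)"
      unfolding genideal_def ideal_iff[OF S] by auto
  next
    assume "A \<subseteq> I \<and> (\<forall>J. ideal_in S J \<and> A \<subseteq> J \<longrightarrow> I \<subseteq> J)"
    thus "I = genideal (R\<lparr>carrier := S\<rparr>) A"
      unfolding genideal_def ideal_iff[OF S] using I by (auto simp: ideal_in_def)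
  qed
  have "noetherian_ring (R\<lparr>carrier := S\<rparr>) \<longleftrightarrow>
    (\<forall>I. ideal_in S I \<longrightarrow> (\<exists>A\<subseteq>S. finite A \<and> I = genideal (R\<lparr>carrier := S\<rparr>) A))"
    using S' by (auto simp: noetherian_ring_def noetherian_ring_axioms_def ideal_iff[OF S])
  moreover have "(\<exists>A\<subseteq>S. finite A \<and> I = genideal (R\<lparr>carrier := S\<rparr>) A) \<longleftrightarrow>
      (\<exists>A. finite A \<and> A \<subseteq> I \<and> (\<forall>J. ideal_in S J \<and> A \<subseteq> J \<longrightarrow> I \<subseteq> J))" if I: "ideal_in S I" for I
  proof
    assume "\<exists>A\<subseteq>S. finite A \<and> I = genideal (R\<lparr>carrier := S\<rparr>) A"
    then obtain A where "A \<subseteq> S" "finite A" "I = genideal (R\<lparr>carrier := S\<rparr>) A" by blast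
    thus "\<exists>A. finite A \<and> A \<subseteq> I \<and> (\<forall>J. ideal_in S J \<and> A \<subseteq> J \<longrightarrow> I \<subseteq> J)"
      using *[OF I, of A] by blast
  next
    assume "\<exists>A. finite A \<and> A \<subseteq> I \<and> (\<forall>J. ideal_in S J \<and> A \<subseteq> J \<longrightarrow> I \<subseteq> J)"
    then obtain A where A: "finite A" "A \<subseteq> I \<and> (\<forall>J. ideal_in S J \<and> A \<subseteq> J \<longrightarrow> I \<subseteq> J)" by blast
    moreover have "A \<subseteq> S" using A ideal_in_D(1)[OF I] by blast
    ultimately show "\<exists>A\<subseteq>S. finite A \<and> I = genideal (R\<lparr>carrier := S\<rparr>) A"
      using *[OF I, of A] by blast
  qed
  ultimately show ?thesis unfolding noetherian_in_def by simp
qed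

lemma ideal_in_Int: "ideal_in S I \<Longrightarrow> ideal_in S J \<Longrightarrow> ideal_in S (I \<inter> J)"
  unfolding ideal_in_def by auto

lemma ideal_in_self: "subring S R \<Longrightarrow> ideal_in S S"
  unfolding ideal_in_def by (auto simp: subring_simps)

lemma ideal_in_zero: "subring S R \<Longrightarrow> ideal_in S {\<zero>}"
  unfolding ideal_in_def by (auto simp: subring_simps)

lemma ideal_in_chain_Union:
  assumes "C \<noteq> {}" "\<And>I. I \<in> C \<Longrightarrow> ideal_in S I" "\<And>I J. I \<in> C \<Longrightarrow> J \<in> C \<Longrightarrow> I \<subseteq> J \<or> J \<subseteq> I"
  shows "ideal_in S (\<Union>C)"
  unfolding ideal_in_def
proof (intro conjI ballI)
  show "\<Union>C \<subseteq> S" using assms(2) ideal_in_D(1) by blast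
  show "\<zero> \<in> \<Union>C" using assms(1,2) ideal_in_D(3) by blast
  show "s \<otimes> x \<in> \<Union>C" if "s \<in> S" "x \<in> \<Union>C" for s x using that assms(2) ideal_in_D(5) by blast
  fix x y assume "x \<in> \<Union>C" "y \<in> \<Union>C"
  then obtain I J where IJ: "x \<in> I" "y \<in> J" "I \<in> C" "J \<in> C" by blast
  then consider "I \<subseteq> J" | "J \<subseteq> I" using assms(3) by blast
  thus "x \<oplus> y \<in> \<Union>C"
  proof cases
    case 1 thus ?thesis using IJ assms(2)[of J] ideal_in_D(4)[of S J x y] by blast
  next
    case 2 thus ?thesis using IJ assms(2)[of I] ideal_in_D(4)[of S I x y] by blast
  qed
qed

lemma exists_maximal_in:
  assumes "ideal_in S I" "\<one> \<notin> I"
  obtains M where "I \<subseteq> M" "maximal_in S M"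
proof -
  let ?A = "{J. ideal_in S J \<and> I \<subseteq> J \<and> \<one> \<notin> J}"
  have "\<exists>M\<in>?A. \<forall>X\<in>?A. M \<subseteq> X \<longrightarrow> X = M"
  proof (rule subset_Zorn_nonempty)
    show "?A \<noteq> {}" using assms by auto
    fix C assume C: "C \<noteq> {}" "subset.chain ?A C"
    hence sub: "C \<subseteq> ?A" by (auto simp: subset.chain_def)
    have "ideal_in S (\<Union>C)"
      using C sub by (intro ideal_in_chain_Union) (auto simp: subset.chain_def)
    thus "\<Union>C \<in> ?A" using C sub by blast
  qed
  then obtain M where M: "M \<in> ?A" "\<forall>X\<in>?A. M \<subseteq> X \<longrightarrow> X = M" by blast
  show thesis
  proof (rule that[of M])
    show "I \<subseteq> M" using M by simp
    show "maximal_in S M" unfolding maximal_in_def using M by blast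
  qed
qed

lemma multiples_ideal:
  assumes S: "subring S R" and x: "x \<in> S"
  shows "ideal_in S (multiples S x)"
  unfolding ideal_in_def multiples_def
proof (intro conjI ballI)
  note c = subring_simps[OF S]
  show "{x \<otimes> s |s. s \<in> S} \<subseteq> S" using c x by auto
  show "\<zero> \<in> {x \<otimes> s |s. s \<in> S}" using c x by (auto intro!: exI[of _ \<zero>])
  show "y \<oplus> z \<in> {x \<otimes> s |s. s \<in> S}" if yz: "y \<in> {x \<otimes> s |s. s \<in> S}" "z \<in> {x \<otimes> s |s. s \<in> S}" for y z
  proof -
    obtain a b where "y = x \<otimes> a" "z = x \<otimes> b" "a \<in> S" "b \<in> S" using yz by auto
    hence "y \<oplus> z = x \<otimes> (a \<oplus> b)" "a \<oplus> b \<in> S" using c x by (simp_all add: r_distr)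
    thus ?thesis by blast
  qed
  show "s \<otimes> y \<in> {x \<otimes> s |s. s \<in> S}" if y: "y \<in> {x \<otimes> s |s. s \<in> S}" "s \<in> S" for y s
  proof -
    obtain a where "y = x \<otimes> a" "a \<in> S" using y by auto
    hence "s \<otimes> y = x \<otimes> (s \<otimes> a)" "s \<otimes> a \<in> S" using c x y by (simp_all add: m_lcomm)
    thus ?thesis by blast
  qed
qed

lemma multiplesI: "s \<in> S \<Longrightarrow> x \<otimes> s \<in> multiples S x"
  by (auto simp: multiples_def)

lemma multiplesE:
  assumes "z \<in> multiples S x"
  obtains s where "s \<in> S" "z = x \<otimes> s"
  using assms by (auto simp: multiples_def)

lemma multiples_self: "subring S R \<Longrightarrow> x \<in> S \<Longrightarrow> x \<in> multiples S x"
  unfolding multiples_def using subring_simps[of S] by (auto intro!: exI[of _ \<one>])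

lemma multiples_subset:
  "subring S R \<Longrightarrow> ideal_in S I \<Longrightarrow> x \<in> I \<Longrightarrow> multiples S x \<subseteq> I"
  by (auto simp: multiples_def ideal_in_simps)

lemma one_in_multiples:
  assumes "subring S R" "x \<in> S"
  shows "\<one> \<in> multiples S x \<longleftrightarrow> x \<notin> nonunits S"
proof
  note c = subring_simps[OF assms(1)]
  assume "\<one> \<in> multiples S x"
  then obtain s where s: "s \<in> S" "\<one> = x \<otimes> s" by (rule multiplesE)
  have "x \<noteq> \<zero>" using s c by auto
  moreover have "inv x = s" using s c assms by (metis comm_inv_char)
  ultimately show "x \<notin> nonunits S" using s by (simp add: nonunits_def)
next
  note c = subring_simps[OF assms(1)]
  assume "x \<notin> nonunits S"
  hence "x \<noteq> \<zero>" "inv x \<in> S" using assms by (auto simp: nonunits_def)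
  thus "\<one> \<in> multiples S x" using multiplesI[of "inv x" S x] c(8)[OF assms(2)] by simp
qed

text \<open>A nonunit generates a proper ideal, which lies in some maximal ideal and hence in the
  only one.\<close>

lemma nonunits_eq_maximal:
  assumes S: "subring S R" and M: "maximal_in S M" and u: "\<And>N. maximal_in S N \<Longrightarrow> N = M"
  shows "nonunits S = M" "local_in S"
proof -
  show eq: "nonunits S = M"
  proof (intro equalityI subsetI)
    fix x assume x: "x \<in> nonunits S"
    hence xS: "x \<in> S" by (simp add: nonunits_def)
    obtain N where "multiples S x \<subseteq> N" "maximal_in S N"
      using exists_maximal_in[OF multiples_ideal[OF S xS]] one_in_multiples[OF S xS] x by blast
    thus "x \<in> M" using u multiples_self[OF S xS] by blast
  next
    fix x assume x: "x \<in> M"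
    have i: "ideal_in S M" "\<one> \<notin> M" using M by (auto simp: maximal_in_def)
    hence xS: "x \<in> S" using x ideal_in_D by blast
    show "x \<in> nonunits S"
      using multiples_subset[OF S i(1) x] i(2) one_in_multiples[OF S xS] by blast
  qed
  show "local_in S" unfolding local_in_def eq using S M by (auto simp: maximal_in_def)
qed

lemma unit_D:
  assumes "subring S R" "x \<in> S" "x \<notin> nonunits S"
  shows "x \<noteq> \<zero>" "inv x \<in> S"
  using assms by (auto simp: nonunits_def)

lemma one_notin_nonunits: "subring S R \<Longrightarrow> \<one> \<notin> nonunits S"
  by (simp add: nonunits_def subring_simps)

lemma proper_ideal_nonunits:
  assumes S: "subring S R" and I: "ideal_in S I" "\<one> \<notin> I"
  shows "I \<subseteq> nonunits S"
proof
  fix x assume x: "x \<in> I"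
  hence xS: "x \<in> S" using I ideal_in_D by blast
  show "x \<in> nonunits S"
    using multiples_subset[OF S I(1) x] I(2) one_in_multiples[OF S xS] by blast
qed

lemma local_maximal:
  assumes "local_in S"
  shows "maximal_in S M \<longleftrightarrow> M = nonunits S"
proof -
  have S: "subring S R" and i: "ideal_in S (nonunits S)" using assms by (auto simp: local_in_def)
  show ?thesis
    using proper_ideal_nonunits[OF S] one_notin_nonunits[OF S] i
    unfolding maximal_in_def by blast
qed

lemma local_unit_add:
  assumes "local_in S" "u \<in> S" "u \<notin> nonunits S" "x \<in> nonunits S"
  shows "u \<oplus> x \<notin> nonunits S"
  using assms ideal_in_add_cancel[of S "nonunits S" u x] by (auto simp: local_in_def)

lemma unit_mult:
  assumes S: "subring S R" and "u \<in> S" "v \<in> S" "u \<notin> nonunits S" "v \<notin> nonunits S"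
  shows "u \<otimes> v \<notin> nonunits S"
  using assms subring_simps[OF S] by (auto simp: nonunits_def inv_mult_nonzero)

lemma unit_inv:
  assumes S: "subring S R" and "u \<in> S" "u \<notin> nonunits S"
  shows "inv u \<in> S" "inv u \<notin> nonunits S"
  using assms subring_simps[OF S] by (auto simp: nonunits_def)

section \<open>Chain condition and Nakayama's lemma\<close>

lemma noetherian_chain:
  assumes S: "subring S R" and N: "noetherian_in S"
    and I: "\<And>n::nat. ideal_in S (I n)" and mono: "\<And>n. I n \<subseteq> I (Suc n)"
  shows "\<exists>N. \<forall>n\<ge>N. I n = I N"
proof -
  have mono': "m \<le> n \<Longrightarrow> I m \<subseteq> I n" for m n using lift_Suc_mono_le[of I] mono by blast
  have "ideal_in S (\<Union>(range I))"
    using I mono' by (intro ideal_in_chain_Union) (auto, metis nat_le_linear subsetD)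
  then obtain A where A: "finite A" "A \<subseteq> \<Union>(range I)"
    "\<And>J. ideal_in S J \<Longrightarrow> A \<subseteq> J \<Longrightarrow> \<Union>(range I) \<subseteq> J"
    using N unfolding noetherian_in_def by meson
  have "\<exists>N. A \<subseteq> I N" using A(1,2)
  proof (induction A)
    case (insert x A)
    then obtain N m where "A \<subseteq> I N" "x \<in> I m" by auto
    hence "insert x A \<subseteq> I (max N m)" using mono'[of N "max N m"] mono'[of m "max N m"] by auto
    thus ?case by blast
  qed simp
  then obtain N where "A \<subseteq> I N" ..
  hence "\<Union>(range I) \<subseteq> I N" using A(3) I by blast
  hence "\<forall>n\<ge>N. I n = I N" using mono' by blast
  thus ?thesis ..
qed

lemma ideal_add_multiples:
  assumes S: "subring S R" and J: "ideal_in S J" and z: "z \<in> S"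
  shows "ideal_in S {j \<oplus> s \<otimes> z | j s. j \<in> J \<and> s \<in> S}" (is "ideal_in S ?I")
  unfolding ideal_in_def
proof (intro conjI ballI)
  note c = subring_simps[OF S] and j = ideal_in_simps[OF S J]
  show "?I \<subseteq> S" using c j z by auto
  show "\<zero> \<in> ?I" using c j z by (auto intro!: exI[of _ \<zero>])
  show "x \<oplus> y \<in> ?I" if "x \<in> ?I" "y \<in> ?I" for x y
  proof -
    from that obtain a b s t where "a \<in> J" "b \<in> J" "s \<in> S" "t \<in> S" "x = a \<oplus> s \<otimes> z" "y = b \<oplus> t \<otimes> z" by auto
    hence "x \<oplus> y = (a \<oplus> b) \<oplus> (s \<oplus> t) \<otimes> z" "a \<oplus> b \<in> J" "s \<oplus> t \<in> S"
      using z by (simp_all add: c j field_arith)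
    thus ?thesis by blast
  qed
  show "r \<otimes> x \<in> ?I" if "x \<in> ?I" "r \<in> S" for x r
  proof -
    from that obtain a s where "a \<in> J" "s \<in> S" "x = a \<oplus> s \<otimes> z" by auto
    hence "r \<otimes> x = r \<otimes> a \<oplus> (r \<otimes> s) \<otimes> z" "r \<otimes> a \<in> J" "r \<otimes> s \<in> S"
      using z that by (simp_all add: c j field_arith)
    thus ?thesis by blast
  qed
qed

text \<open>Serves both as Nakayama's lemma and as Krull's intersection theorem: the ideals
  \<open>J + (z\<^sub>k)\<close> form an ascending chain.\<close>

lemma nakayama_sequence:
  assumes L: "local_in S" and N: "noetherian_in S" and J: "ideal_in S J" and x: "x \<in> nonunits S"
    and z: "\<And>k::nat. z k \<in> S" and step: "\<And>k. \<exists>j\<in>J. z k = j \<oplus> x \<otimes> z (Suc k)"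
  shows "z 0 \<in> J"
proof -
  have S: "subring S R" and M: "ideal_in S (nonunits S)" using L by (auto simp: local_in_def)
  note c = subring_simps[OF S] and j = ideal_in_simps[OF S J] and m = ideal_in_simps[OF S M]
  define I where "I k = {j \<oplus> s \<otimes> z k | j s. j \<in> J \<and> s \<in> S}" for k
  have I: "ideal_in S (I k)" for k unfolding I_def by (rule ideal_add_multiples[OF S J z])
  have zI: "z k \<in> I k" for k proof -
    have "z k = \<zero> \<oplus> \<one> \<otimes> z k" using c z[of k] by simp
    thus ?thesis unfolding I_def using c j by blast
  qed
  have mono: "I k \<subseteq> I (Suc k)" for k
  proof
    fix w assume "w \<in> I k"
    then obtain a s where w: "a \<in> J" "s \<in> S" "w = a \<oplus> s \<otimes> z k" by (auto simp: I_def)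
    obtain b where b: "b \<in> J" "z k = b \<oplus> x \<otimes> z (Suc k)" using step by blast
    have "w = (a \<oplus> s \<otimes> b) \<oplus> (s \<otimes> x) \<otimes> z (Suc k)"
      using w b x z[of "Suc k"] by (simp add: c j m field_arith)
    moreover have "a \<oplus> s \<otimes> b \<in> J" "s \<otimes> x \<in> S" using w b x by (simp_all add: c j m)
    ultimately show "w \<in> I (Suc k)" unfolding I_def by blast
  qed
  obtain n where "I (Suc n) = I n" using noetherian_chain[OF S N, of I] I mono by (metis le_Suc_eq order_refl)
  hence "z (Suc n) \<in> I n" using zI by blast
  then obtain a s where w: "a \<in> J" "s \<in> S" "z (Suc n) = a \<oplus> s \<otimes> z n" by (auto simp: I_def)
  obtain b where b: "b \<in> J" "z n = b \<oplus> x \<otimes> z (Suc n)" using step by blast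
  define Z where "Z = z (Suc n)"
  have Zc: "Z \<in> carrier R" using z c by (simp add: Z_def)
  have xc: "x \<in> S" "x \<in> carrier R" "s \<in> carrier R" "a \<in> carrier R" "b \<in> carrier R"
    using x m w b c j by auto
  have e: "Z = a \<oplus> s \<otimes> (b \<oplus> x \<otimes> Z)" using w b by (simp add: Z_def)
  \<comment> \<open>Substituting the step relation into the stabilised one leaves (1 - s x) Z in
    \<open>J\<close>, and 1 - s x is a unit since \<open>x\<close> lies in the maximal
    ideal.\<close>
  define u where "u = \<one> \<oplus> \<ominus> (s \<otimes> x)"
  have uS: "u \<in> S" using xc w by (simp add: u_def c)
  have u: "u \<notin> nonunits S"
    unfolding u_def using x w m c by (intro local_unit_add[OF L] one_notin_nonunits[OF S]) auto
  have "u \<otimes> Z = Z \<oplus> \<ominus> (s \<otimes> (x \<otimes> Z))" using xc Zc by (simp add: u_def field_arith)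
  also have "\<dots> = (a \<oplus> s \<otimes> b) \<oplus> (s \<otimes> (x \<otimes> Z) \<oplus> \<ominus> (s \<otimes> (x \<otimes> Z)))"
    by (subst e) (use xc Zc in \<open>simp add: field_arith\<close>)
  also have "\<dots> = a \<oplus> s \<otimes> b" using xc Zc by (simp add: r_neg)
  finally have "u \<otimes> Z \<in> J" using w b j c by simp
  hence "inv u \<otimes> (u \<otimes> Z) \<in> J" using unit_inv[OF S uS u] j by simp
  hence "Z \<in> J" using unit_D[OF S uS u] c(8)[OF uS] Zc by (simp add: mult_inv_cancel)
  hence base: "z (Suc n) \<in> J" by (simp add: Z_def)
  have down: "z (Suc k) \<in> J \<Longrightarrow> z k \<in> J" for k
    using step[of k] j xc by auto
  have "z (Suc n - i) \<in> J" for i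
  proof (induction i)
    case (Suc i)
    show ?case
    proof (cases "i < Suc n")
      case True
      hence "Suc n - i = Suc (Suc n - Suc i)" by simp
      thus ?thesis using down Suc by metis
    qed (use Suc in simp)
  qed (use base in simp)
  from this[of "Suc n"] show ?thesis by simp
qed

text \<open>Choice turns the step property into a sequence. \<open>B\<close> need not be an ideal,
  which allows it to be a set of hypothetical counterexamples.\<close>

lemma nakayama_set:
  assumes L: "local_in S" and N: "noetherian_in S" and J: "ideal_in S J" and x: "x \<in> nonunits S"
    and B: "B \<subseteq> S" and step: "\<And>w. w \<in> B \<Longrightarrow> \<exists>w'\<in>B. \<exists>j\<in>J. w = j \<oplus> x \<otimes> w'"
  shows "B \<subseteq> J"
proof
  fix w assume w: "w \<in> B"
  obtain f where f: "\<And>w. w \<in> B \<Longrightarrow> f w \<in> B \<and> (\<exists>j\<in>J. w = j \<oplus> x \<otimes> f w)"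
    using step by metis
  have B': "(f ^^ k) w \<in> B" for k by (induction k) (use w f in auto)
  have "(f ^^ 0) w \<in> J"
    by (rule nakayama_sequence[OF L N J x, of "\<lambda>k. (f ^^ k) w"]) (use B' B f in auto)
  thus "w \<in> J" by simp
qed

subsection \<open>Two-generated local rings\<close>

text \<open>The generators may be redundant and the dimension may be less than two.\<close>

definition two_generated :: "'a set \<Rightarrow> 'a \<Rightarrow> 'a \<Rightarrow> bool" where
  "two_generated S x y \<longleftrightarrow> local_in S \<and> noetherian_in S \<and> x \<in> S \<and> y \<in> S \<and>
     nonunits S = {s \<otimes> x \<oplus> t \<otimes> y | s t. s \<in> S \<and> t \<in> S}"

text \<open>A regular system of parameters of a two-dimensional regular local ring, expressed
  without dimension: the prime generated by \<open>x\<close> lies strictly between zero and the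
  maximal ideal.\<close>

definition regular_pair :: "'a set \<Rightarrow> 'a \<Rightarrow> 'a \<Rightarrow> bool" where
  "regular_pair S x y \<longleftrightarrow> two_generated S x y \<and> x \<noteq> \<zero> \<and> y \<notin> multiples S x \<and> prime_in S (multiples S x)"

lemma local_in_D:
  assumes "local_in S"
  shows "subring S R" "ideal_in S (nonunits S)"
  using assms by (auto simp: local_in_def)

lemma two_generated_D:
  assumes "two_generated S x y"
  shows "local_in S" "noetherian_in S" "x \<in> S" "y \<in> S" "subring S R" "ideal_in S (nonunits S)"
    "x \<in> nonunits S" "y \<in> nonunits S"
    "\<And>z. z \<in> nonunits S \<Longrightarrow> \<exists>s\<in>S. \<exists>t\<in>S. z = s \<otimes> x \<oplus> t \<otimes> y"
proof -
  show l: "local_in S" "noetherian_in S" "x \<in> S" "y \<in> S"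
    and "\<And>z. z \<in> nonunits S \<Longrightarrow> \<exists>s\<in>S. \<exists>t\<in>S. z = s \<otimes> x \<oplus> t \<otimes> y"
    using assms by (auto simp: two_generated_def)
  show S: "subring S R" and "ideal_in S (nonunits S)" using l(1) by (auto simp: local_in_def)
  note c = subring_simps[OF S]
  have "x = \<one> \<otimes> x \<oplus> \<zero> \<otimes> y" "y = \<zero> \<otimes> x \<oplus> \<one> \<otimes> y" using l by (simp_all add: c)
  thus "x \<in> nonunits S" "y \<in> nonunits S"
    using assms c(1,2) unfolding two_generated_def by blast+
qed

lemma two_generatedI:
  assumes L: "local_in S" and N: "noetherian_in S" and x: "x \<in> nonunits S" and y: "y \<in> nonunits S"
    and gen: "\<And>z. z \<in> nonunits S \<Longrightarrow> \<exists>s\<in>S. \<exists>t\<in>S. z = s \<otimes> x \<oplus> t \<otimes> y"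
  shows "two_generated S x y"
proof -
  note m = ideal_in_simps[OF local_in_D[OF L]]
  have "nonunits S = {s \<otimes> x \<oplus> t \<otimes> y | s t. s \<in> S \<and> t \<in> S}"
  proof
    show "nonunits S \<subseteq> {s \<otimes> x \<oplus> t \<otimes> y | s t. s \<in> S \<and> t \<in> S}" using gen by blast
    show "{s \<otimes> x \<oplus> t \<otimes> y | s t. s \<in> S \<and> t \<in> S} \<subseteq> nonunits S" using x y by (auto simp: m)
  qed
  thus ?thesis unfolding two_generated_def using L N m(1)[OF x] m(1)[OF y] by (intro conjI)
qed

lemma two_generated_swap:
  assumes "two_generated S x y"
  shows "two_generated S y x"
proof -
  note d = two_generated_D[OF assms]
  show ?thesis
  proof (rule two_generatedI[OF d(1,2,8,7)])
    fix z assume "z \<in> nonunits S"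
    then obtain s t where "s \<in> S" "t \<in> S" "z = s \<otimes> x \<oplus> t \<otimes> y" using d(9) by blast
    moreover from this have "z = t \<otimes> y \<oplus> s \<otimes> x" using d(3,4) by (simp add: subring_simps[OF d(5)] a_comm)
    ultimately show "\<exists>s\<in>S. \<exists>t\<in>S. z = s \<otimes> y \<oplus> t \<otimes> x" by blast
  qed
qed

lemma prime_in_D:
  assumes "prime_in S P"
  shows "ideal_in S P" "\<one> \<notin> P" "x \<in> S \<Longrightarrow> y \<in> S \<Longrightarrow> x \<otimes> y \<in> P \<Longrightarrow> x \<in> P \<or> y \<in> P"
  using assms by (auto simp: prime_in_def)

lemma prime_in_pow:
  assumes "subring S R" "prime_in S P" "x \<in> S" "x [^] (n::nat) \<in> P"
  shows "x \<in> P"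
  using assms(4)
proof (induction n)
  case (Suc n)
  thus ?case using prime_in_D(3)[OF assms(2), of "x [^] n" x] assms(1,3) by (auto simp: subring_simps)
qed (use prime_in_D[OF assms(2)] in simp)

lemma prime_in_local:
  assumes "subring S R" "prime_in S P"
  shows "P \<subseteq> nonunits S"
  using assms proper_ideal_nonunits prime_in_D by blast

lemma two_generated_subset_nonunits:
  assumes "two_generated S x y" "ideal_in S I" "x \<in> I" "y \<in> I"
  shows "nonunits S \<subseteq> I"
proof
  note d = two_generated_D[OF assms(1)] and i = ideal_in_simps[OF two_generated_D(5)[OF assms(1)] assms(2)]
  fix z assume "z \<in> nonunits S"
  then obtain s t where "s \<in> S" "t \<in> S" "z = s \<otimes> x \<oplus> t \<otimes> y" using d(9) by blast
  thus "z \<in> I" using assms i by simp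
qed

text \<open>A counterexample w is a nonunit, since units have exponent zero. Writing w = s x + t y,
  the coefficient t is again a counterexample. So the set of counterexamples lies in xS + yB, and
  Nakayama puts it inside xS.\<close>

lemma monomial_mod:
  assumes G: "two_generated S x y" and z: "z \<in> S" "z \<notin> multiples S x"
  shows "\<exists>k::nat. \<exists>u d. u \<in> S \<and> u \<notin> nonunits S \<and> d \<in> S \<and> z = u \<otimes> y [^] k \<oplus> x \<otimes> d"
proof -
  note d = two_generated_D[OF G]
  note c = subring_simps[OF d(5)]
  define B where "B = {w \<in> S. \<not> (\<exists>k::nat. \<exists>u d. u \<in> S \<and> u \<notin> nonunits S \<and> d \<in> S \<and> w = u \<otimes> y [^] k \<oplus> x \<otimes> d)}"
  have "B \<subseteq> multiples S x"
  proof (rule nakayama_set[OF d(1,2) multiples_ideal[OF d(5,3)] d(8)])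
    show "B \<subseteq> S" by (auto simp: B_def)
    fix w assume w: "w \<in> B"
    hence wS: "w \<in> S" by (simp add: B_def)
    have "w \<in> nonunits S"
    proof (rule ccontr)
      assume n: "w \<notin> nonunits S"
      have "w = w \<otimes> y [^] (0::nat) \<oplus> x \<otimes> \<zero>" using wS d(3) by (simp add: c)
      thus False using w n wS c(1) unfolding B_def by blast
    qed
    then obtain s t where st: "s \<in> S" "t \<in> S" "w = s \<otimes> x \<oplus> t \<otimes> y" using d(9) by blast
    have "t \<in> B"
    proof (rule ccontr)
      assume "t \<notin> B"
      then obtain k :: nat and u e where u: "u \<in> S" "u \<notin> nonunits S" "e \<in> S" "t = u \<otimes> y [^] k \<oplus> x \<otimes> e"
        using st by (auto simp: B_def)
      have "w = u \<otimes> y [^] (Suc k) \<oplus> x \<otimes> (s \<oplus> y \<otimes> e)"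
        using st u d(3,4) by (simp add: c field_arith)
      moreover have "s \<oplus> y \<otimes> e \<in> S" using st u d(4) by (simp add: c)
      ultimately show False using w u unfolding B_def by blast
    qed
    moreover have "w = x \<otimes> s \<oplus> y \<otimes> t" using st d(3,4) by (simp add: c m_comm)
    ultimately show "\<exists>w'\<in>B. \<exists>j\<in>multiples S x. w = j \<oplus> y \<otimes> w'" using multiplesI[OF st(1)] by blast
  qed
  thus ?thesis using z unfolding B_def by blast
qed

text \<open>Modulo \<open>x\<close> every nonzero element is a unit times a power of
  \<open>y\<close>, so divisibility is a comparison of exponents, as in a discrete valuation
  ring.\<close>

lemma least_monomial_divides:
  assumes G: "two_generated S x y" and u: "u \<in> S" "u \<notin> nonunits S" "d \<in> S" and p: "p = u \<otimes> y [^] (k::nat) \<oplus> x \<otimes> d"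
    and z: "z \<in> S" and least: "\<And>l v e. v \<in> S \<Longrightarrow> v \<notin> nonunits S \<Longrightarrow> e \<in> S \<Longrightarrow> z = v \<otimes> y [^] (l::nat) \<oplus> x \<otimes> e \<Longrightarrow> k \<le> l"
  shows "\<exists>s\<in>S. \<exists>e\<in>S. z = s \<otimes> p \<oplus> x \<otimes> e"
proof -
  note g = two_generated_D[OF G]
  note c = subring_simps[OF g(5)]
  note gS = g(3,4)
  have pS: "p \<in> S" using p u gS by (simp add: c)
  show ?thesis
  proof (cases "z \<in> multiples S x")
    case True
    then obtain e where "e \<in> S" "z = x \<otimes> e" by (rule multiplesE)
    moreover from this have "z = \<zero> \<otimes> p \<oplus> x \<otimes> e" using pS gS by (simp add: c)
    ultimately show ?thesis using c(1) by blast
  next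
    case False
    then obtain l :: nat and v e where v: "v \<in> S" "v \<notin> nonunits S" "e \<in> S" and zv: "z = v \<otimes> y [^] l \<oplus> x \<otimes> e"
      using monomial_mod[OF G z] by blast
    then obtain m where l: "l = k + m" using least by (metis le_Suc_ex)
    define s where "s = v \<otimes> inv u \<otimes> y [^] m"
    have u': "inv u \<in> S" "u \<noteq> \<zero>" using unit_D[OF g(5) u(1,2)] by auto
    have sS: "s \<in> S" using v u' gS by (simp add: c s_def)
    have car: "v \<in> carrier R" "u \<in> carrier R" "inv u \<in> carrier R" "y [^] k \<in> carrier R" "y [^] m \<in> carrier R"
      "x \<in> carrier R" "d \<in> carrier R" "y \<in> carrier R" "e \<in> carrier R" "s \<in> carrier R"
      using v u u' gS sS by (simp_all add: c)
    have "s \<otimes> p = (u \<otimes> inv u) \<otimes> (v \<otimes> (y [^] k \<otimes> y [^] m)) \<oplus> x \<otimes> (s \<otimes> d)"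
      unfolding p using car by (simp del: mult_inv add: s_def cring_simprules)
    also have "\<dots> = v \<otimes> y [^] l \<oplus> x \<otimes> (s \<otimes> d)" using car u' by (simp add: l nat_pow_mult)
    finally have "z = s \<otimes> p \<oplus> x \<otimes> (e \<ominus> s \<otimes> d)"
      unfolding zv using car by (simp add: field_arith)
    moreover have "e \<ominus> s \<otimes> d \<in> S" using v sS u by (simp add: c)
    ultimately show ?thesis using sS by blast
  qed
qed

text \<open>Krull's intersection theorem in the form needed: this is Nakayama with \<open>J\<close>
  the zero ideal, and \<open>I\<close> may be any subset closed under some choice of division by
  \<open>x\<close>.\<close>

lemma ideal_zero_if_divisible:
  assumes G: "local_in S" "noetherian_in S" and x: "x \<in> nonunits S" and I: "I \<subseteq> S"
    and div: "\<And>z. z \<in> I \<Longrightarrow> \<exists>w\<in>I. z = x \<otimes> w"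
  shows "I \<subseteq> {\<zero>}"
proof (rule nakayama_set[OF G _ x I])
  have S: "subring S R" using G by (simp add: local_in_def)
  note c = subring_simps[OF S]
  show "ideal_in S {\<zero>}" using ideal_in_zero[OF S] .
  have xS: "x \<in> S" using x by (simp add: nonunits_def)
  fix z assume "z \<in> I"
  then obtain w where "w \<in> I" "z = x \<otimes> w" using div by blast
  thus "\<exists>w'\<in>I. \<exists>j\<in>{\<zero>}. z = j \<oplus> x \<otimes> w'" using xS I c(8) by (auto intro!: bexI[of _ w] simp: subset_iff)
qed

text \<open>If \<open>x\<close> lies in \<open>Q\<close>, an element of \<open>Q\<close> outside xS
  would put a power of \<open>y\<close>, hence \<open>y\<close>, into \<open>Q\<close> and make
  \<open>Q\<close> maximal. Otherwise take p in \<open>Q\<close> whose exponent modulo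
  \<open>x\<close> is least: each z in \<open>Q\<close> is s p + x e, primality moves e into
  \<open>Q\<close>, and Nakayama gives Q = pS.\<close>

lemma prime_principal:
  assumes G: "regular_pair S x y" and Q: "prime_in S Q" "Q \<noteq> nonunits S" "Q \<noteq> {\<zero>}"
  shows "\<exists>p\<in>Q. p \<noteq> \<zero> \<and> Q = multiples S p"
proof -
  have g2: "two_generated S x y" "x \<noteq> \<zero>" using G by (auto simp: regular_pair_def)
  note g = two_generated_D[OF g2(1)]
  note c = subring_simps[OF g(5)]
  have Qi: "ideal_in S Q" using Q by (simp add: prime_in_def)
  note q = ideal_in_simps[OF g(5) Qi]
  have Qm: "Q \<subseteq> nonunits S" using prime_in_local g(5) Q(1) by blast
  show ?thesis
  proof (cases "x \<in> Q")
    case True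
    have "Q \<subseteq> multiples S x"
    proof
      fix z assume z: "z \<in> Q"
      show "z \<in> multiples S x"
      proof (rule ccontr)
        assume "z \<notin> multiples S x"
        then obtain k :: nat and u d where u: "u \<in> S" "u \<notin> nonunits S" "d \<in> S" "z = u \<otimes> y [^] k \<oplus> x \<otimes> d"
          using monomial_mod[OF g2(1) q(1)[OF z]] by blast
        have "u \<otimes> y [^] k \<in> Q"
          using ideal_in_add_cancel[OF g(5) Qi, of "u \<otimes> y [^] k" "x \<otimes> d"] u z True g(4) by (simp add: c q)
        hence "y [^] k \<in> Q" using prime_in_D(3)[OF Q(1) u(1) c(7)[OF g(4)]] u Qm by blast
        hence "y \<in> Q" using prime_in_pow[OF g(5) Q(1) g(4)] by blast
        hence "nonunits S \<subseteq> Q" using two_generated_subset_nonunits[OF g2(1) Qi True] by blast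
        thus False using Q Qm by blast
      qed
    qed
    hence "Q = multiples S x" using multiples_subset[OF g(5) Qi True] by blast
    thus ?thesis using True g2(2) by blast
  next
    case False
    have quot: "e \<in> Q" if "x \<otimes> e \<in> Q" "e \<in> S" for e
      using that False prime_in_D(3)[OF Q(1) g(3), of e] by blast
    define E where "E k \<longleftrightarrow> (\<exists>p\<in>Q. \<exists>u d. u \<in> S \<and> u \<notin> nonunits S \<and> d \<in> S \<and> p = u \<otimes> y [^] k \<oplus> x \<otimes> d)" for k :: nat
    have "\<not> Q \<subseteq> multiples S x"
    proof
      assume sub: "Q \<subseteq> multiples S x"
      have "Q \<subseteq> {\<zero>}"
      proof (rule ideal_zero_if_divisible[OF g(1,2,7)])
        show "Q \<subseteq> S" using q by blast
        fix z assume z: "z \<in> Q"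
        then obtain w where "w \<in> S" "z = x \<otimes> w" using sub multiplesE by blast
        thus "\<exists>w\<in>Q. z = x \<otimes> w" using quot z by blast
      qed
      thus False using Q q by blast
    qed
    hence "\<exists>k. E k" unfolding E_def using monomial_mod[OF g2(1)] q(1) by blast
    define k where "k = (LEAST k. E k)"
    have "E k" unfolding k_def using \<open>\<exists>k. E k\<close> by (rule LeastI_ex)
    then obtain p u d where p: "p \<in> Q" "u \<in> S" "u \<notin> nonunits S" "d \<in> S" "p = u \<otimes> y [^] k \<oplus> x \<otimes> d"
      unfolding E_def by blast
    have pS: "p \<in> S" using p q by blast
    have "Q \<subseteq> multiples S p"
    proof (rule nakayama_set[OF g(1,2) multiples_ideal[OF g(5) pS] g(7)])
      show "Q \<subseteq> S" using q by blast
      fix z assume z: "z \<in> Q"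
      have "\<exists>s\<in>S. \<exists>e\<in>S. z = s \<otimes> p \<oplus> x \<otimes> e"
      proof (rule least_monomial_divides[OF g2(1) p(2-5) q(1)[OF z]])
        fix l v e assume "v \<in> S" "v \<notin> nonunits S" "e \<in> S" "z = v \<otimes> y [^] (l::nat) \<oplus> x \<otimes> e"
        hence "E l" unfolding E_def using z by blast
        thus "k \<le> l" unfolding k_def by (rule Least_le)
      qed
      then obtain s e where se: "s \<in> S" "e \<in> S" "z = s \<otimes> p \<oplus> x \<otimes> e" by blast
      have "x \<otimes> e \<oplus> s \<otimes> p \<in> Q" using z se pS g(3) by (simp add: c a_comm)
      hence "x \<otimes> e \<in> Q" using ideal_in_add_cancel[OF g(5) Qi, of "x \<otimes> e" "s \<otimes> p"] q(4)[OF se(1) p(1)] c(4)[OF g(3) se(2)] by blast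
      hence "e \<in> Q" using quot se by blast
      moreover have "s \<otimes> p \<in> multiples S p" using multiplesI[OF se(1), of p] se pS by (simp add: c m_comm)
      ultimately show "\<exists>w'\<in>Q. \<exists>j\<in>multiples S p. z = j \<oplus> x \<otimes> w'" using se by blast
    qed
    hence eq: "Q = multiples S p" using multiples_subset[OF g(5) Qi p(1)] by blast
    have "p \<noteq> \<zero>"
    proof
      assume "p = \<zero>"
      hence "Q \<subseteq> {\<zero>}" unfolding eq by (auto simp: multiples_def c)
      thus False using Q q by blast
    qed
    thus ?thesis using eq p by blast
  qed
qed

text \<open>The case of Krull's principal ideal theorem that is needed here; the ideals
  \<open>q\<^sup>n S\<^sub>Q \<inter> S\<close> play the role of the symbolic powers.\<close>

lemma second_generator_not_nilpotent:
  assumes G: "two_generated S a b" and Q: "prime_in S Q" "Q \<noteq> nonunits S" "Q \<noteq> {\<zero>}"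
  shows "b [^] (k::nat) \<notin> multiples S a"
proof
  assume bk: "b [^] k \<in> multiples S a"
  note g = two_generated_D[OF G]
  note c = subring_simps[OF g(5)]
  have Qi: "ideal_in S Q" using Q by (simp add: prime_in_def)
  note q = ideal_in_simps[OF g(5) Qi]
  have Qm: "Q \<subseteq> nonunits S" using prime_in_local g(5) Q(1) by blast
  have aQ: "a \<notin> Q"
  proof
    assume aQ: "a \<in> Q"
    hence "b [^] k \<in> Q" using bk multiples_subset[OF g(5) Qi] by blast
    hence "b \<in> Q" using prime_in_pow[OF g(5) Q(1) g(4)] by blast
    hence "nonunits S \<subseteq> Q" using two_generated_subset_nonunits[OF G Qi aQ] by blast
    thus False using Q Qm by blast
  qed
  obtain h where h: "h \<in> Q" "h \<noteq> \<zero>" using Q q by blast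
  have hS: "h \<in> S" using h q by blast
  define I where "I n = {z \<in> S. \<exists>s\<in>S. s \<notin> Q \<and> s \<otimes> z \<in> multiples S (h [^] n)}" for n :: nat
  have J: "ideal_in S (multiples S (h [^] n))" for n :: nat using multiples_ideal[OF g(5)] hS by (simp add: c)
  have Ii: "ideal_in S (I n)" for n
    unfolding ideal_in_def
  proof (intro conjI ballI)
    note j = ideal_in_simps[OF g(5) J[of n]]
    show "I n \<subseteq> S" by (auto simp: I_def)
    have "\<one> \<otimes> \<zero> \<in> multiples S (h [^] n)" using j by simp
    thus "\<zero> \<in> I n" unfolding I_def using c(1,2) prime_in_D(2)[OF Q(1)] by blast
    fix x assume "x \<in> I n"
    then obtain s where s: "x \<in> S" "s \<in> S" "s \<notin> Q" "s \<otimes> x \<in> multiples S (h [^] n)" by (auto simp: I_def)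
    {
      fix r assume r: "r \<in> S"
      have "s \<otimes> (r \<otimes> x) = r \<otimes> (s \<otimes> x)" using r s by (simp add: c m_lcomm)
      hence "s \<otimes> (r \<otimes> x) \<in> multiples S (h [^] n)" using r s j by simp
      thus "r \<otimes> x \<in> I n" unfolding I_def using r s by (auto simp: c)
    }
    fix y assume "y \<in> I n"
    then obtain t where t: "y \<in> S" "t \<in> S" "t \<notin> Q" "t \<otimes> y \<in> multiples S (h [^] n)" by (auto simp: I_def)
    have "(s \<otimes> t) \<otimes> (x \<oplus> y) = t \<otimes> (s \<otimes> x) \<oplus> s \<otimes> (t \<otimes> y)" using s t by (simp add: c field_arith)
    hence "(s \<otimes> t) \<otimes> (x \<oplus> y) \<in> multiples S (h [^] n)" using s t j by simp
    moreover have "s \<otimes> t \<notin> Q" using prime_in_D(3)[OF Q(1)] s t by blast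
    ultimately show "x \<oplus> y \<in> I n" unfolding I_def using s t by (auto simp: c)
  qed
  have anti: "I (Suc n) \<subseteq> I n" for n
  proof
    fix z assume "z \<in> I (Suc n)"
    then obtain s t where s: "z \<in> S" "s \<in> S" "s \<notin> Q" "t \<in> S" "s \<otimes> z = h [^] (Suc n) \<otimes> t"
      by (auto simp: I_def multiples_def)
    hence "s \<otimes> z = h [^] n \<otimes> (h \<otimes> t)" using hS by (simp add: c m_assoc)
    moreover have "h \<otimes> t \<in> S" using s hS by (simp add: c)
    ultimately show "z \<in> I n" unfolding I_def using s multiplesI[of "h \<otimes> t" S "h [^] n"] by auto
  qed
  define E where "E n l \<longleftrightarrow> (\<exists>z\<in>I n. \<exists>u d. u \<in> S \<and> u \<notin> nonunits S \<and> d \<in> S \<and> z = u \<otimes> b [^] l \<oplus> a \<otimes> d)"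
    for n l :: nat
  have Ek: "E n k" for n
  proof -
    obtain d where d: "d \<in> S" "b [^] k = a \<otimes> d" using bk by (rule multiplesE)
    \<comment> \<open>Under the assumption to be refuted, zero itself has a monomial form with
      exponent \<open>k\<close>. As zero lies in every \<open>I n\<close>, all the least exponents
      are bounded by \<open>k\<close>.\<close>
    have "\<zero> = \<one> \<otimes> b [^] k \<oplus> a \<otimes> (\<ominus> d)" using d g(3) by (simp add: c field_arith)
    thus ?thesis unfolding E_def using ideal_in_D(3)[OF Ii] c(2) c(3)[OF d(1)] one_notin_nonunits[OF g(5)] by blast
  qed
  define \<nu> where "\<nu> n = (LEAST l. E n l)" for n
  have E\<nu>: "E n (\<nu> n)" for n unfolding \<nu>_def by (rule LeastI[of "E n", OF Ek])
  have \<nu>k: "\<nu> n \<le> k" for n unfolding \<nu>_def by (rule Least_le[of "E n", OF Ek])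
  have "E (Suc n) l \<Longrightarrow> E n l" for n l unfolding E_def using anti[of n] by blast
  hence \<nu>mono: "\<nu> n \<le> \<nu> (Suc n)" for n using E\<nu>[of "Suc n"] unfolding \<nu>_def[of n] by (simp add: Least_le)
  have "\<exists>n. \<nu> (Suc n) = \<nu> n"
  proof (rule ccontr)
    assume "\<not> (\<exists>n. \<nu> (Suc n) = \<nu> n)"
    hence "\<nu> n < \<nu> (Suc n)" for n using \<nu>mono[of n] by (simp add: le_less) (metis)
    hence "strict_mono \<nu>" by (simp add: strict_mono_Suc_iff)
    hence "Suc k \<le> \<nu> (Suc k)" by (rule strict_mono_imp_increasing)
    thus False using \<nu>k[of "Suc k"] by simp
  qed
  then obtain n where n: "\<nu> (Suc n) = \<nu> n" ..
  obtain p u d where p: "p \<in> I (Suc n)" "u \<in> S" "u \<notin> nonunits S" "d \<in> S" "p = u \<otimes> b [^] (\<nu> n) \<oplus> a \<otimes> d"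
    using E\<nu>[of "Suc n"] unfolding n E_def by blast
  \<comment> \<open>The least exponents of \<open>I n\<close> and \<open>I (Suc n)\<close> agree, so
    \<open>p\<close> divides every element of \<open>I n\<close> modulo \<open>a\<close>. Since
    \<open>a\<close> is outside \<open>Q\<close>, the cofactor of \<open>a\<close> is again in
    \<open>I n\<close>, and Nakayama applies.\<close>
  have "I n \<subseteq> I (Suc n)"
  proof (rule nakayama_set[OF g(1,2) Ii g(7)])
    note i = ideal_in_simps[OF g(5) Ii[of n]] and i' = ideal_in_simps[OF g(5) Ii[of "Suc n"]]
    show "I n \<subseteq> S" using i by blast
    fix z assume z: "z \<in> I n"
    have "\<exists>s\<in>S. \<exists>e\<in>S. z = s \<otimes> p \<oplus> a \<otimes> e"
    proof (rule least_monomial_divides[OF G p(2-5) i(1)[OF z]])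
      fix l v e assume "v \<in> S" "v \<notin> nonunits S" "e \<in> S" "z = v \<otimes> b [^] (l::nat) \<oplus> a \<otimes> e"
      hence "E n l" unfolding E_def using z by blast
      thus "\<nu> n \<le> l" unfolding \<nu>_def by (rule Least_le)
    qed
    then obtain s e where se: "s \<in> S" "e \<in> S" "z = s \<otimes> p \<oplus> a \<otimes> e" by blast
    have pI: "p \<in> I n" using p anti by blast
    have pS: "p \<in> S" using p i' by blast
    have "a \<otimes> e \<oplus> s \<otimes> p \<in> I n" using z se pS g(3) by (simp add: c a_comm)
    hence "a \<otimes> e \<in> I n" using ideal_in_add_cancel[OF g(5) Ii, of "a \<otimes> e"] se pI g(3) by (simp add: i c)
    then obtain r where r: "r \<in> S" "r \<notin> Q" "r \<otimes> (a \<otimes> e) \<in> multiples S (h [^] n)" by (auto simp: I_def)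
    have "(r \<otimes> a) \<otimes> e \<in> multiples S (h [^] n)" using r g(3) se by (simp add: c m_assoc)
    moreover have "r \<otimes> a \<notin> Q" using prime_in_D(3)[OF Q(1)] r g(3) aQ by blast
    ultimately have "e \<in> I n" unfolding I_def using se r g(3) by (auto simp: c)
    moreover have "s \<otimes> p \<in> I (Suc n)" using se p i' by simp
    ultimately show "\<exists>w'\<in>I n. \<exists>j\<in>I (Suc n). z = j \<oplus> a \<otimes> w'" using se by blast
  qed
  \<comment> \<open>Placing this power in the next symbolic power yields s h^n = h^(n+1) t with s
    outside \<open>Q\<close>; cancelling gives s = h t in \<open>Q\<close>, a contradiction.\<close>
  moreover have "h [^] n \<in> I n"
  proof -
    have "\<one> \<otimes> h [^] n \<in> multiples S (h [^] n)" using multiples_self[OF g(5)] hS by (simp add: c)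
    thus ?thesis unfolding I_def using prime_in_D(2)[OF Q(1)] c(2) hS by (auto simp: c)
  qed
  ultimately have "h [^] n \<in> I (Suc n)" by blast
  then obtain s t where s: "s \<in> S" "s \<notin> Q" "t \<in> S" "s \<otimes> h [^] n = h [^] (Suc n) \<otimes> t"
    by (auto simp: I_def multiples_def)
  have hn: "h [^] n \<in> carrier R" "h [^] n \<noteq> \<zero>" "h \<in> carrier R" using hS h(2) c
    by (auto, induction n) (auto simp: c)
  have sc: "s \<in> carrier R" "t \<in> carrier R" using s c by auto
  have "h [^] n \<otimes> s = h [^] n \<otimes> (h \<otimes> t)"
    using s(4) sc hn by (simp add: m_ac)
  hence "s = h \<otimes> t" using hn sc by (simp add: m_lcancel)
  thus False using s(2) q(5)[OF s(3) h(1)] by simp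
qed

text \<open>The intermediate prime \<open>Q\<close> replaces the assumption of dimension two. Since
  no power of \<open>b\<close> lies in aS, the product of two monomials modulo \<open>a\<close>
  stays nonzero, which makes aS prime. If \<open>a\<close> were zero, a nonzero element of
  \<open>Q\<close> would be a unit times a power of \<open>b\<close>, forcing \<open>b\<close> into
  \<open>Q\<close>.\<close>

lemma regular_pairI:
  assumes G: "two_generated S a b" and Q: "prime_in S Q" "Q \<noteq> nonunits S" "Q \<noteq> {\<zero>}"
  shows "regular_pair S a b"
proof -
  note g = two_generated_D[OF G]
  note c = subring_simps[OF g(5)]
  have Qi: "ideal_in S Q" using Q by (simp add: prime_in_def)
  note q = ideal_in_simps[OF g(5) Qi]
  have Qm: "Q \<subseteq> nonunits S" using prime_in_local g(5) Q(1) by blast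
  note nn = second_generator_not_nilpotent[OF G Q]
  have ab: "b \<notin> multiples S a" using nn[of 1] c(8)[OF g(4)] by simp
  have Ji: "ideal_in S (multiples S a)" by (rule multiples_ideal[OF g(5,3)])
  note j = ideal_in_simps[OF g(5) Ji]
  have pr: "prime_in S (multiples S a)"
    unfolding prime_in_def
  proof (intro conjI ballI impI Ji)
    show "\<one> \<notin> multiples S a" using one_in_multiples[OF g(5,3)] g(7) by blast
    fix z w assume z: "z \<in> S" and w: "w \<in> S" and zw: "z \<otimes> w \<in> multiples S a"
    show "z \<in> multiples S a \<or> w \<in> multiples S a"
    proof (rule ccontr)
      assume n: "\<not> (z \<in> multiples S a \<or> w \<in> multiples S a)"
      obtain k :: nat and u d where u: "u \<in> S" "u \<notin> nonunits S" "d \<in> S" "z = u \<otimes> b [^] k \<oplus> a \<otimes> d"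
        using monomial_mod[OF G z] n by blast
      obtain l :: nat and v e where v: "v \<in> S" "v \<notin> nonunits S" "e \<in> S" "w = v \<otimes> b [^] l \<oplus> a \<otimes> e"
        using monomial_mod[OF G w] n by blast
      have uv: "u \<otimes> v \<in> S" "u \<otimes> v \<notin> nonunits S" using unit_mult[OF g(5)] u v by (auto simp: c)
      have uv': "u \<otimes> v \<noteq> \<zero>" "inv (u \<otimes> v) \<in> S" using unit_D[OF g(5) uv] by auto
      define B where "B = b [^] k" define B' where "B' = b [^] l"
      have BS: "B \<in> S" "B' \<in> S" using g(4) by (auto simp: c B_def B'_def)
      have "z \<otimes> w = (u \<otimes> v) \<otimes> (B \<otimes> B') \<oplus> a \<otimes> (d \<otimes> w \<oplus> u \<otimes> (B \<otimes> e))"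
        using u v BS g(3) by (simp add: c field_arith B_def[symmetric] B'_def[symmetric])
      moreover have "d \<otimes> w \<oplus> u \<otimes> (B \<otimes> e) \<in> S" using u v w BS by (simp add: c)
      ultimately have "(u \<otimes> v) \<otimes> (B \<otimes> B') \<in> multiples S a"
        using ideal_in_add_cancel[OF g(5) Ji, of "(u \<otimes> v) \<otimes> (B \<otimes> B')"] multiplesI zw uv BS by (simp add: c)
      hence "inv (u \<otimes> v) \<otimes> ((u \<otimes> v) \<otimes> (B \<otimes> B')) \<in> multiples S a" using j uv' by blast
      hence "B \<otimes> B' \<in> multiples S a" using mult_inv_cancel(2)[of "u \<otimes> v" "B \<otimes> B'"] uv uv' BS by (simp add: c del: mult_nonzero)
      hence "b [^] (k + l) \<in> multiples S a" using g(4) by (simp add: c nat_pow_mult B_def B'_def)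
      thus False using nn by blast
    qed
  qed
  have "a \<noteq> \<zero>"
  proof
    assume a: "a = \<zero>"
    obtain z where z: "z \<in> Q" "z \<noteq> \<zero>" using Q q by blast
    have "z \<notin> multiples S a" using z a by (auto simp: multiples_def c)
    then obtain k :: nat and u d where u: "u \<in> S" "u \<notin> nonunits S" "d \<in> S" "z = u \<otimes> b [^] k \<oplus> a \<otimes> d"
      using monomial_mod[OF G q(1)[OF z(1)]] by blast
    hence "u \<otimes> b [^] k \<in> Q" using z a g(4) by (simp add: c)
    hence "b [^] k \<in> Q" using prime_in_D(3)[OF Q(1) u(1) c(7)[OF g(4)]] u Qm by blast
    hence "b \<in> Q" using prime_in_pow[OF g(5) Q(1) g(4)] by blast
    hence "nonunits S \<subseteq> Q" using two_generated_subset_nonunits[OF G Qi] a q(2) by blast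
    thus False using Q Qm by blast
  qed
  thus ?thesis using G ab pr by (simp add: regular_pair_def)
qed

lemma regular_pair_D:
  assumes "regular_pair S x y"
  shows "two_generated S x y" "x \<noteq> \<zero>" "y \<notin> multiples S x" "prime_in S (multiples S x)"
    "multiples S x \<noteq> nonunits S" "multiples S x \<noteq> {\<zero>}"
proof -
  show g: "two_generated S x y" "x \<noteq> \<zero>" "y \<notin> multiples S x" "prime_in S (multiples S x)"
    using assms by (auto simp: regular_pair_def)
  show "multiples S x \<noteq> nonunits S" "multiples S x \<noteq> {\<zero>}"
    using g two_generated_D[OF g(1)] multiples_self[of S x] by auto
qed

text \<open>Outside the square of the maximal ideal, one of the two coefficients of \<open>a\<close>
  is a unit, so \<open>a\<close> can be exchanged for that generator. The old prime xS serves as the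
  intermediate prime that certifies the new pair.\<close>

lemma regular_pair_extend:
  assumes G: "regular_pair S x y" and a: "a \<in> nonunits S"
    "a \<notin> ideal_prod (R\<lparr>carrier := S\<rparr>) (nonunits S) (nonunits S)"
  shows "\<exists>b. regular_pair S a b"
proof -
  note r = regular_pair_D[OF G]
  note g = two_generated_D[OF r(1)]
  note c = subring_simps[OF g(5)]
  obtain s t where st: "s \<in> S" "t \<in> S" "a = s \<otimes> x \<oplus> t \<otimes> y" using g(9) a(1) by blast
  have sw: "two_generated S (s \<otimes> x \<oplus> t \<otimes> y) y"
    if xy: "two_generated S x y" and st: "s \<in> S" "t \<in> S" "s \<notin> nonunits S" for x y s t
  proof -
    note g = two_generated_D[OF xy]
    note m = ideal_in_simps[OF g(5,6)]
    show ?thesis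
    proof (rule two_generatedI[OF g(1,2) _ g(8)])
      show "s \<otimes> x \<oplus> t \<otimes> y \<in> nonunits S" using g st by (simp add: m)
      fix z assume "z \<in> nonunits S"
      then obtain p q where pq: "p \<in> S" "q \<in> S" "z = p \<otimes> x \<oplus> q \<otimes> y" using g(9) by blast
      have i: "inv s \<in> S" "s \<noteq> \<zero>" using unit_D[OF g(5) st(1,3)] by auto
      have car: "s \<in> carrier R" "inv s \<in> carrier R" "t \<in> carrier R" "p \<in> carrier R" "q \<in> carrier R"
        "x \<in> carrier R" "y \<in> carrier R" using i st pq g(3,4) by (simp_all add: c)
      have "p \<otimes> inv s \<otimes> (s \<otimes> x \<oplus> t \<otimes> y) = (s \<otimes> inv s) \<otimes> (p \<otimes> x) \<oplus> (p \<otimes> (inv s \<otimes> t)) \<otimes> y"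
        using car by (simp del: mult_inv add: cring_simprules)
      also have "\<dots> = p \<otimes> x \<oplus> (p \<otimes> (inv s \<otimes> t)) \<otimes> y" using car i by simp
      finally have "z = (p \<otimes> inv s) \<otimes> (s \<otimes> x \<oplus> t \<otimes> y) \<oplus> (q \<ominus> p \<otimes> (inv s \<otimes> t)) \<otimes> y"
        using car pq by (simp add: field_arith)
      moreover have "p \<otimes> inv s \<in> S" "q \<ominus> p \<otimes> (inv s \<otimes> t) \<in> S" using pq i st by (simp_all add: c)
      ultimately show "\<exists>p\<in>S. \<exists>q\<in>S. z = p \<otimes> (s \<otimes> x \<oplus> t \<otimes> y) \<oplus> q \<otimes> y" by blast
    qed
  qed
  have a': "a = t \<otimes> y \<oplus> s \<otimes> x" using st g(3,4) by (simp add: c a_comm)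
  consider "s \<notin> nonunits S" | "t \<notin> nonunits S" | "s \<in> nonunits S" "t \<in> nonunits S" by blast
  thus ?thesis
  proof cases
    case 1
    thus ?thesis using sw[OF r(1) st(1,2)] regular_pairI[OF _ r(4,5,6)] st by blast
  next
    case 2
    thus ?thesis using sw[OF two_generated_swap[OF r(1)] st(2,1)] regular_pairI[OF _ r(4,5,6)] a' by blast
  next
    case 3
    have "s \<otimes> x \<oplus> t \<otimes> y \<in> ideal_prod (R\<lparr>carrier := S\<rparr>) (nonunits S) (nonunits S)"
      using ideal_prod.sum[OF ideal_prod.prod[OF 3(1) g(7)] ideal_prod.prod[OF 3(2) g(8)], of "R\<lparr>carrier := S\<rparr>"] by simp
    thus ?thesis using a st by simp
  qed
qed

subsection \<open>Dimension and regularity\<close>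

lemma prime_chain_iff:
  assumes "subring S R"
  shows "prime_chain (R\<lparr>carrier := S\<rparr>) n c \<longleftrightarrow> (\<forall>i\<le>n. prime_in S (c i)) \<and> (\<forall>i<n. c i \<subset> c (Suc i))"
  unfolding prime_chain_def primeideal_iff[OF assms] ..

lemma prime_in_zero:
  assumes "subring S R"
  shows "prime_in S {\<zero>}"
  unfolding prime_in_def using ideal_in_zero[OF assms] by (auto simp: subring_simps[OF assms])

lemma prime_in_nonunits:
  assumes "local_in S"
  shows "prime_in S (nonunits S)"
proof -
  note l = local_in_D[OF assms]
  show ?thesis
    unfolding prime_in_def using l one_notin_nonunits[OF l(1)] unit_mult[OF l(1)] by blast
qed

lemma regular_local_ringI:
  assumes L: "local_in S" and N: "noetherian_in S" and G: "finite G" "G \<subseteq> nonunits S"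
    and gen: "\<And>J. ideal_in S J \<Longrightarrow> G \<subseteq> J \<Longrightarrow> nonunits S \<subseteq> J"
    and dim: "krull_dim (R\<lparr>carrier := S\<rparr>) = enat (card G)"
  shows "regular_local_ring (R\<lparr>carrier := S\<rparr>)"
proof -
  note l = local_in_D[OF L]
  have "genideal (R\<lparr>carrier := S\<rparr>) G = nonunits S"
    unfolding genideal_def ideal_iff[OF l(1)] using G gen l(2) by blast
  hence "maximalideal (genideal (R\<lparr>carrier := S\<rparr>) G) (R\<lparr>carrier := S\<rparr>)"
    using local_maximal[OF L] maximalideal_iff[OF l(1)] by simp
  moreover have "G \<subseteq> S" using G by (auto simp: nonunits_def)
  moreover have "\<exists>!M. maximalideal M (R\<lparr>carrier := S\<rparr>)"
    unfolding maximalideal_iff[OF l(1)] local_maximal[OF L] by simp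
  ultimately show ?thesis
    unfolding regular_local_ring_def using cring_sub[OF l(1)] noetherian_iff[OF l(1)] N G dim by auto
qed

text \<open>Both primes are principal. A generator p = q s of \<open>P\<close> forces q or s into
  \<open>P\<close>; in the second case p cancels and q becomes a unit. This bounds the length of
  prime chains by two.\<close>

lemma regular_pair_prime_eq:
  assumes G: "regular_pair S x y" and P: "prime_in S P" "P \<noteq> {\<zero>}" and Q: "prime_in S Q" "Q \<noteq> nonunits S"
    and PQ: "P \<subseteq> Q"
  shows "P = Q"
proof -
  note g = two_generated_D[OF regular_pair_D(1)[OF G]]
  note c = subring_simps[OF g(5)]
  have Qm: "Q \<subseteq> nonunits S" using prime_in_local g(5) Q by blast
  have Pm: "P \<noteq> nonunits S" "Q \<noteq> {\<zero>}" using Qm Q PQ P prime_in_D(1)[OF P(1)] ideal_in_D(3) by auto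
  obtain p where p: "p \<in> P" "p \<noteq> \<zero>" "P = multiples S p" using prime_principal[OF G P(1) Pm(1) P(2)] by blast
  obtain q where q: "q \<in> Q" "q \<noteq> \<zero>" "Q = multiples S q" using prime_principal[OF G Q Pm(2)] by blast
  have S: "p \<in> S" "q \<in> S" using p q P Q prime_in_D(1) ideal_in_D(2) by blast+
  obtain s where s: "s \<in> S" "p = q \<otimes> s" using p(1) PQ q(3) by (auto simp: multiples_def)
  consider "q \<in> P" | "s \<in> P" using prime_in_D(3)[OF P(1) S(2) s(1)] s p by auto
  thus ?thesis
  proof cases
    case 1
    thus ?thesis using PQ multiples_subset[OF g(5) prime_in_D(1)[OF P(1)]] q(3) by blast
  next
    case 2
    then obtain t where t: "t \<in> S" "s = p \<otimes> t" using p(3) by (auto simp: multiples_def)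
    have "p \<otimes> \<one> = p \<otimes> (q \<otimes> t)" using s(2) t S by (simp add: c m_ac)
    hence "\<one> = q \<otimes> t" using m_lcancel[of p \<one> "q \<otimes> t"] S t p(2) by (simp only: c one_closed m_closed if_True simp_thms)
    hence "\<one> \<in> Q" using multiplesI[OF t(1), of q] q by simp
    thus ?thesis using prime_in_D(2)[OF Q(1)] by blast
  qed
qed

lemma regular_pair_dim:
  assumes G: "regular_pair S x y"
  shows "krull_dim (R\<lparr>carrier := S\<rparr>) = enat 2"
proof -
  note r = regular_pair_D[OF G]
  note g = two_generated_D[OF r(1)]
  note c = subring_simps[OF g(5)]
  define C where "C i = (if i = 0 then {\<zero>} else if i = 1 then multiples S x else nonunits S)" for i :: nat
  have x: "{\<zero>} \<subset> multiples S x" "multiples S x \<subset> nonunits S"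
    using r(5,6) prime_in_D(1)[OF r(4)] ideal_in_D(3) prime_in_local[OF g(5) r(4)] by auto
  show ?thesis
  proof (rule krull_dim_eqI)
    show "prime_chain (R\<lparr>carrier := S\<rparr>) 2 C"
      unfolding prime_chain_iff[OF g(5)] C_def
      using prime_in_zero[OF g(5)] prime_in_nonunits[OF g(1)] r(4) x by (auto simp: less_2_cases_iff)
    fix c show "\<not> prime_chain (R\<lparr>carrier := S\<rparr>) (Suc 2) c"
    proof
      \<comment> \<open>Of the four primes the two middle ones are nonzero and not maximal, yet
        strictly nested.\<close>
      assume "prime_chain (R\<lparr>carrier := S\<rparr>) (Suc 2) c"
      hence pr: "i \<le> 3 \<Longrightarrow> prime_in S (c i)" and ss: "i < 3 \<Longrightarrow> c i \<subset> c (Suc i)" for i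
        unfolding prime_chain_iff[OF g(5)] by (auto simp: eval_nat_numeral)
      have "\<zero> \<in> c 0" using pr[of 0] prime_in_D(1) ideal_in_D(3) by blast
      hence 1: "c 1 \<noteq> {\<zero>}" using ss[of 0] by auto
      have 2: "c 1 \<subset> c 2" "c 2 \<subset> c 3" using ss[of 1] ss[of 2] by (simp_all add: eval_nat_numeral)
      have 3: "c 2 \<noteq> nonunits S" using 2 prime_in_local[OF g(5) pr[of 3]] by auto
      show False using regular_pair_prime_eq[OF G pr[of 1] 1 pr[of 2] 3] 2 by auto
    qed
  qed
qed

lemma regular_pair_imp_regular_local_ring:
  assumes G: "regular_pair S x y"
  shows "regular_local_ring (R\<lparr>carrier := S\<rparr>)"
proof -
  note r = regular_pair_D[OF G]
  note g = two_generated_D[OF r(1)]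
  have "x \<noteq> y" using r(3) multiples_self[OF g(5,3)] by auto
  hence "card {x, y} = 2" by simp
  thus ?thesis
    using two_generated_subset_nonunits[OF r(1)] g(7,8) regular_pair_dim[OF G]
    by (intro regular_local_ringI[OF g(1,2), of "{x, y}"]) auto
qed

text \<open>A prime missing \<open>p\<close> would be divisible by \<open>p\<close> within itself
  indefinitely, hence zero. This gives dimension one for a principal maximal ideal and, conversely,
  shows that a two-dimensional ring cannot have one.\<close>

lemma principal_prime_unique:
  assumes L: "local_in S" "noetherian_in S" and p: "p \<in> S" "nonunits S = multiples S p"
    and Q: "prime_in S Q" "Q \<noteq> {\<zero>}"
  shows "Q = nonunits S"
proof -
  note l = local_in_D[OF L(1)]
  note q = ideal_in_simps[OF l(1) prime_in_D(1)[OF Q(1)]]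
  have Qm: "Q \<subseteq> nonunits S" using prime_in_local[OF l(1) Q(1)] .
  have pm: "p \<in> nonunits S" using multiples_self[OF l(1) p(1)] p(2) by simp
  have "p \<in> Q"
  proof (rule ccontr)
    assume pQ: "p \<notin> Q"
    have "Q \<subseteq> {\<zero>}"
    proof (rule ideal_zero_if_divisible[OF L pm])
      show "Q \<subseteq> S" using q by blast
      fix z assume z: "z \<in> Q"
      then obtain w where "w \<in> S" "z = p \<otimes> w" using Qm p(2) by (auto simp: multiples_def)
      thus "\<exists>w\<in>Q. z = p \<otimes> w" using z pQ prime_in_D(3)[OF Q(1) p(1)] by blast
    qed
    thus False using Q(2) q(2) by blast
  qed
  thus ?thesis using Qm multiples_subset[OF l(1) prime_in_D(1)[OF Q(1)], of p] p(2) by blast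
qed

text \<open>Applied to localizations of the intersection at primes that are neither zero nor
  maximal.\<close>

lemma principal_imp_regular_local_ring:
  assumes L: "local_in S" "noetherian_in S" and p: "p \<in> S" "p \<noteq> \<zero>" "nonunits S = multiples S p"
  shows "regular_local_ring (R\<lparr>carrier := S\<rparr>)"
proof -
  note l = local_in_D[OF L(1)]
  have pm: "p \<in> nonunits S" using multiples_self[OF l(1) p(1)] p(3) by simp
  define C where "C i = (if i = 0 then {\<zero>} else nonunits S)" for i :: nat
  have "krull_dim (R\<lparr>carrier := S\<rparr>) = enat 1"
  proof (rule krull_dim_eqI)
    show "prime_chain (R\<lparr>carrier := S\<rparr>) 1 C"
      unfolding prime_chain_iff[OF l(1)] C_def
      using prime_in_zero[OF l(1)] prime_in_nonunits[OF L(1)] pm p(2) ideal_in_D(3)[OF l(2)] by auto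
    fix c show "\<not> prime_chain (R\<lparr>carrier := S\<rparr>) (Suc 1) c"
    proof
      assume "prime_chain (R\<lparr>carrier := S\<rparr>) (Suc 1) c"
      hence pr: "i \<le> 2 \<Longrightarrow> prime_in S (c i)" and ss: "i < 2 \<Longrightarrow> c i \<subset> c (Suc i)" for i
        unfolding prime_chain_iff[OF l(1)] by (auto simp: eval_nat_numeral)
      have "\<zero> \<in> c 0" using pr[of 0] prime_in_D(1) ideal_in_D(3) by blast
      hence 1: "c 1 \<noteq> {\<zero>}" using ss[of 0] by auto
      have 2: "c 1 \<subset> c 2" using ss[of 1] by (simp add: eval_nat_numeral)
      show False
        using principal_prime_unique[OF L p(1,3) pr[of 1] 1] 2 prime_in_local[OF l(1) pr[of 2]] by auto
    qed
  qed
  thus ?thesis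
    using multiples_subset[OF l(1)] p(3) pm
    by (intro regular_local_ringI[OF L, of "{p}"]) auto
qed

lemma ideal_in_carrier:
  assumes "ideal_in (carrier R) I" "I \<noteq> {\<zero>}"
  shows "I = carrier R"
proof -
  obtain x where x: "x \<in> I" "x \<noteq> \<zero>" using assms ideal_in_D(3) by blast
  have "inv x \<otimes> x \<in> I"
    using ideal_in_D(5)[OF assms(1), of "inv x" x] x ideal_in_D(2)[OF assms(1) x(1)] by (simp del: mult_inv)
  moreover have "x \<in> carrier R" using x ideal_in_D(2)[OF assms(1)] by blast
  ultimately have "\<one> \<in> I" using x by simp
  thus ?thesis using ideal_in_one[OF carrier_is_subring assms(1)] by blast
qed

lemma carrier_local: "local_in (carrier R)" "nonunits (carrier R) = {\<zero>}"
proof -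
  show eq: "nonunits (carrier R) = {\<zero>}" unfolding nonunits_def by auto
  show "local_in (carrier R)"
    unfolding local_in_def eq using ideal_in_zero carrier_is_subring by blast
qed

lemma noetherian_in_carrier: "noetherian_in (carrier R)"
  unfolding noetherian_in_def
proof (intro allI impI)
  fix I assume I: "ideal_in (carrier R) I"
  show "\<exists>A. finite A \<and> A \<subseteq> I \<and> (\<forall>J. ideal_in (carrier R) J \<and> A \<subseteq> J \<longrightarrow> I \<subseteq> J)"
  proof (cases "I = {\<zero>}")
    case True
    thus ?thesis by (intro exI[of _ "{}"]) (auto simp: ideal_in_def)
  next
    case False
    hence I: "I = carrier R" using ideal_in_carrier[OF I] by blast
    show ?thesis
      unfolding I using ideal_in_one[OF carrier_is_subring] by (intro exI[of _ "{\<one>}"]) auto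
  qed
qed

text \<open>Needed for the zero prime, whose localization is the whole field: dimension zero with an
  empty system of parameters.\<close>

lemma carrier_regular_local_ring: "regular_local_ring (R\<lparr>carrier := carrier R\<rparr>)"
proof -
  have pz: "prime_in (carrier R) P \<longleftrightarrow> P = {\<zero>}" for P
    using prime_in_zero[OF carrier_is_subring] ideal_in_carrier[of P] prime_in_D(1,2)[of "carrier R" P] by auto
  have "krull_dim (R\<lparr>carrier := carrier R\<rparr>) = enat 0"
    by (rule krull_dim_eqI[of _ _ "\<lambda>_. {\<zero>}"]) (unfold prime_chain_iff[OF carrier_is_subring] pz, auto)
  thus ?thesis
    using ideal_in_D(3)
    by (intro regular_local_ringI[OF carrier_local(1) noetherian_in_carrier, of "{}"]) (auto simp: carrier_local(2))
qed

text \<open>The dimension contributes the number of generators and one further fact: the second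
  prime of a chain of length at least two is neither zero nor maximal, which is what
  \<open>regular_pairI\<close> asks for.\<close>

lemma two_dim_imp_regular_pair:
  assumes "two_dim_regular_local_ring R S"
  shows "\<exists>x y. regular_pair S x y"
proof -
  have S: "subring S R" and reg: "regular_local_ring (R\<lparr>carrier := S\<rparr>)" and dim: "krull_dim (R\<lparr>carrier := S\<rparr>) = 2"
    using assms by (auto simp: two_dim_regular_local_ring_def)
  note c = subring_simps[OF S]
  have N: "noetherian_in S" using reg noetherian_iff[OF S] by (auto simp: regular_local_ring_def)
  have un: "\<exists>!M. maximal_in S M" using reg maximalideal_iff[OF S] by (simp add: regular_local_ring_def)
  then obtain M where M: "maximal_in S M" by blast
  have L: "local_in S" and nM: "nonunits S = M" using nonunits_eq_maximal[OF S M] un M by blast+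
  obtain G where G: "G \<subseteq> S" "finite G" "maximal_in S (genideal (R\<lparr>carrier := S\<rparr>) G)" "card G = 2"
    using reg dim maximalideal_iff[OF S] by (auto simp: regular_local_ring_def numeral_eq_enat)
  obtain x y where xy: "G = {x, y}" using G(4) by (auto simp: card_2_iff)
  have gen: "genideal (R\<lparr>carrier := S\<rparr>) {x, y} = nonunits S" using G(3) un M nM xy by blast
  have xyS: "x \<in> S" "y \<in> S" using G xy by auto
  have xyn: "x \<in> nonunits S" "y \<in> nonunits S" unfolding gen[symmetric] by (auto simp: genideal_def)
  have two: "two_generated S x y"
  proof (rule two_generatedI[OF L N xyn])
    fix z assume z: "z \<in> nonunits S"
    let ?I = "{j \<oplus> s \<otimes> y | j s. j \<in> multiples S x \<and> s \<in> S}"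
    have I: "ideal_in S ?I" by (rule ideal_add_multiples[OF S multiples_ideal[OF S xyS(1)] xyS(2)])
    have 1: "x = x \<oplus> \<zero> \<otimes> y" "y = \<zero> \<oplus> \<one> \<otimes> y" using xyS by (simp_all add: c)
    have "x \<in> ?I" "y \<in> ?I"
      using 1 multiples_self[OF S xyS(1)] ideal_in_D(3)[OF multiples_ideal[OF S xyS(1)]] c(1,2) by blast+
    hence "genideal (R\<lparr>carrier := S\<rparr>) {x, y} \<subseteq> ?I" using I by (auto simp: genideal_def ideal_iff[OF S])
    hence "z \<in> ?I" using z gen by blast
    then obtain s t where "s \<in> S" "t \<in> S" "z = x \<otimes> s \<oplus> t \<otimes> y" by (auto simp: multiples_def)
    moreover from this have "z = s \<otimes> x \<oplus> t \<otimes> y" using xyS by (simp add: c m_comm)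
    ultimately show "\<exists>s\<in>S. \<exists>t\<in>S. z = s \<otimes> x \<oplus> t \<otimes> y" by blast
  qed
  have "enat (Suc 1) \<le> krull_dim (R\<lparr>carrier := S\<rparr>)" using dim by (simp add: numeral_eq_enat)
  then obtain n where n: "n > 1" "\<exists>c. prime_chain (R\<lparr>carrier := S\<rparr>) n c"
    unfolding krull_dim_def using le_enat_SUP_imp[of 1 "\<lambda>n. \<exists>c. prime_chain (R\<lparr>carrier := S\<rparr>) n c"] by auto
  then obtain C where C: "\<forall>i\<le>n. prime_in S (C i)" "\<forall>i<n. C i \<subset> C (Suc i)"
    unfolding prime_chain_iff[OF S] by blast
  have pr: "prime_in S (C 0)" "prime_in S (C 1)" "prime_in S (C 2)" and ss: "C 0 \<subset> C 1" "C 1 \<subset> C 2"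
    using C n(1) by (auto simp: eval_nat_numeral)
  have "\<zero> \<in> C 0" using pr(1) prime_in_D(1) ideal_in_D(3) by blast
  hence "C 1 \<noteq> {\<zero>}" using ss by auto
  moreover have "C 1 \<noteq> nonunits S" using ss prime_in_local[OF S pr(3)] by auto
  ultimately show ?thesis using regular_pairI[OF two pr(2)] by blast
qed

subsection \<open>Localizations and simple ring extensions\<close>

lemma fractionsI: "a \<in> S \<Longrightarrow> b \<in> M \<Longrightarrow> a \<otimes> inv b \<in> fractions R S M"
  by (auto simp: fractions_def)

lemma fractionsE:
  assumes "z \<in> fractions R S M"
  obtains a b where "a \<in> S" "b \<in> M" "z = a \<otimes> inv b"
  using assms by (auto simp: fractions_def)

lemma frac_add:
  assumes "a \<in> carrier R" "b \<in> carrier R" "c \<in> carrier R" "d \<in> carrier R" "b \<noteq> \<zero>" "d \<noteq> \<zero>"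
  shows "a \<otimes> inv b \<oplus> c \<otimes> inv d = (a \<otimes> d \<oplus> c \<otimes> b) \<otimes> inv (b \<otimes> d)"
  using assms by (simp add: field_arith)

lemma frac_mult:
  assumes "a \<in> carrier R" "b \<in> carrier R" "c \<in> carrier R" "d \<in> carrier R" "b \<noteq> \<zero>" "d \<noteq> \<zero>"
  shows "(a \<otimes> inv b) \<otimes> (c \<otimes> inv d) = (a \<otimes> c) \<otimes> inv (b \<otimes> d)"
  using assms by (simp add: field_arith)

lemma frac_eqD:
  assumes "a \<in> carrier R" "b \<in> carrier R" "c \<in> carrier R" "d \<in> carrier R" "b \<noteq> \<zero>" "d \<noteq> \<zero>"
    "a \<otimes> inv b = c \<otimes> inv d"
  shows "a \<otimes> d = c \<otimes> b"
proof -
  have "a \<otimes> d = (a \<otimes> inv b) \<otimes> (b \<otimes> d)" using assms(1-6) by (simp add: field_arith)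
  also have "\<dots> = c \<otimes> b" unfolding assms(7) using assms(1-6) by (simp add: field_arith)
  finally show ?thesis .
qed

context
  fixes S P assumes S: "subring S R" and P: "prime_in S P"
begin

lemma denominator:
  assumes "b \<in> S - P"
  shows "b \<in> S" "b \<noteq> \<zero>" "b \<in> carrier R" "inv b \<in> carrier R" "inv b \<noteq> \<zero>"
proof -
  show "b \<in> S" "b \<noteq> \<zero>" using assms ideal_in_D(3)[OF prime_in_D(1)[OF P]] by auto
  thus "b \<in> carrier R" "inv b \<in> carrier R" "inv b \<noteq> \<zero>" using subring_simps(8)[OF S] by auto
qed

lemma denominator_mult: "b \<in> S - P \<Longrightarrow> d \<in> S - P \<Longrightarrow> b \<otimes> d \<in> S - P"
  using prime_in_D(3)[OF P] subring_simps(4)[OF S] by auto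

lemma denominator_one: "\<one> \<in> S - P"
  using prime_in_D(2)[OF P] subring_simps(2)[OF S] by auto

lemma fractions_ideal_closed:
  assumes Q: "ideal_in S Q" and z: "z \<in> fractions R Q (S - P)"
  shows "w \<in> fractions R Q (S - P) \<Longrightarrow> z \<oplus> w \<in> fractions R Q (S - P)"
    "w \<in> fractions R S (S - P) \<Longrightarrow> w \<otimes> z \<in> fractions R Q (S - P)"
proof -
  note q = ideal_in_simps[OF S Q] and c = subring_simps[OF S]
  obtain a b where z: "a \<in> Q" "b \<in> S - P" "z = a \<otimes> inv b" using z by (rule fractionsE)
  note b = denominator[OF z(2)]
  {
    assume "w \<in> fractions R Q (S - P)"
    then obtain x y where w: "x \<in> Q" "y \<in> S - P" "w = x \<otimes> inv y" by (rule fractionsE)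
    note y = denominator[OF w(2)]
    have "z \<oplus> w = (a \<otimes> y \<oplus> x \<otimes> b) \<otimes> inv (b \<otimes> y)"
      unfolding z(3) w(3) using z(1) w(1) b y by (intro frac_add) (auto simp: q)
    moreover have "a \<otimes> y \<oplus> x \<otimes> b \<in> Q" using z(1) w(1) b(1) y(1) by (simp add: q)
    ultimately show "z \<oplus> w \<in> fractions R Q (S - P)" using denominator_mult[OF z(2) w(2)] fractionsI by metis
  }
  {
    assume "w \<in> fractions R S (S - P)"
    then obtain x y where w: "x \<in> S" "y \<in> S - P" "w = x \<otimes> inv y" by (rule fractionsE)
    note y = denominator[OF w(2)]
    have "w \<otimes> z = (x \<otimes> a) \<otimes> inv (y \<otimes> b)"
      unfolding z(3) w(3) using z(1) w(1) b y by (intro frac_mult) (auto simp: q c)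
    moreover have "x \<otimes> a \<in> Q" using z(1) w(1) by (simp add: q)
    ultimately show "w \<otimes> z \<in> fractions R Q (S - P)" using denominator_mult[OF w(2) z(2)] fractionsI by metis
  }
qed

lemma fractions_incl: "Q \<subseteq> S \<Longrightarrow> x \<in> Q \<Longrightarrow> x \<in> fractions R Q (S - P)"
  using fractionsI[of x Q \<one>, OF _ denominator_one] subring_simps(8)[OF S, of x] by auto

lemma inv_denominator: "b \<in> S - P \<Longrightarrow> inv b \<in> localization_at R S P"
  using fractionsI[of \<one> S b "S - P"] denominator[of b] subring_simps(2)[OF S] by (simp add: localization_at_def)

lemma localization_subring: "subring (localization_at R S P) R"
  unfolding localization_at_def
proof (rule subringI)
  note c = subring_simps[OF S]
  show "fractions R S (S - P) \<subseteq> carrier R"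
    using denominator(4) c(8) by (auto simp: fractions_def)
  show one: "\<one> \<in> fractions R S (S - P)" using fractions_incl[of S \<one>] c by simp
  note cl = fractions_ideal_closed[OF ideal_in_self[OF S]]
  fix x y assume x: "x \<in> fractions R S (S - P)" "y \<in> fractions R S (S - P)"
  show "x \<otimes> y \<in> fractions R S (S - P)" "x \<oplus> y \<in> fractions R S (S - P)" using cl x by auto
next
  note c = subring_simps[OF S]
  fix x assume "x \<in> fractions R S (S - P)"
  then obtain a b where z: "a \<in> S" "b \<in> S - P" "x = a \<otimes> inv b" by (rule fractionsE)
  hence "\<ominus> x = (\<ominus> a) \<otimes> inv b" using denominator[OF z(2)] c(8)[OF z(1)] by (simp add: l_minus)
  thus "\<ominus> x \<in> fractions R S (S - P)" using fractionsI[OF _ z(2)] z(1) c(3) by simp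
qed

lemma localization_superset: "S \<subseteq> localization_at R S P"
  unfolding localization_at_def using fractions_incl[of S] by blast

lemma fractions_ideal:
  assumes Q: "ideal_in S Q"
  shows "ideal_in (localization_at R S P) (fractions R Q (S - P))"
  unfolding ideal_in_def localization_at_def
proof (intro conjI ballI)
  show "fractions R Q (S - P) \<subseteq> fractions R S (S - P)" using ideal_in_D(1)[OF Q] by (auto simp: fractions_def)
  show "\<zero> \<in> fractions R Q (S - P)" using fractions_incl ideal_in_D[OF Q] by blast
qed (use fractions_ideal_closed[OF Q] in auto)

lemma fractions_contract:
  assumes Q: "prime_in S Q" "Q \<subseteq> P" and a: "a \<in> S" "b \<in> S - P" "a \<otimes> inv b \<in> fractions R Q (S - P)"
  shows "a \<in> Q"
proof -
  note q = ideal_in_simps[OF S prime_in_D(1)[OF Q(1)]] and c = subring_simps[OF S]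
  obtain x y where x: "x \<in> Q" "y \<in> S - P" "a \<otimes> inv b = x \<otimes> inv y" using a(3) by (rule fractionsE)
  have "a \<otimes> y = x \<otimes> b"
    using denominator[OF a(2)] denominator[OF x(2)] c(8)[OF a(1)] q(8)[OF x(1)]
    by (intro frac_eqD[OF _ _ _ _ _ _ x(3)])
  also have "\<dots> \<in> Q" using x(1) denominator(1)[OF a(2)] by (simp add: q)
  finally show ?thesis using prime_in_D(3)[OF Q(1) a(1), of y] x(2) Q(2) by auto
qed

lemma fractions_prime:
  assumes Q: "prime_in S Q" "Q \<subseteq> P"
  shows "prime_in (localization_at R S P) (fractions R Q (S - P))"
  unfolding prime_in_def
proof (intro conjI ballI impI)
  note q = ideal_in_simps[OF S prime_in_D(1)[OF Q(1)]] and c = subring_simps[OF S]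
  show "ideal_in (localization_at R S P) (fractions R Q (S - P))" by (rule fractions_ideal[OF prime_in_D(1)[OF Q(1)]])
  show "\<one> \<notin> fractions R Q (S - P)"
    using fractions_contract[OF Q, of \<one> \<one>] denominator_one prime_in_D(2)[OF Q(1)] by auto
  fix z w assume zw: "z \<in> localization_at R S P" "w \<in> localization_at R S P" "z \<otimes> w \<in> fractions R Q (S - P)"
  obtain a b where z: "a \<in> S" "b \<in> S - P" "z = a \<otimes> inv b" using zw(1) unfolding localization_at_def by (rule fractionsE)
  obtain x y where w: "x \<in> S" "y \<in> S - P" "w = x \<otimes> inv y" using zw(2) unfolding localization_at_def by (rule fractionsE)
  have "z \<otimes> w = (a \<otimes> x) \<otimes> inv (b \<otimes> y)"
    unfolding z w using z w denominator[OF z(2)] denominator[OF w(2)] by (intro frac_mult) (auto simp: c)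
  hence "a \<otimes> x \<in> Q" using fractions_contract[OF Q _ denominator_mult[OF z(2) w(2)]] zw(3) z(1) w(1) c(4) by simp
  hence "a \<in> Q \<or> x \<in> Q" using prime_in_D(3)[OF Q(1)] z w by blast
  thus "z \<in> fractions R Q (S - P) \<or> w \<in> fractions R Q (S - P)" using z w fractionsI by blast
qed

lemma localization_nonunits: "nonunits (localization_at R S P) = fractions R P (S - P)"
proof
  note c = subring_simps[OF S] and p = ideal_in_simps[OF S prime_in_D(1)[OF P]]
  note pr = fractions_prime[OF P order_refl]
  show "fractions R P (S - P) \<subseteq> nonunits (localization_at R S P)"
    using proper_ideal_nonunits[OF localization_subring prime_in_D(1)[OF pr] prime_in_D(2)[OF pr]] .
  show "nonunits (localization_at R S P) \<subseteq> fractions R P (S - P)"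
  proof
    fix z assume z: "z \<in> nonunits (localization_at R S P)"
    hence "z \<in> localization_at R S P" by (simp add: nonunits_def)
    then obtain a b where ab: "a \<in> S" "b \<in> S - P" "z = a \<otimes> inv b" unfolding localization_at_def by (rule fractionsE)
    have "a \<in> P"
    proof (rule ccontr)
      assume a: "a \<notin> P"
      hence a: "a \<in> S - P" using ab by simp
      have "z \<noteq> \<zero>" "inv z = b \<otimes> inv a"
        unfolding ab(3) using denominator[OF a] denominator[OF ab(2)] by (auto simp: inv_mult_nonzero m_comm)
      thus False using z fractionsI[OF denominator(1)[OF ab(2)] a] by (simp add: nonunits_def localization_at_def)
    qed
    thus "z \<in> fractions R P (S - P)" using ab fractionsI by blast
  qed
qed

lemma localization_local: "local_in (localization_at R S P)"
  unfolding local_in_def localization_nonunits using localization_subring fractions_ideal[OF prime_in_D(1)[OF P]] by blast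

lemma localization_contract: "x \<in> S \<Longrightarrow> x \<in> nonunits (localization_at R S P) \<longleftrightarrow> x \<in> P"
  using fractions_contract[OF P order_refl, of x \<one>] denominator_one fractions_incl[of P x] subring_simps(8)[OF S, of x]
    ideal_in_D(1)[OF prime_in_D(1)[OF P]]
  unfolding localization_nonunits by auto

text \<open>Generators of the contraction of \<open>I\<close> to \<open>S\<close> also generate
  \<open>I\<close>, because denominators are units.\<close>

lemma localization_noetherian:
  assumes N: "noetherian_in S"
  shows "noetherian_in (localization_at R S P)"
  unfolding noetherian_in_def
proof (intro allI impI)
  let ?T = "localization_at R S P"
  note c = subring_simps[OF S] and T = localization_subring
  note cT = subring_simps[OF T]
  have con: "ideal_in S (J \<inter> S)" if J: "ideal_in ?T J" for J
    unfolding ideal_in_def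
    using ideal_in_simps[OF T J] c localization_superset by auto
  fix I assume I: "ideal_in ?T I"
  obtain A where A: "finite A" "A \<subseteq> I \<inter> S" "\<And>J. ideal_in S J \<Longrightarrow> A \<subseteq> J \<Longrightarrow> I \<inter> S \<subseteq> J"
    using N con[OF I] unfolding noetherian_in_def by meson
  show "\<exists>A. finite A \<and> A \<subseteq> I \<and> (\<forall>J. ideal_in ?T J \<and> A \<subseteq> J \<longrightarrow> I \<subseteq> J)"
  proof (intro exI[of _ A] conjI allI impI subsetI)
    fix J z assume J: "ideal_in ?T J \<and> A \<subseteq> J" and z: "z \<in> I"
    hence sub: "I \<inter> S \<subseteq> J \<inter> S" using A(2) by (intro A(3) con) auto
    have "z \<in> ?T" using z ideal_in_D(2)[OF I] by blast
    then obtain a b where ab: "a \<in> S" "b \<in> S - P" "z = a \<otimes> inv b" unfolding localization_at_def by (rule fractionsE)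
    note b = denominator[OF ab(2)]
    have "b \<otimes> z = a" unfolding ab(3) using b c(8)[OF ab(1)] by (simp add: mult_inv_cancel)
    moreover have "b \<otimes> z \<in> I" using ideal_in_D(5)[OF I _ z] b localization_superset by blast
    ultimately have "a \<in> J" using sub ab(1) by blast
    hence "inv b \<otimes> a \<in> J" using ideal_in_D(5)[of ?T J "inv b" a] J inv_denominator[OF ab(2)] by blast
    thus "z \<in> J" unfolding ab(3) using b c(8)[OF ab(1)] by (simp add: m_comm)
  qed (use A in auto)
qed

lemma localization_multiples:
  assumes f: "f \<in> S"
  shows "multiples (localization_at R S P) f = fractions R (multiples S f) (S - P)"
proof (intro equalityI subsetI)
  note c = subring_simps[OF S]
  fix z assume "z \<in> multiples (localization_at R S P) f"
  then obtain a b where ab: "a \<in> S" "b \<in> S - P" "z = f \<otimes> (a \<otimes> inv b)"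
    by (auto simp: multiples_def localization_at_def fractions_def)
  hence "z = (f \<otimes> a) \<otimes> inv b" using denominator[OF ab(2)] f by (simp add: c m_assoc)
  thus "z \<in> fractions R (multiples S f) (S - P)" using fractionsI[OF multiplesI[OF ab(1)] ab(2)] by simp
next
  note c = subring_simps[OF S]
  fix z assume "z \<in> fractions R (multiples S f) (S - P)"
  then obtain a b where ab: "a \<in> S" "b \<in> S - P" "z = (f \<otimes> a) \<otimes> inv b"
    by (auto simp: multiples_def fractions_def)
  hence "z = f \<otimes> (a \<otimes> inv b)" using denominator[OF ab(2)] f by (simp add: c m_assoc)
  thus "z \<in> multiples (localization_at R S P) f"
    using multiplesI[OF fractionsI[OF ab(1,2)]] by (simp add: localization_at_def)
qed

text \<open>The defining properties of a regular pair survive localization directly. With f = a and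
  \<open>P\<close> a maximal ideal of a chart, this gives regularity of the quadratic
  transform.\<close>

lemma localization_regular_pair:
  assumes N: "noetherian_in S" and f: "f \<in> P" "f \<noteq> \<zero>" "prime_in S (multiples S f)" and g: "g \<in> P" "g \<notin> multiples S f"
    and gen: "\<And>z. z \<in> P \<Longrightarrow> \<exists>s\<in>S. \<exists>t\<in>S. z = s \<otimes> f \<oplus> t \<otimes> g"
  shows "regular_pair (localization_at R S P) f g"
proof -
  let ?T = "localization_at R S P"
  note c = subring_simps[OF S] and p = ideal_in_simps[OF S prime_in_D(1)[OF P]]
  have fg: "f \<in> S" "g \<in> S" using f g p by auto
  have sub: "multiples S f \<subseteq> P" using multiples_subset[OF S prime_in_D(1)[OF P] f(1)] .
  have two: "two_generated ?T f g"
  proof (rule two_generatedI[OF localization_local localization_noetherian[OF N]])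
    show "f \<in> nonunits ?T" "g \<in> nonunits ?T" using localization_contract fg f g by auto
    fix z assume "z \<in> nonunits ?T"
    then obtain a b where ab: "a \<in> P" "b \<in> S - P" "z = a \<otimes> inv b" unfolding localization_nonunits by (rule fractionsE)
    obtain s t where st: "s \<in> S" "t \<in> S" "a = s \<otimes> f \<oplus> t \<otimes> g" using gen ab(1) by blast
    have "z = (s \<otimes> inv b) \<otimes> f \<oplus> (t \<otimes> inv b) \<otimes> g"
      unfolding ab(3) st(3) using st(1,2) fg denominator[OF ab(2)] by (simp add: c field_arith)
    thus "\<exists>s\<in>?T. \<exists>t\<in>?T. z = s \<otimes> f \<oplus> t \<otimes> g"
      using fractionsI[OF st(1) ab(2)] fractionsI[OF st(2) ab(2)] unfolding localization_at_def by blast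
  qed
  have "prime_in ?T (multiples ?T f)"
    unfolding localization_multiples[OF fg(1)] by (rule fractions_prime[OF f(3) sub])
  moreover have "g \<notin> multiples ?T f"
    using fractions_contract[OF f(3) sub fg(2) denominator_one] g(2) fg
    unfolding localization_multiples[OF fg(1)] by (auto simp: c)
  ultimately show ?thesis unfolding regular_pair_def using two f(2) by blast
qed

end

text \<open>Values at \<open>t\<close> of polynomials over \<open>S\<close> of degree less than
  \<open>n\<close>. Only values are recorded, so one element may have several representations and
  its leading coefficient depends on the one chosen.\<close>

primrec polys :: "'a set \<Rightarrow> 'a \<Rightarrow> nat \<Rightarrow> 'a set" where
  "polys S t 0 = {\<zero>}"
| "polys S t (Suc n) = {w \<oplus> s \<otimes> t [^] n | w s. w \<in> polys S t n \<and> s \<in> S}"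

definition adjoin :: "'a set \<Rightarrow> 'a \<Rightarrow> 'a set" where
  "adjoin S t = (\<Union>n. polys S t n)"

context
  fixes S t assumes S: "subring S R" and t: "t \<in> carrier R"
begin

lemma polys_SucE:
  assumes "z \<in> polys S t (Suc n)"
  obtains w s where "w \<in> polys S t n" "s \<in> S" "z = w \<oplus> s \<otimes> t [^] n"
  using assms by auto

lemma polys_SucI: "w \<in> polys S t n \<Longrightarrow> s \<in> S \<Longrightarrow> w \<oplus> s \<otimes> t [^] n \<in> polys S t (Suc n)"
  by auto

lemma polys_carrier: "w \<in> polys S t n \<Longrightarrow> w \<in> carrier R"
  by (induction n arbitrary: w) (use t subring_simps[OF S] in auto)

lemma polys_Suc: "w \<in> polys S t n \<Longrightarrow> w \<in> polys S t (Suc n)"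
  using polys_SucI[of w n \<zero>] subring_simps(1)[OF S] polys_carrier[of w n] t by simp

lemma polys_mono: "m \<le> n \<Longrightarrow> w \<in> polys S t m \<Longrightarrow> w \<in> polys S t n"
  by (induction n rule: dec_induct) (auto intro: polys_Suc simp del: polys.simps(2))

lemma polys_zero: "\<zero> \<in> polys S t n"
  using polys_mono[of 0 n \<zero>] by simp

lemma polys_add: "v \<in> polys S t n \<Longrightarrow> w \<in> polys S t n \<Longrightarrow> v \<oplus> w \<in> polys S t n"
proof (induction n arbitrary: v w)
  case (Suc n)
  note c = subring_simps[OF S]
  obtain v' a where v: "v' \<in> polys S t n" "a \<in> S" "v = v' \<oplus> a \<otimes> t [^] n" using Suc(2) by (rule polys_SucE)
  obtain w' b where w: "w' \<in> polys S t n" "b \<in> S" "w = w' \<oplus> b \<otimes> t [^] n" using Suc(3) by (rule polys_SucE)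
  have "v \<oplus> w = (v' \<oplus> w') \<oplus> (a \<oplus> b) \<otimes> t [^] n"
    unfolding v(3) w(3) using polys_carrier[OF v(1)] polys_carrier[OF w(1)] v(2) w(2) t by (simp add: c field_arith)
  thus ?case using polys_SucI[OF Suc(1)[OF v(1) w(1)] c(5)[OF v(2) w(2)]] by simp
qed simp

lemma polys_smult: "s \<in> S \<Longrightarrow> w \<in> polys S t n \<Longrightarrow> s \<otimes> w \<in> polys S t n"
proof (induction n arbitrary: w)
  case 0
  thus ?case using subring_simps(8)[OF S] by simp
next
  case (Suc n)
  note c = subring_simps[OF S]
  obtain w' b where w: "w' \<in> polys S t n" "b \<in> S" "w = w' \<oplus> b \<otimes> t [^] n" using Suc(3) by (rule polys_SucE)
  have "s \<otimes> w = s \<otimes> w' \<oplus> (s \<otimes> b) \<otimes> t [^] n"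
    unfolding w(3) using polys_carrier[OF w(1)] w(2) t Suc(2) by (simp add: c field_arith)
  thus ?case using polys_SucI[OF Suc(1)[OF Suc(2) w(1)] c(4)[OF Suc(2) w(2)]] by simp
qed

lemma polys_minus: "w \<in> polys S t n \<Longrightarrow> \<ominus> w \<in> polys S t n"
  using polys_smult[of "\<ominus> \<one>" w n] subring_simps(2,3)[OF S] polys_carrier[of w n] by (simp add: l_minus)

lemma polys_t: "w \<in> polys S t n \<Longrightarrow> t \<otimes> w \<in> polys S t (Suc n)"
proof (induction n arbitrary: w)
  case 0
  thus ?case using t polys_zero[of "Suc 0"] by (simp del: polys.simps(2))
next
  case (Suc n)
  note c = subring_simps[OF S]
  obtain w' b where w: "w' \<in> polys S t n" "b \<in> S" "w = w' \<oplus> b \<otimes> t [^] n" using Suc(2) by (rule polys_SucE)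
  have "t \<otimes> w = t \<otimes> w' \<oplus> b \<otimes> t [^] (Suc n)"
    unfolding w(3) using polys_carrier[OF w(1)] w(2) t by (simp add: c field_arith)
  thus ?case using polys_SucI[OF Suc(1)[OF w(1)] w(2)] by simp
qed

lemma polys_tpow: "w \<in> polys S t n \<Longrightarrow> t [^] k \<otimes> w \<in> polys S t (k + n)"
proof (induction k)
  case 0
  thus ?case using polys_carrier[of w n] by simp
next
  case (Suc k)
  have "t [^] Suc k \<otimes> w = t \<otimes> (t [^] k \<otimes> w)" using Suc(2) polys_carrier[of w n] t by (simp add: m_ac)
  thus ?case using polys_t[OF Suc(1)[OF Suc(2)]] by simp
qed

lemma polys_mult: "v \<in> polys S t m \<Longrightarrow> w \<in> polys S t n \<Longrightarrow> v \<otimes> w \<in> polys S t (m + n)"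
proof (induction m arbitrary: v)
  case 0
  thus ?case using polys_carrier[of w n] polys_zero by simp
next
  case (Suc m)
  note c = subring_simps[OF S]
  obtain v' a where v: "v' \<in> polys S t m" "a \<in> S" "v = v' \<oplus> a \<otimes> t [^] m" using Suc(2) by (rule polys_SucE)
  have "v \<otimes> w = v' \<otimes> w \<oplus> a \<otimes> (t [^] m \<otimes> w)"
    unfolding v(3) using polys_carrier[OF v(1)] polys_carrier[OF Suc(3)] v(2) t by (simp add: c field_arith)
  moreover have "v' \<otimes> w \<oplus> a \<otimes> (t [^] m \<otimes> w) \<in> polys S t (m + n)"
    using polys_add Suc(1)[OF v(1) Suc(3)] polys_smult[OF v(2) polys_tpow[OF Suc(3)]] by blast
  ultimately show ?case using polys_Suc[of _ "m + n"] by simp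
qed

lemma polys_const: "s \<in> S \<Longrightarrow> s \<in> polys S t 1"
  using polys_SucI[of \<zero> 0 s] subring_simps(8)[OF S] by simp

lemma adjoin_subring: "subring (adjoin S t) R"
proof (rule subringI)
  show "adjoin S t \<subseteq> carrier R" using polys_carrier by (auto simp: adjoin_def)
  show "\<one> \<in> adjoin S t" using polys_const subring_simps(2)[OF S] unfolding adjoin_def by blast
  show "\<ominus> h \<in> adjoin S t" if "h \<in> adjoin S t" for h using that polys_minus by (auto simp: adjoin_def)
  fix v w assume "v \<in> adjoin S t" "w \<in> adjoin S t"
  then obtain m n where mn: "v \<in> polys S t m" "w \<in> polys S t n" by (auto simp: adjoin_def)
  show "v \<otimes> w \<in> adjoin S t" using polys_mult[OF mn] by (auto simp: adjoin_def)
  have "v \<oplus> w \<in> polys S t (max m n)"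
    using polys_add polys_mono[of m "max m n" v] polys_mono[of n "max m n" w] mn by simp
  thus "v \<oplus> w \<in> adjoin S t" by (auto simp: adjoin_def)
qed

lemma adjoin_superset: "S \<subseteq> adjoin S t"
  using polys_const unfolding adjoin_def by blast

lemma adjoin_generator: "t \<in> adjoin S t"
proof -
  have "\<zero> \<oplus> \<one> \<otimes> t [^] (1::nat) \<in> polys S t (Suc 1)"
    using polys_SucI[OF polys_zero subring_simps(2)[OF S]] .
  hence "t \<in> polys S t (Suc 1)" using t by (simp del: polys.simps)
  thus ?thesis unfolding adjoin_def by blast
qed

lemma adjoin_least:
  assumes L: "subring L R" "S \<subseteq> L" "t \<in> L"
  shows "adjoin S t \<subseteq> L"
proof -
  have "w \<in> polys S t n \<Longrightarrow> w \<in> L" for w n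
    by (induction n arbitrary: w) (use L subring_simps[OF L(1)] in auto)
  thus ?thesis by (auto simp: adjoin_def)
qed

text \<open>Hilbert's basis theorem through the ideals of leading coefficients, which grow with the
  degree and stabilise. Non-unique representations do no harm: a coefficient counts as soon as some
  representation of some element of the ideal exhibits it.\<close>

lemma adjoin_noetherian:
  assumes N: "noetherian_in S"
  shows "noetherian_in (adjoin S t)"
  unfolding noetherian_in_def
proof (intro allI impI)
  let ?T = "adjoin S t"
  note T = adjoin_subring
  note c = subring_simps[OF S] and cT = subring_simps[OF T]
  define lead where "lead I n = {s \<in> S. \<exists>w\<in>polys S t n. w \<oplus> s \<otimes> t [^] n \<in> I}" for I n
  have lead: "ideal_in S (lead I n)" if I: "ideal_in ?T I" for I n
    unfolding ideal_in_def
  proof (intro conjI ballI)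
    note i = ideal_in_simps[OF T I]
    show "lead I n \<subseteq> S" by (auto simp: lead_def)
    show "\<zero> \<in> lead I n" unfolding lead_def using polys_zero[of n] c(1) i(2) t by (auto intro!: bexI[of _ \<zero>])
    fix x assume "x \<in> lead I n"
    then obtain v where v: "x \<in> S" "v \<in> polys S t n" "v \<oplus> x \<otimes> t [^] n \<in> I" by (auto simp: lead_def)
    note vc = polys_carrier[OF v(2)]
    {
      fix s assume s: "s \<in> S"
      have "s \<otimes> (v \<oplus> x \<otimes> t [^] n) = s \<otimes> v \<oplus> (s \<otimes> x) \<otimes> t [^] n"
        using s v vc t by (simp add: c field_arith)
      moreover have "s \<otimes> (v \<oplus> x \<otimes> t [^] n) \<in> I" using i(4)[OF _ v(3)] s adjoin_superset by blast
      ultimately show "s \<otimes> x \<in> lead I n"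
        unfolding lead_def using polys_smult[OF s v(2)] c(4)[OF s v(1)] by auto
    }
    fix y assume "y \<in> lead I n"
    then obtain w where w: "y \<in> S" "w \<in> polys S t n" "w \<oplus> y \<otimes> t [^] n \<in> I" by (auto simp: lead_def)
    have "(v \<oplus> x \<otimes> t [^] n) \<oplus> (w \<oplus> y \<otimes> t [^] n) = (v \<oplus> w) \<oplus> (x \<oplus> y) \<otimes> t [^] n"
      using v w vc polys_carrier[OF w(2)] t by (simp add: c field_arith)
    moreover have "(v \<oplus> x \<otimes> t [^] n) \<oplus> (w \<oplus> y \<otimes> t [^] n) \<in> I" using i(3)[OF v(3) w(3)] .
    ultimately show "x \<oplus> y \<in> lead I n"
      unfolding lead_def using polys_add[OF v(2) w(2)] c(5)[OF v(1) w(1)] by auto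
  qed
  have lead_Suc: "lead I n \<subseteq> lead I (Suc n)" if I: "ideal_in ?T I" for I n
  proof
    fix x assume "x \<in> lead I n"
    then obtain v where v: "x \<in> S" "v \<in> polys S t n" "v \<oplus> x \<otimes> t [^] n \<in> I" by (auto simp: lead_def)
    have "t \<otimes> (v \<oplus> x \<otimes> t [^] n) = t \<otimes> v \<oplus> x \<otimes> t [^] (Suc n)"
      using v polys_carrier[OF v(2)] t by (simp add: c field_arith)
    moreover have "t \<otimes> (v \<oplus> x \<otimes> t [^] n) \<in> I" using ideal_in_simps(4)[OF T I adjoin_generator v(3)] .
    ultimately show "x \<in> lead I (Suc n)" unfolding lead_def using polys_t[OF v(2)] v(1) by auto
  qed
  fix I assume I: "ideal_in ?T I"
  note i = ideal_in_simps[OF T I]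
  obtain M where M: "\<And>n. M \<le> n \<Longrightarrow> lead I n = lead I M"
    using noetherian_chain[OF S N, of "lead I"] lead[OF I] lead_Suc[OF I] by blast
  have "\<exists>A. finite A \<and> A \<subseteq> lead I n \<and> (\<forall>J. ideal_in S J \<and> A \<subseteq> J \<longrightarrow> lead I n \<subseteq> J)" for n
    using N lead[OF I] unfolding noetherian_in_def by blast
  then obtain A where A: "\<And>n. finite (A n)" "\<And>n. A n \<subseteq> lead I n"
    "\<And>n J. ideal_in S J \<Longrightarrow> A n \<subseteq> J \<Longrightarrow> lead I n \<subseteq> J" by metis
  have "\<exists>w. s \<in> A n \<longrightarrow> w \<in> polys S t n \<and> w \<oplus> s \<otimes> t [^] n \<in> I" for s n
    using A(2)[of n] by (auto simp: lead_def)
  then obtain f where f: "\<And>s n. s \<in> A n \<Longrightarrow> f s n \<in> polys S t n \<and> f s n \<oplus> s \<otimes> t [^] n \<in> I" by metis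
  define B where "B = (\<Union>n\<in>{..M}. (\<lambda>s. f s n \<oplus> s \<otimes> t [^] n) ` A n)"
  show "\<exists>A. finite A \<and> A \<subseteq> I \<and> (\<forall>J. ideal_in ?T J \<and> A \<subseteq> J \<longrightarrow> I \<subseteq> J)"
  proof (intro exI[of _ B] conjI allI impI)
    show "finite B" using A(1) by (auto simp: B_def)
    show BI: "B \<subseteq> I" using f by (auto simp: B_def)
    fix J assume "ideal_in ?T J \<and> B \<subseteq> J"
    \<comment> \<open>Passing to the intersection keeps the differences formed in the degree
      induction below inside \<open>I\<close>.\<close>
    hence J: "ideal_in ?T (J \<inter> I)" "B \<subseteq> J \<inter> I" using ideal_in_Int I BI by auto
    have le: "lead I n \<subseteq> lead (J \<inter> I) n" if "n \<le> M" for n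
    proof (rule A(3)[OF lead[OF J(1)]])
      show "A n \<subseteq> lead (J \<inter> I) n"
      proof
        fix s assume s: "s \<in> A n"
        hence "f s n \<oplus> s \<otimes> t [^] n \<in> B" using that by (auto simp: B_def)
        moreover have "s \<in> S" using s A(2) by (auto simp: lead_def)
        ultimately show "s \<in> lead (J \<inter> I) n" unfolding lead_def using J(2) f[OF s] by auto
      qed
    qed
    have le': "lead I n \<subseteq> lead (J \<inter> I) n" for n
    proof (cases "n \<le> M")
      case False
      hence "lead I n \<subseteq> lead (J \<inter> I) M" using M[of n] le[of M] by simp
      also have "\<dots> \<subseteq> lead (J \<inter> I) n" using lift_Suc_mono_le[of "lead (J \<inter> I)" M n] lead_Suc[OF J(1)] False by simp
      finally show ?thesis .
    qed (rule le)
    have "g \<in> I \<Longrightarrow> g \<in> polys S t n \<Longrightarrow> g \<in> J \<inter> I" for g n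
    proof (induction n arbitrary: g)
      case 0
      thus ?case using ideal_in_D(3)[OF J(1)] by simp
    next
      case (Suc n)
      obtain w s where g: "w \<in> polys S t n" "s \<in> S" "g = w \<oplus> s \<otimes> t [^] n" using Suc(3) by (rule polys_SucE)
      have "s \<in> lead I n" unfolding lead_def using g Suc(2) by auto
      then obtain v where v: "v \<in> polys S t n" "v \<oplus> s \<otimes> t [^] n \<in> J \<inter> I" using le'[of n] by (auto simp: lead_def)
      have cr: "w \<in> carrier R" "v \<in> carrier R" "s \<in> carrier R" "t [^] n \<in> carrier R"
        using polys_carrier[OF g(1)] polys_carrier[OF v(1)] g(2) t by (auto simp: c)
      define h where "h = v \<oplus> s \<otimes> t [^] n"
      have hJ: "h \<in> J \<inter> I" using v by (simp add: h_def)
      have e: "g \<ominus> h = w \<oplus> \<ominus> v" unfolding g(3) h_def using cr by (simp add: field_arith)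
      have "g \<ominus> h \<in> I" using i(7)[OF Suc(2)] hJ by blast
      moreover have "g \<ominus> h \<in> polys S t n" unfolding e using polys_add[OF g(1) polys_minus[OF v(1)]] .
      ultimately have "g \<ominus> h \<in> J \<inter> I" using Suc(1) by blast
      hence "(g \<ominus> h) \<oplus> h \<in> J \<inter> I" using ideal_in_D(4)[OF J(1)] hJ by blast
      moreover have "(g \<ominus> h) \<oplus> h = g" unfolding e unfolding g(3) h_def using cr by (simp add: field_arith)
      ultimately show ?case by simp
    qed
    thus "I \<subseteq> J" using i(1) unfolding adjoin_def by blast
  qed
qed

end

subsection \<open>Local quadratic transforms\<close>

definition regular2 :: "'a set \<Rightarrow> bool" where
  "regular2 S \<longleftrightarrow> (\<exists>x y. regular_pair S x y)"

text \<open>The element a generates the extension to \<open>T\<close> of the maximal ideal of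
  \<open>S\<close>. The clause over all L says that \<open>T\<close> is generated by
  \<open>S\<close>, the quotients z/a and the inverses of its own units. This describes a
  localization of a chart without naming the chart or the prime.\<close>

definition quadratic :: "'a set \<Rightarrow> 'a set \<Rightarrow> bool" where
  "quadratic S T \<longleftrightarrow> regular2 T \<and> S \<subseteq> T \<and> nonunits S \<subseteq> nonunits T \<and> \<not> T \<subseteq> S \<and>
     (\<exists>a\<in>nonunits S. a \<noteq> \<zero> \<and> (\<forall>z\<in>nonunits S. z \<otimes> inv a \<in> T) \<and>
       (\<forall>L. subring L R \<and> S \<subseteq> L \<and> (\<forall>z\<in>nonunits S. z \<otimes> inv a \<in> L) \<and>
         (\<forall>v\<in>L. v \<in> T \<and> v \<notin> nonunits T \<longrightarrow> inv v \<in> L) \<longrightarrow> T \<subseteq> L))"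

section \<open>A chart of the blow-up and the relation a t = b\<close>

context
  fixes S a b assumes G: "regular_pair S a b"
begin

abbreviation (input) ratio :: 'a where "ratio \<equiv> b \<otimes> inv a"

lemma chart_basics:
  shows "subring S R" "a \<in> S" "b \<in> S" "a \<in> carrier R" "b \<in> carrier R" "a \<noteq> \<zero>" "ratio \<in> carrier R"
    "a \<otimes> ratio = b" "ideal_in S (multiples S a)" "a \<in> nonunits S" "b \<in> nonunits S"
proof -
  note r = regular_pair_D[OF G]
  note g = two_generated_D[OF r(1)]
  show S: "subring S R" and ab: "a \<in> S" "b \<in> S" "a \<noteq> \<zero>" "a \<in> nonunits S" "b \<in> nonunits S" using g r by auto
  show c: "a \<in> carrier R" "b \<in> carrier R" using ab subring_simps(8)[OF S] by auto
  show "ratio \<in> carrier R" "a \<otimes> ratio = b" using c ab by (simp_all add: mult_inv_cancel)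
  show "ideal_in S (multiples S a)" using multiples_ideal[OF S ab(1)] .
qed

lemma a_ratio_pow: "a [^] k \<otimes> ratio [^] k = b [^] (k::nat)"
proof -
  have "a [^] k \<otimes> ratio [^] k = (a \<otimes> ratio) [^] k" using chart_basics(4,7) by (simp only: nat_pow_distrib)
  thus ?thesis using chart_basics(8) by (simp only:)
qed

text \<open>Since the degree is less than \<open>k\<close>, clearing denominators leaves at least
  one factor \<open>a\<close> over.\<close>

lemma a_pow_polys: "w \<in> polys S ratio k \<Longrightarrow> a [^] k \<otimes> w \<in> multiples S a"
proof (induction k arbitrary: w)
  case 0
  thus ?case using ideal_in_D(3)[OF chart_basics(9)] by simp
next
  case (Suc k)
  note cb = chart_basics
  note c = subring_simps[OF cb(1)]
  obtain w' s where w: "w' \<in> polys S ratio k" "s \<in> S" "w = w' \<oplus> s \<otimes> ratio [^] k"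
    using Suc(2) by (rule polys_SucE[OF cb(1,7)])
  define T where "T = ratio [^] k" define A where "A = a [^] k"
  have car: "w' \<in> carrier R" "s \<in> carrier R" "T \<in> carrier R" "A \<in> carrier R"
    using polys_carrier[OF cb(1,7) w(1)] w(2) cb by (simp_all add: c T_def A_def)
  have "a [^] Suc k \<otimes> w = a \<otimes> (A \<otimes> w' \<oplus> s \<otimes> (A \<otimes> T))"
    unfolding w(3) T_def[symmetric] using car cb(4) by (simp add: A_def[symmetric] field_arith)
  also have "A \<otimes> T = b [^] k" unfolding A_def T_def by (rule a_ratio_pow)
  finally have e: "a [^] Suc k \<otimes> w = a \<otimes> (A \<otimes> w' \<oplus> s \<otimes> b [^] k)" .
  have "A \<otimes> w' \<in> S" using Suc(1)[OF w(1)] ideal_in_D(2)[OF cb(9)] by (simp add: A_def)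
  hence "A \<otimes> w' \<oplus> s \<otimes> b [^] k \<in> S" using w(2) cb(3) by (simp add: c)
  thus ?case unfolding e by (rule multiplesI)
qed

text \<open>Clearing denominators turns the hypothesis into r b^k \<in> aS, where aS is prime and
  does not contain \<open>b\<close>. This limits how far the representation of an element by
  polynomials in b/a can be ambiguous.\<close>

lemma leading_coeff_multiple:
  assumes r: "r \<in> S" "r \<otimes> ratio [^] k \<in> polys S ratio k"
  shows "r \<in> multiples S a"
proof -
  note cb = chart_basics
  note c = subring_simps[OF cb(1)]
  note pr = regular_pair_D(4)[OF G]
  have "a [^] k \<otimes> (r \<otimes> ratio [^] k) \<in> multiples S a" by (rule a_pow_polys[OF r(2)])
  moreover have "a [^] k \<otimes> (r \<otimes> ratio [^] k) = r \<otimes> (a [^] k \<otimes> ratio [^] k)"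
    using c(8)[OF r(1)] cb(4,7) by (simp only: m_lcomm nat_pow_closed)
  ultimately have "r \<otimes> b [^] k \<in> multiples S a" by (simp only: a_ratio_pow)
  hence "r \<in> multiples S a \<or> b [^] k \<in> multiples S a" using prime_in_D(3)[OF pr r(1)] c(7)[OF cb(3)] by blast
  thus ?thesis using prime_in_pow[OF cb(1) pr cb(3)] regular_pair_D(3)[OF G] by blast
qed

lemma ratio_pow_Suc:
  assumes "s \<in> carrier R"
  shows "a \<otimes> (s \<otimes> ratio [^] Suc n) = (s \<otimes> b) \<otimes> ratio [^] n"
proof -
  note cb = chart_basics
  define t where "t = ratio"
  have t: "t \<in> carrier R" "a \<otimes> t = b" using cb by (simp_all only: t_def)
  have "a \<otimes> (s \<otimes> t [^] Suc n) = (s \<otimes> (a \<otimes> t)) \<otimes> t [^] n" using t(1) assms cb(4) by (simp add: m_ac)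
  thus ?thesis unfolding t(2) unfolding t_def .
qed

text \<open>Through a t = b, multiplication by \<open>a\<close> lowers the degree of the top term by
  one. Both bounds are positive because a constant term keeps degree zero.\<close>

lemma a_polys:
  assumes v: "v \<in> polys S ratio (Suc (Suc n))"
  shows "a \<otimes> v \<in> polys S ratio (Suc n)"
proof -
  note cb = chart_basics
  note c = subring_simps[OF cb(1)] and St = cb(1,7)
  obtain w s where w: "w \<in> polys S ratio (Suc n)" "s \<in> S" "v = w \<oplus> s \<otimes> ratio [^] Suc n"
    using v by (rule polys_SucE[OF St])
  have "a \<otimes> v = a \<otimes> w \<oplus> a \<otimes> (s \<otimes> ratio [^] Suc n)"
    unfolding w(3) using c(8)[OF w(2)] polys_carrier[OF St w(1)] cb(4,7) by (simp only: r_distr nat_pow_closed m_closed)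
  also have "\<dots> = a \<otimes> w \<oplus> (\<zero> \<oplus> (s \<otimes> b) \<otimes> ratio [^] n)"
    using ratio_pow_Suc[of s n] c(8)[OF w(2)] cb(5,7) by (simp only: l_zero nat_pow_closed m_closed)
  also have "\<dots> \<in> polys S ratio (Suc n)"
    using polys_add[OF St polys_smult[OF St cb(2) w(1)] polys_SucI[OF St polys_zero[OF St] c(4)[OF w(2) cb(3)]]] .
  finally show ?thesis .
qed

text \<open>Suppose the top term r t^(m+1) of v has too large a degree. Both a v and a times the
  rest of v have smaller degree, so r b t^m equals a polynomial of lower degree and r = a e. Then r
  t^(m+1) = e b t^m, and v has a representation of smaller degree.\<close>

lemma polys_degree_of_a_mult:
  assumes "v \<in> polys S ratio N" "a \<otimes> v \<in> polys S ratio (Suc n)"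
  shows "v \<in> polys S ratio (Suc (Suc n))"
  using assms
proof (induction N arbitrary: v)
  case 0
  thus ?case using polys_zero[OF chart_basics(1,7), of "Suc (Suc n)"] by (simp del: polys.simps(2))
next
  case (Suc k)
  note cb = chart_basics
  note c = subring_simps[OF cb(1)] and St = cb(1,7)
  show ?case
  proof (cases "Suc k \<le> Suc (Suc n)")
    case True
    thus ?thesis using polys_mono[OF St True Suc(2)] by blast
  next
    case False
    then obtain m where m: "k = Suc m" "Suc n \<le> m" by (cases k) auto
    then obtain m' where m': "m = Suc m'" by (cases m) auto
    obtain w r where w: "w \<in> polys S ratio k" "r \<in> S" "v = w \<oplus> r \<otimes> ratio [^] k"
      using Suc(2) by (rule polys_SucE[OF St])
    have car: "w \<in> carrier R" "r \<in> carrier R" "ratio [^] k \<in> carrier R" "ratio [^] m \<in> carrier R"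
      using polys_carrier[OF St w(1)] c(8)[OF w(2)] cb(7) by (simp_all only: nat_pow_closed)
    have av: "a \<otimes> v = a \<otimes> w \<oplus> a \<otimes> (r \<otimes> ratio [^] k)"
      unfolding w(3) using car cb(4) by (simp only: r_distr m_closed)
    have aw: "a \<otimes> w \<in> polys S ratio m" using a_polys[of w m'] w(1) by (simp only: m m')
    have avm: "a \<otimes> v \<in> polys S ratio m" using polys_mono[OF St m(2) Suc(3)] .
    have "a \<otimes> (r \<otimes> ratio [^] k) = \<ominus> (a \<otimes> w) \<oplus> a \<otimes> v"
      unfolding av using car cb(4) by (simp only: r_neg1 m_closed)
    also have "\<dots> \<in> polys S ratio m" using polys_add[OF St polys_minus[OF St aw] avm] .
    finally have "(r \<otimes> b) \<otimes> ratio [^] m \<in> polys S ratio m" unfolding m(1) ratio_pow_Suc[OF car(2)] .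
    hence "r \<otimes> b \<in> multiples S a" using leading_coeff_multiple c(4)[OF w(2) cb(3)] by blast
    hence "r \<in> multiples S a"
      using prime_in_D(3)[OF regular_pair_D(4)[OF G] w(2) cb(3)] regular_pair_D(3)[OF G] by blast
    then obtain e where e: "e \<in> S" "r = a \<otimes> e" by (rule multiplesE)
    have "r \<otimes> ratio [^] k = a \<otimes> (e \<otimes> ratio [^] Suc m)"
      unfolding e(2) m(1) using c(8)[OF e(1)] cb(4,7) by (simp only: m_assoc nat_pow_closed)
    also have "\<dots> = (e \<otimes> b) \<otimes> ratio [^] m" using ratio_pow_Suc c(8)[OF e(1)] by blast
    finally have "v = w \<oplus> (\<zero> \<oplus> (e \<otimes> b) \<otimes> ratio [^] m)"
      unfolding w(3) using c(8)[OF e(1)] car cb(5) by (simp only: l_zero m_closed)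
    also have "\<dots> \<in> polys S ratio k"
      unfolding m(1) using polys_add[OF St w(1)[unfolded m(1)] polys_SucI[OF St polys_zero[OF St] c(4)[OF e(1) cb(3)]]] .
    finally show ?thesis using Suc(1) Suc(3) by blast
  qed
qed

section \<open>The exceptional divisor and ideals containing it\<close>

lemma chart_subring: "subring (adjoin S ratio) R" and chart_superset: "S \<subseteq> adjoin S ratio"
  and chart_ratio: "ratio \<in> adjoin S ratio"
  using adjoin_subring adjoin_superset adjoin_generator chart_basics(1,7) by auto

lemma chart_multiples_ideal: "ideal_in (adjoin S ratio) (multiples (adjoin S ratio) a)"
  using multiples_ideal chart_subring chart_superset chart_basics(2) by blast

text \<open>The special fibre \<open>T / aT\<close> of the chart \<open>T = S[b/a]\<close> is a polynomial ring over the residue field.\<close>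

lemma special_fibre_leading_coeff:
  assumes w: "w \<in> polys S ratio n" and s: "s \<in> S" and z: "w \<oplus> s \<otimes> ratio [^] n \<in> multiples (adjoin S ratio) a"
  shows "s \<in> nonunits S"
proof -
  note cb = chart_basics
  note c = subring_simps[OF cb(1)] and St = cb(1,7)
  obtain v where v: "v \<in> adjoin S ratio" "w \<oplus> s \<otimes> ratio [^] n = a \<otimes> v" using z by (rule multiplesE)
  then obtain N where "v \<in> polys S ratio N" by (auto simp: adjoin_def)
  moreover have "a \<otimes> v \<in> polys S ratio (Suc n)" using v(2) polys_SucI[OF St w s] by simp
  ultimately have "v \<in> polys S ratio (Suc (Suc n))" using polys_degree_of_a_mult by blast
  then obtain v' r where v': "v' \<in> polys S ratio (Suc n)" "r \<in> S" "v = v' \<oplus> r \<otimes> ratio [^] Suc n"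
    by (rule polys_SucE[OF St])
  then obtain v'' q where v'': "v'' \<in> polys S ratio n" "q \<in> S" "v' = v'' \<oplus> q \<otimes> ratio [^] n"
    using polys_SucE[OF St] by metis
  define t where "t = ratio [^] n"
  have car: "w \<in> carrier R" "s \<in> carrier R" "t \<in> carrier R" "v'' \<in> carrier R" "q \<in> carrier R" "r \<in> carrier R"
    using polys_carrier[OF St w] c(8) s polys_carrier[OF St v''(1)] v''(2) v'(2) cb(7) by (simp_all add: t_def)
  have "w \<oplus> s \<otimes> t = a \<otimes> (v'' \<oplus> q \<otimes> t) \<oplus> a \<otimes> (r \<otimes> ratio [^] Suc n)"
    unfolding t_def v(2) v'(3) v''(3) using car cb(4,7) by (simp only: r_distr m_closed nat_pow_closed a_closed)
  also have "\<dots> = a \<otimes> (v'' \<oplus> q \<otimes> t) \<oplus> (r \<otimes> b) \<otimes> t" unfolding ratio_pow_Suc[OF car(6)] t_def ..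
  finally have "w \<oplus> s \<otimes> t = a \<otimes> (v'' \<oplus> q \<otimes> t) \<oplus> (r \<otimes> b) \<otimes> t" .
  hence "s \<otimes> t = \<ominus> w \<oplus> (a \<otimes> (v'' \<oplus> q \<otimes> t) \<oplus> (r \<otimes> b) \<otimes> t)"
    using car by (metis m_closed r_neg1)
  \<comment> \<open>Comparison of the coefficients of the n-th power: on the side of a v, this
    coefficient receives a q from degree n and r b from degree n + 1, and both lie in the maximal
    ideal.\<close>
  hence eq: "(s \<ominus> (a \<otimes> q \<oplus> r \<otimes> b)) \<otimes> t = a \<otimes> v'' \<oplus> \<ominus> w"
    using car cb(4,5) by (simp add: field_arith)
  have "(s \<ominus> (a \<otimes> q \<oplus> r \<otimes> b)) \<otimes> ratio [^] n \<in> polys S ratio n"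
    unfolding eq[unfolded t_def] using polys_add[OF St polys_smult[OF St cb(2) v''(1)] polys_minus[OF St w]] .
  moreover have aqrb: "a \<otimes> q \<oplus> r \<otimes> b \<in> nonunits S"
    using ideal_in_simps[OF cb(1) two_generated_D(6)[OF regular_pair_D(1)[OF G]]] cb(10,11) v''(2) v'(2) by simp
  moreover from this have sS: "s \<ominus> (a \<otimes> q \<oplus> r \<otimes> b) \<in> S" using s by (simp add: c nonunits_def)
  ultimately have "s \<ominus> (a \<otimes> q \<oplus> r \<otimes> b) \<in> multiples S a" using leading_coeff_multiple by blast
  hence "s \<ominus> (a \<otimes> q \<oplus> r \<otimes> b) \<in> nonunits S"
    using multiples_subset[OF cb(1) two_generated_D(6)[OF regular_pair_D(1)[OF G]] cb(10)] by blast
  hence "(s \<ominus> (a \<otimes> q \<oplus> r \<otimes> b)) \<oplus> (a \<otimes> q \<oplus> r \<otimes> b) \<in> nonunits S"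
    using ideal_in_D(4)[OF two_generated_D(6)[OF regular_pair_D(1)[OF G]]] aqrb by blast
  moreover have "(s \<ominus> (a \<otimes> q \<oplus> r \<otimes> b)) \<oplus> (a \<otimes> q \<oplus> r \<otimes> b) = s" using car cb(4,5) by (simp add: field_arith)
  ultimately show ?thesis by simp
qed

lemma chart_one: "\<one> \<notin> multiples (adjoin S ratio) a"
  using special_fibre_leading_coeff[of \<zero> 0 \<one>] one_notin_nonunits[OF chart_basics(1)]
    subring_simps(2)[OF chart_basics(1)] by auto

lemma nonunits_chart:
  assumes "x \<in> nonunits S"
  shows "\<exists>e\<in>adjoin S ratio. x = a \<otimes> e"
proof -
  note cb = chart_basics
  note c = subring_simps[OF cb(1)] and cT = subring_simps[OF chart_subring]
  obtain p q where pq: "p \<in> S" "q \<in> S" "x = p \<otimes> a \<oplus> q \<otimes> b"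
    using assms two_generated_D(9)[OF regular_pair_D(1)[OF G]] by blast
  define t where "t = ratio"
  have t: "t \<in> carrier R" "b = a \<otimes> t" using cb(7,8) by (simp_all add: t_def)
  have tT: "t \<in> adjoin S ratio" unfolding t_def by (rule chart_ratio)
  have "x = a \<otimes> (p \<oplus> q \<otimes> t)"
    unfolding pq(3) t(2) using t(1) c(8)[OF pq(1)] c(8)[OF pq(2)] cb(4) by (simp add: field_arith)
  moreover have "p \<oplus> q \<otimes> t \<in> adjoin S ratio"
    using subsetD[OF chart_superset pq(1)] subsetD[OF chart_superset pq(2)] tT by (simp add: cT)
  ultimately show ?thesis by blast
qed

text \<open>A top coefficient in the maximal ideal is divisible by \<open>a\<close> in the chart and
  moves into the remainder. This is repeated until the top coefficient is a unit.\<close>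

lemma special_fibre_poly:
  assumes "z \<in> polys S ratio n" "z \<notin> multiples (adjoin S ratio) a"
  shows "\<exists>k w u e. k < n \<and> w \<in> polys S ratio k \<and> u \<in> S \<and> u \<notin> nonunits S \<and> e \<in> adjoin S ratio \<and>
    z = (w \<oplus> u \<otimes> ratio [^] k) \<oplus> a \<otimes> e"
  using assms
proof (induction n arbitrary: z)
  case 0
  thus ?case using ideal_in_D(3)[OF chart_multiples_ideal] by simp
next
  case (Suc n)
  note cb = chart_basics
  note c = subring_simps[OF cb(1)] and St = cb(1,7) and cT = subring_simps[OF chart_subring]
  obtain w s where w: "w \<in> polys S ratio n" "s \<in> S" "z = w \<oplus> s \<otimes> ratio [^] n"
    using Suc(2) by (rule polys_SucE[OF St])
  define t where "t = ratio [^] n"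
  have car: "w \<in> carrier R" "s \<in> carrier R" "t \<in> carrier R"
    using polys_carrier[OF St w(1)] c(8)[OF w(2)] cb(7) by (simp_all add: t_def)
  show ?case
  proof (cases "s \<in> nonunits S")
    case False
    have "z = (w \<oplus> s \<otimes> ratio [^] n) \<oplus> a \<otimes> \<zero>"
      unfolding w(3) t_def[symmetric] using car cb(4) by simp
    thus ?thesis using w False cT(1) by blast
  next
    case True
    then obtain d where d: "d \<in> adjoin S ratio" "s = a \<otimes> d" using nonunits_chart by blast
    have dc: "d \<in> carrier R" using cT(8)[OF d(1)] .
    have dt: "d \<otimes> t \<in> adjoin S ratio" using d(1) cT(7)[OF chart_ratio] cT(4) by (simp add: t_def)
    have z: "z = w \<oplus> a \<otimes> (d \<otimes> t)" unfolding w(3) d(2) t_def[symmetric] using car dc cb(4) by (simp add: m_assoc)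
    have "w \<notin> multiples (adjoin S ratio) a"
      using Suc(3) ideal_in_D(4)[OF chart_multiples_ideal] multiplesI[OF dt] z by blast
    then obtain k w' u e where k: "k < n" "w' \<in> polys S ratio k" "u \<in> S" "u \<notin> nonunits S" "e \<in> adjoin S ratio"
      "w = (w' \<oplus> u \<otimes> ratio [^] k) \<oplus> a \<otimes> e" using Suc(1)[OF w(1)] by blast
    have "w' \<oplus> u \<otimes> ratio [^] k \<in> carrier R" using polys_carrier[OF St polys_SucI[OF St k(2,3)]] .
    hence "z = (w' \<oplus> u \<otimes> ratio [^] k) \<oplus> a \<otimes> (e \<oplus> d \<otimes> t)"
      unfolding z k(6) using cT(8)[OF k(5)] cT(8)[OF dt] cb(4) by (simp only: r_distr a_assoc m_closed)
    thus ?thesis using k(1-4) cT(5)[OF k(5) dt] less_SucI by blast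
  qed
qed

lemma special_fibre_poly_adjoin:
  assumes "z \<in> adjoin S ratio" "z \<notin> multiples (adjoin S ratio) a"
  shows "\<exists>k w u e. w \<in> polys S ratio k \<and> u \<in> S \<and> u \<notin> nonunits S \<and> e \<in> adjoin S ratio \<and>
    z = (w \<oplus> u \<otimes> ratio [^] k) \<oplus> a \<otimes> e"
  using special_fibre_poly assms unfolding adjoin_def by blast

lemma polys_subset_adjoin: "w \<in> polys S ratio k \<Longrightarrow> w \<in> adjoin S ratio"
  by (auto simp: adjoin_def)

lemma poly_product:
  assumes w: "w \<in> polys S ratio m" "u \<in> S" and v: "v \<in> polys S ratio n" "q \<in> S"
  shows "\<exists>h\<in>polys S ratio (m + n). (w \<oplus> u \<otimes> ratio [^] m) \<otimes> (v \<oplus> q \<otimes> ratio [^] n) = h \<oplus> (u \<otimes> q) \<otimes> ratio [^] (m + n)"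
proof -
  note cb = chart_basics
  note c = subring_simps[OF cb(1)] and St = cb(1,7)
  define A where "A = ratio [^] m" define B where "B = ratio [^] n"
  define h where "h = w \<otimes> v \<oplus> (u \<otimes> (A \<otimes> v) \<oplus> q \<otimes> (B \<otimes> w))"
  have car: "w \<in> carrier R" "v \<in> carrier R" "u \<in> carrier R" "q \<in> carrier R" "A \<in> carrier R" "B \<in> carrier R"
    using polys_carrier[OF St w(1)] polys_carrier[OF St v(1)] c(8) w(2) v(2) cb(7) by (simp_all add: A_def B_def)
  have "h \<in> polys S ratio (m + n)"
    unfolding h_def A_def B_def
    using polys_add[OF St polys_mult[OF St w(1) v(1)] polys_add[OF St polys_smult[OF St w(2) polys_tpow[OF St v(1), of m]]]]
      polys_smult[OF St v(2) polys_tpow[OF St w(1), of n]] by (simp only: add.commute)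
  moreover have "(w \<oplus> u \<otimes> A) \<otimes> (v \<oplus> q \<otimes> B) = h \<oplus> (u \<otimes> q) \<otimes> (A \<otimes> B)"
    using car by (simp add: h_def field_arith)
  moreover have "A \<otimes> B = ratio [^] (m + n)" using cb(7) by (simp only: A_def B_def nat_pow_mult)
  ultimately show ?thesis unfolding A_def B_def by metis
qed

text \<open>Representatives with unit leading coefficients multiply to one with a unit leading
  coefficient, which cannot vanish in the special fibre.\<close>

lemma exceptional_prime: "prime_in (adjoin S ratio) (multiples (adjoin S ratio) a)"
  unfolding prime_in_def
proof (intro conjI ballI impI chart_multiples_ideal chart_one)
  let ?T = "adjoin S ratio"
  note cb = chart_basics
  note c = subring_simps[OF cb(1)] and St = cb(1,7) and cT = subring_simps[OF chart_subring]
  note j = ideal_in_simps[OF chart_subring chart_multiples_ideal]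
  fix x y assume x: "x \<in> ?T" and y: "y \<in> ?T" and xy: "x \<otimes> y \<in> multiples ?T a"
  show "x \<in> multiples ?T a \<or> y \<in> multiples ?T a"
  proof (rule ccontr)
    assume n: "\<not> (x \<in> multiples ?T a \<or> y \<in> multiples ?T a)"
    obtain k w u e where w: "w \<in> polys S ratio k" "u \<in> S" "u \<notin> nonunits S" "e \<in> ?T" "x = (w \<oplus> u \<otimes> ratio [^] k) \<oplus> a \<otimes> e"
      using special_fibre_poly_adjoin[OF x] n by blast
    obtain l v q d where v: "v \<in> polys S ratio l" "q \<in> S" "q \<notin> nonunits S" "d \<in> ?T" "y = (v \<oplus> q \<otimes> ratio [^] l) \<oplus> a \<otimes> d"
      using special_fibre_poly_adjoin[OF y] n by blast
    define W where "W = w \<oplus> u \<otimes> ratio [^] k" define V where "V = v \<oplus> q \<otimes> ratio [^] l"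
    have WV: "W \<in> ?T" "V \<in> ?T"
      unfolding W_def V_def using polys_subset_adjoin polys_SucI[OF St w(1,2)] polys_SucI[OF St v(1,2)] by blast+
    have car: "W \<in> carrier R" "V \<in> carrier R" "e \<in> carrier R" "d \<in> carrier R" "y \<in> carrier R"
      using WV w(4) v(4) y by (simp_all add: cT)
    have "x \<otimes> y = W \<otimes> y \<oplus> a \<otimes> (e \<otimes> y)" unfolding w(5) W_def[symmetric] using car cb(4) by (simp add: field_arith)
    also have "W \<otimes> y = W \<otimes> V \<oplus> a \<otimes> (W \<otimes> d)" unfolding v(5) V_def[symmetric] using car cb(4) by (simp add: field_arith)
    finally have "W \<otimes> V \<oplus> a \<otimes> (W \<otimes> d \<oplus> e \<otimes> y) = x \<otimes> y" using car cb(4) by (simp add: field_arith)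
    moreover have "W \<otimes> d \<oplus> e \<otimes> y \<in> ?T" using WV w(4) v(4) y by (simp add: cT)
    ultimately have WVm: "W \<otimes> V \<in> multiples ?T a"
      using ideal_in_add_cancel[OF chart_subring chart_multiples_ideal, of "W \<otimes> V"] xy multiplesI cT(4)[OF WV] by metis
    obtain h where h: "h \<in> polys S ratio (k + l)" "W \<otimes> V = h \<oplus> (u \<otimes> q) \<otimes> ratio [^] (k + l)"
      using poly_product[OF w(1,2) v(1,2)] unfolding W_def V_def by blast
    have "u \<otimes> q \<in> nonunits S"
      using special_fibre_leading_coeff[OF h(1) c(4)[OF w(2) v(2)]] WVm h(2) by simp
    thus False using unit_mult[OF cb(1) w(2) v(2) w(3) v(3)] by blast
  qed
qed

text \<open>In the polynomial ring of the special fibre the variable is not invertible: an inverse s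
  would make s t - 1 a vanishing polynomial with a unit leading coefficient.\<close>

lemma exceptional_not_maximal: "\<not> maximal_in (adjoin S ratio) (multiples (adjoin S ratio) a)"
proof
  let ?T = "adjoin S ratio"
  assume m: "maximal_in ?T (multiples ?T a)"
  note cb = chart_basics
  note c = subring_simps[OF cb(1)] and St = cb(1,7) and cT = subring_simps[OF chart_subring]
  let ?J = "{j \<oplus> s \<otimes> ratio | j s. j \<in> multiples ?T a \<and> s \<in> ?T}"
  have J: "ideal_in ?T ?J" by (rule ideal_add_multiples[OF chart_subring chart_multiples_ideal chart_ratio])
  have rJ: "ratio \<in> ?J"
  proof -
    have "ratio = \<zero> \<oplus> \<one> \<otimes> ratio" using cb(7) by (simp only: l_one l_zero)
    thus ?thesis using ideal_in_D(3)[OF chart_multiples_ideal] cT(2) by blast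
  qed
  have sub: "multiples ?T a \<subseteq> ?J"
  proof
    fix j assume j: "j \<in> multiples ?T a"
    hence "j = j \<oplus> \<zero> \<otimes> ratio" using ideal_in_simps(8)[OF chart_subring chart_multiples_ideal] cb(7) by simp
    thus "j \<in> ?J" using j cT(1) by blast
  qed
  have rn: "ratio \<notin> multiples ?T a"
  proof
    assume "ratio \<in> multiples ?T a"
    hence "\<zero> \<oplus> \<one> \<otimes> ratio [^] (1::nat) \<in> multiples ?T a" using cb(7) by simp
    thus False using special_fibre_leading_coeff[OF polys_zero[OF St] c(2)] one_notin_nonunits[OF cb(1)] by blast
  qed
  have "\<one> \<in> ?J" using m J sub rJ rn unfolding maximal_in_def by blast
  then obtain j s where js: "j \<in> multiples ?T a" "s \<in> ?T" "\<one> = j \<oplus> s \<otimes> ratio" by blast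
  have jc: "j \<in> carrier R" using ideal_in_simps(8)[OF chart_subring chart_multiples_ideal js(1)] .
  show False
  proof (cases "s \<in> multiples ?T a")
    case True
    hence "\<one> \<in> multiples ?T a"
      using js ideal_in_simps(3,5)[OF chart_subring chart_multiples_ideal] chart_ratio by metis
    thus False using chart_one by blast
  next
    case False
    then obtain k w u e where w: "w \<in> polys S ratio k" "u \<in> S" "u \<notin> nonunits S" "e \<in> ?T" "s = (w \<oplus> u \<otimes> ratio [^] k) \<oplus> a \<otimes> e"
      using special_fibre_poly_adjoin[OF js(2)] by blast
    define t where "t = ratio"
    have car: "w \<in> carrier R" "u \<in> carrier R" "e \<in> carrier R" "t \<in> carrier R" "t [^] k \<in> carrier R"
      using polys_carrier[OF St w(1)] c(8)[OF w(2)] cT(8)[OF w(4)] cb(7) by (simp_all add: t_def)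
    have "(\<ominus> \<one> \<oplus> t \<otimes> w) \<oplus> u \<otimes> t [^] Suc k = \<ominus> (j \<oplus> s \<otimes> t) \<oplus> (t \<otimes> w \<oplus> u \<otimes> t [^] Suc k)"
      using js(3) car jc cT(8)[OF js(2)] by (simp add: t_def a_assoc)
    also have "\<dots> = \<ominus> j \<oplus> a \<otimes> (\<ominus> (e \<otimes> t))"
      unfolding w(5) t_def[symmetric] using car jc cb(4) by (simp add: field_arith)
    also have "\<dots> \<in> multiples ?T a"
      using ideal_in_simps[OF chart_subring chart_multiples_ideal] js(1)
        multiplesI[OF cT(3)[OF cT(4)[OF w(4) chart_ratio]], of a] by (simp add: t_def)
    finally have *: "(\<ominus> \<one> \<oplus> t \<otimes> w) \<oplus> u \<otimes> t [^] Suc k \<in> multiples ?T a" .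
    have "\<ominus> \<one> \<in> polys S ratio (Suc k)" using polys_const[OF St c(3)[OF c(2)]] polys_mono[OF St, of 1 "Suc k"] by simp
    hence "\<ominus> \<one> \<oplus> t \<otimes> w \<in> polys S ratio (Suc k)" using polys_add[OF St _ polys_t[OF St w(1)]] by (simp add: t_def)
    hence "u \<in> nonunits S" using special_fibre_leading_coeff[OF _ w(2)] * unfolding t_def by blast
    thus False using w(3) by blast
  qed
qed

text \<open>Division with remainder in the special fibre: f is a monic polynomial of least degree in
  \<open>P\<close>, so every element of \<open>P\<close> reduces to zero modulo f and
  \<open>a\<close>.\<close>

lemma chart_ideal_generators:
  assumes P: "ideal_in (adjoin S ratio) P" and aP: "a \<in> P" and ne: "P \<noteq> multiples (adjoin S ratio) a"
  shows "\<exists>f\<in>P. f \<notin> multiples (adjoin S ratio) a \<and> (\<forall>z\<in>P. \<exists>s\<in>adjoin S ratio. \<exists>e\<in>adjoin S ratio. z = s \<otimes> a \<oplus> e \<otimes> f)"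
proof -
  let ?T = "adjoin S ratio"
  note cb = chart_basics
  note c = subring_simps[OF cb(1)] and St = cb(1,7) and cT = subring_simps[OF chart_subring]
  note p = ideal_in_simps[OF chart_subring P]
  define E where "E n \<longleftrightarrow> (\<exists>w\<in>polys S ratio n. w \<oplus> \<one> \<otimes> ratio [^] n \<in> P)" for n
  have monic: "E k" if w: "w \<in> polys S ratio k" "u \<in> S" "u \<notin> nonunits S" "w \<oplus> u \<otimes> ratio [^] k \<in> P" for k w u
  proof -
    have u: "inv u \<in> S" "u \<noteq> \<zero>" using unit_D[OF cb(1) w(2,3)] by auto
    have car: "w \<in> carrier R" "u \<in> carrier R" "ratio [^] k \<in> carrier R"
      using polys_carrier[OF St w(1)] c(8)[OF w(2)] cb(7) by (simp_all only: nat_pow_closed)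
    have "inv u \<otimes> (w \<oplus> u \<otimes> ratio [^] k) = inv u \<otimes> w \<oplus> (inv u \<otimes> u) \<otimes> ratio [^] k"
      using car u(2) by (simp only: r_distr m_closed m_assoc inv_carrier not_False_eq_True)
    also have "\<dots> = inv u \<otimes> w \<oplus> \<one> \<otimes> ratio [^] k" using car u(2) by simp
    finally have "inv u \<otimes> w \<oplus> \<one> \<otimes> ratio [^] k \<in> P" using p(4)[OF _ w(4), of "inv u"] u(1) chart_superset by auto
    thus ?thesis unfolding E_def using polys_smult[OF St u(1) w(1)] by blast
  qed
  have "\<exists>z\<in>P. z \<notin> multiples ?T a" using multiples_subset[OF chart_subring P aP] ne by blast
  then obtain z where z: "z \<in> P" "z \<notin> multiples ?T a" by blast
  then obtain k w u e where w: "w \<in> polys S ratio k" "u \<in> S" "u \<notin> nonunits S" "e \<in> ?T" "z = (w \<oplus> u \<otimes> ratio [^] k) \<oplus> a \<otimes> e"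
    using special_fibre_poly_adjoin[OF p(1)] by blast
  have "w \<oplus> u \<otimes> ratio [^] k \<in> P"
    using ideal_in_add_cancel[OF chart_subring P] z(1) w(5) p(5)[OF w(4) aP] polys_subset_adjoin[OF polys_SucI[OF St w(1,2)]]
    by blast
  hence "\<exists>n. E n" using monic[OF w(1-3)] by blast
  define n where "n = (LEAST n. E n)"
  have "E n" unfolding n_def using \<open>\<exists>n. E n\<close> by (rule LeastI_ex)
  then obtain g where g: "g \<in> polys S ratio n" "g \<oplus> \<one> \<otimes> ratio [^] n \<in> P" by (auto simp: E_def)
  define f where "f = g \<oplus> \<one> \<otimes> ratio [^] n"
  have fP: "f \<in> P" using g by (simp add: f_def)
  have gc: "g \<in> carrier R" using polys_carrier[OF St g(1)] .
  have "f \<notin> multiples ?T a"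
    using special_fibre_leading_coeff[OF g(1) c(2)] one_notin_nonunits[OF cb(1)] unfolding f_def by blast
  moreover have gen: "\<exists>s\<in>?T. \<exists>e\<in>?T. z = s \<otimes> a \<oplus> e \<otimes> f" if "z \<in> polys S ratio N" "z \<in> P" for z N
    using that
  proof (induction N arbitrary: z)
    case 0
    hence "z = \<zero> \<otimes> a \<oplus> \<zero> \<otimes> f" using cb(4) p(8)[OF fP] by simp
    thus ?case using cT(1) by blast
  next
    case (Suc k)
    obtain w s where w: "w \<in> polys S ratio k" "s \<in> S" "z = w \<oplus> s \<otimes> ratio [^] k"
      using Suc(2) by (rule polys_SucE[OF St])
    define t where "t = ratio"
    have tT: "t [^] i \<in> ?T" for i :: nat using cT(7)[OF chart_ratio] by (simp add: t_def)
    have car: "w \<in> carrier R" "s \<in> carrier R" "t [^] k \<in> carrier R" "t \<in> carrier R" "a \<in> carrier R" "f \<in> carrier R"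
      using polys_carrier[OF St w(1)] c(8)[OF w(2)] cT(8)[OF tT] cb(4,7) p(8)[OF fP] by (simp_all add: t_def)
    have sT: "s \<in> ?T" using w(2) chart_superset by blast
    have fT: "f \<in> ?T" using fP p(1) by blast
    have aT: "a \<in> ?T" using cb(2) chart_superset by blast
    \<comment> \<open>The top term is removed by a multiple of \<open>a\<close> if its coefficient
      is a nonunit. If it is a unit, minimality gives n \<le> k and a multiple of f removes the
      term.\<close>
    obtain A B where AB: "A \<in> ?T" "B \<in> ?T" "z \<oplus> \<ominus> (A \<otimes> a \<oplus> B \<otimes> f) \<in> polys S ratio k"
    proof (cases "s \<in> nonunits S")
      case True
      then obtain d where d: "d \<in> ?T" "s = a \<otimes> d" using nonunits_chart by blast
      have dc: "d \<in> carrier R" using d(1) cT(8) by blast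
      have "z \<oplus> \<ominus> ((d \<otimes> t [^] k) \<otimes> a \<oplus> \<zero> \<otimes> f) = w"
        unfolding w(3) d(2) t_def[symmetric] using car dc by (simp add: field_arith)
      thus ?thesis using that[of "d \<otimes> t [^] k" \<zero>] d tT w(1) cT by metis
    next
      case False
      have "n \<le> k" unfolding n_def using monic[OF w(1,2) False] Suc(3) w(3) by (intro Least_le) simp
      then obtain m where m: "k = m + n" by (metis le_Suc_ex add.commute)
      have "t [^] m \<otimes> f = t [^] m \<otimes> g \<oplus> t [^] k"
        unfolding f_def m t_def[symmetric] using gc car(4) by (simp add: r_distr nat_pow_mult)
      hence "z \<oplus> \<ominus> (\<zero> \<otimes> a \<oplus> (s \<otimes> t [^] m) \<otimes> f) = w \<oplus> \<ominus> (s \<otimes> (t [^] m \<otimes> g))"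
        unfolding w(3) t_def[symmetric] using car gc by (simp add: m_assoc) (simp add: field_arith)
      moreover have "t [^] m \<otimes> g \<in> polys S ratio k" unfolding m t_def using polys_tpow[OF St g(1)] .
      ultimately have "z \<oplus> \<ominus> (\<zero> \<otimes> a \<oplus> (s \<otimes> t [^] m) \<otimes> f) \<in> polys S ratio k"
        using polys_add[OF St w(1) polys_minus[OF St polys_smult[OF St w(2)]]] by simp
      thus ?thesis using that[of \<zero> "s \<otimes> t [^] m"] cT(1) cT(4)[OF sT tT] by blast
    qed
    have "z \<oplus> \<ominus> (A \<otimes> a \<oplus> B \<otimes> f) \<in> P" using Suc(3) AB(1,2) aP fP by (simp add: p)
    then obtain x y where xy: "x \<in> ?T" "y \<in> ?T" "z \<oplus> \<ominus> (A \<otimes> a \<oplus> B \<otimes> f) = x \<otimes> a \<oplus> y \<otimes> f"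
      using Suc(1)[OF AB(3)] by blast
    have zc: "z \<in> carrier R" using p(8)[OF Suc(3)] .
    have ABc: "A \<in> carrier R" "B \<in> carrier R" "x \<in> carrier R" "y \<in> carrier R" using AB xy by (simp_all add: cT)
    have "z = (z \<oplus> \<ominus> (A \<otimes> a \<oplus> B \<otimes> f)) \<oplus> (A \<otimes> a \<oplus> B \<otimes> f)"
      using zc ABc car by (simp add: a_assoc l_neg)
    also have "\<dots> = (x \<oplus> A) \<otimes> a \<oplus> (y \<oplus> B) \<otimes> f" unfolding xy(3) using ABc car by (simp add: field_arith)
    finally show ?case using cT(5)[OF xy(1) AB(1)] cT(5)[OF xy(2) AB(2)] by blast
  qed
  moreover have "\<exists>s\<in>?T. \<exists>e\<in>?T. z = s \<otimes> a \<oplus> e \<otimes> f" if z: "z \<in> P" for z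
  proof -
    obtain N where "z \<in> polys S ratio N" using p(1)[OF z] by (auto simp: adjoin_def)
    thus ?thesis using gen z by blast
  qed
  ultimately show ?thesis using fP by blast
qed

text \<open>The maximal ideal is generated by \<open>a\<close> and \<open>b\<close>, so the single
  quotient b/a produces all the others.\<close>

lemma blowup_chart_eq: "blowup_chart R S (nonunits S) a = adjoin S ratio"
proof
  note cb = chart_basics
  note c = subring_simps[OF cb(1)] and St = cb(1,7) and cT = subring_simps[OF chart_subring]
  let ?H = "S \<union> {x \<otimes> inv a | x. x \<in> nonunits S}"
  have HT: "?H \<subseteq> adjoin S ratio"
  proof -
    have "x \<otimes> inv a \<in> adjoin S ratio" if x: "x \<in> nonunits S" for x
    proof -
      obtain e where "e \<in> adjoin S ratio" "x = a \<otimes> e" using nonunits_chart[OF x] by blast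
      thus ?thesis using cb(4,6) by (simp add: cT mult_inv_cancel)
    qed
    thus ?thesis using chart_superset by blast
  qed
  hence H: "?H \<subseteq> carrier R" using cT(8) by blast
  show "blowup_chart R S (nonunits S) a \<subseteq> adjoin S ratio"
    unfolding blowup_chart_def using generate_ring_min_subring1[OF H chart_subring HT] .
  show "adjoin S ratio \<subseteq> blowup_chart R S (nonunits S) a"
    unfolding blowup_chart_def
    using generate_ring_is_subring[OF H] cb(11) generate_ring.incl[of _ ?H R] by (intro adjoin_least[OF St]) blast+
qed

text \<open>Powers of \<open>a\<close> clear denominators, so contraction to \<open>S\<close> keeps
  inclusions strict among primes inside a \<open>P\<close> that misses \<open>a\<close>. A chain of
  length two below \<open>P\<close> would contract to one ending in a prime of \<open>S\<close> that
  misses \<open>a\<close> and hence is not maximal, which \<open>regular_pair_prime_eq\<close>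
  forbids.\<close>

lemma height_two_exceptional:
  assumes P: "prime_in (adjoin S ratio) P" and h: "height (R\<lparr>carrier := adjoin S ratio\<rparr>) P = 2"
  shows "a \<in> P"
proof (rule ccontr)
  assume aP: "a \<notin> P"
  let ?T = "adjoin S ratio"
  note cb = chart_basics
  note c = subring_simps[OF cb(1)] and St = cb(1,7) and cT = subring_simps[OF chart_subring]
  have "enat (Suc 1) \<le> height (R\<lparr>carrier := ?T\<rparr>) P" using h by (simp add: numeral_eq_enat)
  then obtain n where n: "n > 1" "\<exists>c. prime_chain (R\<lparr>carrier := ?T\<rparr>) n c \<and> c n = P"
    unfolding height_def using le_enat_SUP_imp[of 1 "\<lambda>n. \<exists>c. prime_chain (R\<lparr>carrier := ?T\<rparr>) n c \<and> c n = P"] by auto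
  then obtain C where C: "\<forall>i\<le>n. prime_in ?T (C i)" "\<forall>i<n. C i \<subset> C (Suc i)" "C n = P"
    unfolding prime_chain_iff[OF chart_subring] by blast
  define m where "m = n - 2"
  have m: "n = Suc (Suc m)" using n(1) by (simp add: m_def)
  have pr: "prime_in ?T (C m)" "prime_in ?T (C (Suc m))" and ss: "C m \<subset> C (Suc m)" "C (Suc m) \<subset> P"
    using C m by auto
  have con: "prime_in S (Q \<inter> S)" if Q: "prime_in ?T Q" for Q
  proof -
    note q = prime_in_D[OF Q]
    have "ideal_in S (Q \<inter> S)" unfolding ideal_in_def
      using ideal_in_simps[OF chart_subring q(1)] c chart_superset by auto
    thus ?thesis unfolding prime_in_def using q(2,3) chart_superset by blast
  qed
  have str: "Q \<inter> S \<subset> Q' \<inter> S" if Q: "prime_in ?T Q" "prime_in ?T Q'" "Q \<subset> Q'" "Q' \<subseteq> P" for Q Q'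
  proof -
    obtain x where x: "x \<in> Q'" "x \<notin> Q" using Q by blast
    have xT: "x \<in> ?T" using x Q(2) prime_in_D(1) ideal_in_D(2) by blast
    then obtain k where "x \<in> polys S ratio k" by (auto simp: adjoin_def)
    hence "a [^] k \<otimes> x \<in> multiples S a" by (rule a_pow_polys)
    hence kS: "a [^] k \<otimes> x \<in> S" using ideal_in_D(2)[OF cb(9)] by blast
    have aT: "a \<in> ?T" using cb(2) chart_superset by blast
    hence akT: "a [^] k \<in> ?T" using cT(7) by blast
    have "a [^] k \<otimes> x \<in> Q'" using ideal_in_D(5)[OF prime_in_D(1)[OF Q(2)] akT x(1)] .
    moreover have "a [^] k \<otimes> x \<notin> Q"
      using prime_in_D(3)[OF Q(1) akT xT] x(2) prime_in_pow[OF chart_subring Q(1) aT] aP Q(3,4) by blast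
    ultimately show ?thesis using kS Q(3) by blast
  qed
  have 1: "C m \<inter> S \<subset> C (Suc m) \<inter> S" "C (Suc m) \<inter> S \<subset> P \<inter> S"
    using str[OF pr ss(1) psubset_imp_subset[OF ss(2)]] str[OF pr(2) P ss(2) order_refl] by simp_all
  have "\<zero> \<in> C m \<inter> S" using ideal_in_D(3)[OF prime_in_D(1)[OF con[OF pr(1)]]] .
  hence "C (Suc m) \<inter> S \<noteq> {\<zero>}" using 1(1) by (intro notI) (simp add: psubset_eq subset_singleton_iff, blast)
  moreover have "P \<inter> S \<noteq> nonunits S" using cb(10) aP by blast
  ultimately show False
    using regular_pair_prime_eq[OF G con[OF pr(2)] _ con[OF P] _ psubset_imp_subset[OF 1(2)]] 1(2) by simp
qed

text \<open>\<open>P\<close> is generated by \<open>a\<close> and a further element outside the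
  exceptional prime, which gives regularity. The transform is strictly larger than \<open>S\<close>
  because b/a in \<open>S\<close> would put \<open>b\<close> into aS.\<close>

lemma localization_of_chart_quadratic:
  assumes P: "maximal_in (adjoin S ratio) P" "prime_in (adjoin S ratio) P" and aP: "a \<in> P"
  shows "quadratic S (localization_at R (adjoin S ratio) P)"
proof -
  let ?T = "adjoin S ratio" let ?L = "localization_at R (adjoin S ratio) P"
  note cb = chart_basics
  note c = subring_simps[OF cb(1)] and St = cb(1,7) and cT = subring_simps[OF chart_subring]
  note loc = localization_superset[OF chart_subring P(2)] localization_contract[OF chart_subring P(2)]
  have "P \<noteq> multiples ?T a" using P(1) exceptional_not_maximal by blast
  then obtain f where f: "f \<in> P" "f \<notin> multiples ?T a" "\<forall>z\<in>P. \<exists>s\<in>?T. \<exists>e\<in>?T. z = s \<otimes> a \<oplus> e \<otimes> f"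
    using chart_ideal_generators[OF prime_in_D(1)[OF P(2)] aP] by blast
  have 1: "regular_pair ?L a f"
    using localization_regular_pair[OF chart_subring P(2) adjoin_noetherian[OF St] aP cb(6) exceptional_prime f(1,2)] f(3)
      two_generated_D(2)[OF regular_pair_D(1)[OF G]] by blast
  have 2: "nonunits S \<subseteq> nonunits ?L"
  proof
    fix x assume x: "x \<in> nonunits S"
    then obtain e where e: "e \<in> ?T" "x = a \<otimes> e" using nonunits_chart by blast
    hence "x \<in> P" using ideal_in_simps(5)[OF chart_subring prime_in_D(1)[OF P(2)] e(1) aP] by simp
    thus "x \<in> nonunits ?L" using loc(2) ideal_in_D(2)[OF prime_in_D(1)[OF P(2)]] by blast
  qed
  have 3: "\<not> ?L \<subseteq> S"
  proof
    assume "?L \<subseteq> S"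
    hence "ratio \<in> S" using chart_ratio loc(1) by blast
    hence "b \<in> multiples S a" using multiplesI[of ratio S a] cb(8) by simp
    thus False using regular_pair_D(3)[OF G] by blast
  qed
  have 4: "z \<otimes> inv a \<in> ?L" if z: "z \<in> nonunits S" for z
  proof -
    obtain e where "e \<in> ?T" "z = a \<otimes> e" using nonunits_chart[OF z] by blast
    thus ?thesis using cb(4,6) loc(1) by (auto simp: cT mult_inv_cancel)
  qed
  have 5: "?L \<subseteq> L" if L: "subring L R" "S \<subseteq> L" "\<forall>z\<in>nonunits S. z \<otimes> inv a \<in> L" "\<forall>v\<in>L. v \<in> ?L \<and> v \<notin> nonunits ?L \<longrightarrow> inv v \<in> L" for L
  proof
    fix z assume "z \<in> ?L"
    then obtain u v where uv: "u \<in> ?T" "v \<in> ?T - P" "z = u \<otimes> inv v" unfolding localization_at_def by (rule fractionsE)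
    have TL: "?T \<subseteq> L" using adjoin_least[OF St L(1,2)] L(3) cb(11) by blast
    have "inv v \<in> L" using L(4) TL uv(2) loc by blast
    thus "z \<in> L" using uv TL subring_simps(4)[OF L(1)] by blast
  qed
  show ?thesis unfolding quadratic_def regular2_def using 1 2 3 4 5 loc(1) chart_superset cb(6,10) by blast
qed

end

text \<open>The given a need not belong to the given pair, so the pair is first exchanged for one
  starting with a. Only the chart-free relation is used afterwards.\<close>

lemma local_quadratic_transform_imp_quadratic:
  assumes G: "regular_pair S x y" and T: "local_quadratic_transform R S T"
  shows "quadratic S T"
proof -
  note g = two_generated_D[OF regular_pair_D(1)[OF G]]
  obtain M a P where *: "maximalideal M (R\<lparr>carrier := S\<rparr>)" "a \<in> M - ideal_prod (R\<lparr>carrier := S\<rparr>) M M"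
    "maximalideal P (R\<lparr>carrier := blowup_chart R S M a\<rparr>)"
    "height (R\<lparr>carrier := blowup_chart R S M a\<rparr>) P = 2" "T = localization_at R (blowup_chart R S M a) P"
    using T unfolding local_quadratic_transform_def by blast
  have M: "M = nonunits S" using *(1) maximalideal_iff[OF g(5)] local_maximal[OF g(1)] by blast
  obtain b where ab: "regular_pair S a b" using regular_pair_extend[OF G] *(2) M by blast
  note e = blowup_chart_eq[OF ab] and sr = chart_subring[OF ab]
  have Pm: "maximal_in (adjoin S (b \<otimes> inv a)) P" using *(3) maximalideal_iff[OF sr] unfolding M e by blast
  have "primeideal P (R\<lparr>carrier := adjoin S (b \<otimes> inv a)\<rparr>)"
    using cring.maximalideal_prime[OF cring_sub[OF sr]] *(3) unfolding M e by blast
  hence Pp: "prime_in (adjoin S (b \<otimes> inv a)) P" using primeideal_iff[OF sr] by blast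
  have "a \<in> P" using height_two_exceptional[OF ab Pp] *(4) unfolding M e by blast
  thus ?thesis using localization_of_chart_quadratic[OF ab Pm Pp] *(5) unfolding M e by blast
qed

subsection \<open>The tree of quadratic transforms\<close>

lemma regular2_D:
  assumes "regular2 S"
  shows "subring S R" "local_in S" "noetherian_in S" "ideal_in S (nonunits S)"
proof -
  obtain x y where "regular_pair S x y" using assms by (auto simp: regular2_def)
  from two_generated_D[OF regular_pair_D(1)[OF this]]
  show "subring S R" "local_in S" "noetherian_in S" "ideal_in S (nonunits S)" by blast+
qed

lemma nonunitsI: "x \<in> S \<Longrightarrow> x = \<zero> \<or> inv x \<notin> S \<Longrightarrow> x \<in> nonunits S"
  by (simp add: nonunits_def)

lemma quadratic_D:
  assumes "quadratic S T"
  shows "regular2 T" "S \<subseteq> T" "nonunits S \<subseteq> nonunits T" "\<not> T \<subseteq> S"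
    "\<exists>a\<in>nonunits S. a \<noteq> \<zero> \<and> (\<forall>z\<in>nonunits S. z \<otimes> inv a \<in> T) \<and>
       (\<forall>L. subring L R \<and> S \<subseteq> L \<and> (\<forall>z\<in>nonunits S. z \<otimes> inv a \<in> L) \<and>
         (\<forall>v\<in>L. v \<in> T \<and> v \<notin> nonunits T \<longrightarrow> inv v \<in> L) \<longrightarrow> T \<subseteq> L)"
  using assms unfolding quadratic_def by blast+

text \<open>An element of \<open>T'\<close> that is invertible in \<open>g\<close> is already
  invertible in \<open>T'\<close>. This applies to a/a', whose inverse lies in \<open>T\<close>;
  hence each z/a = (z/a')(a'/a) lies in \<open>T'\<close>, and the generation property of
  \<open>T\<close> does the rest.\<close>

lemma quadratic_subset_if_dominated:
  assumes S: "subring S R" and T: "quadratic S T" and T': "quadratic S T'"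
    and dom: "T \<subseteq> g" "T' \<subseteq> g" "nonunits T' \<subseteq> nonunits g"
  shows "T \<subseteq> T'"
proof -
  note c = subring_simps[OF S] and c' = subring_simps[OF regular2_D(1)[OF quadratic_D(1)[OF T']]]
  obtain a where a: "a \<in> nonunits S" "a \<noteq> \<zero>" "\<forall>z\<in>nonunits S. z \<otimes> inv a \<in> T"
    "\<forall>L. subring L R \<and> S \<subseteq> L \<and> (\<forall>z\<in>nonunits S. z \<otimes> inv a \<in> L) \<and>
         (\<forall>v\<in>L. v \<in> T \<and> v \<notin> nonunits T \<longrightarrow> inv v \<in> L) \<longrightarrow> T \<subseteq> L"
    using quadratic_D(5)[OF T] by blast
  obtain a' where a': "a' \<in> nonunits S" "a' \<noteq> \<zero>" "\<And>z. z \<in> nonunits S \<Longrightarrow> z \<otimes> inv a' \<in> T'"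
    using quadratic_D(5)[OF T'] by blast
  have unit: "inv v \<in> T'" if v: "v \<in> T'" "v \<noteq> \<zero>" "inv v \<in> g" for v
  proof (rule ccontr)
    assume "inv v \<notin> T'"
    hence "v \<in> nonunits g" using v dom(3) nonunitsI by blast
    thus False using v by (simp add: nonunits_def)
  qed
  have nc: "z \<in> nonunits S \<Longrightarrow> z \<in> carrier R" for z using c(8) by (simp add: nonunits_def)
  have aa: "a \<in> carrier R" "a' \<in> carrier R" using a a' nc by auto
  show ?thesis
  proof (rule a(4)[rule_format], intro conjI ballI impI)
    show "subring T' R" using regular2_D(1) quadratic_D(1)[OF T'] by blast
    show "S \<subseteq> T'" using quadratic_D(2)[OF T'] .
    have "a \<otimes> inv a' \<in> T'" using a'(3) a(1) by blast
    moreover have e: "inv (a \<otimes> inv a') = a' \<otimes> inv a" using aa a(2) a'(2) by (simp add: inv_mult_nonzero m_comm)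
    moreover have "a' \<otimes> inv a \<in> g" using a(3) a'(1) dom(1) by blast
    ultimately have u: "a' \<otimes> inv a \<in> T'" using unit[of "a \<otimes> inv a'"] aa a(2) a'(2) by simp
    fix z assume z: "z \<in> nonunits S"
    have "(z \<otimes> inv a') \<otimes> (a' \<otimes> inv a) = z \<otimes> inv a" using aa nc[OF z] a(2) a'(2) by (simp add: field_arith)
    thus "z \<otimes> inv a \<in> T'" using c'(4)[OF a'(3)[OF z] u] by simp
  next
    fix v assume v: "v \<in> T'" "v \<in> T \<and> v \<notin> nonunits T"
    thus "inv v \<in> T'" using unit[OF v(1)] dom(1) by (auto simp: nonunits_def)
  qed
qed

section \<open>Domination and the tree property\<close>

definition quotient_field_in :: "'a set \<Rightarrow> bool" where
  "quotient_field_in S \<longleftrightarrow> (\<forall>z\<in>carrier R. \<exists>v\<in>S. v \<noteq> \<zero> \<and> v \<otimes> z \<in> S)"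

lemma quotient_field_in_mono: "S \<subseteq> T \<Longrightarrow> quotient_field_in S \<Longrightarrow> quotient_field_in T"
  unfolding quotient_field_in_def by blast

lemma has_quotient_field_imp:
  assumes "has_quotient_field R S"
  shows "quotient_field_in S"
  unfolding quotient_field_in_def
proof
  fix z assume "z \<in> carrier R"
  then obtain a b where ab: "a \<in> S" "b \<in> S - {\<zero>}" "z = a \<otimes> inv b"
    using assms fractionsE unfolding has_quotient_field_def by metis
  have "a \<in> carrier R" "b \<in> carrier R" using ab assms subring_carrier by (auto simp: has_quotient_field_def)
  hence "b \<otimes> z = a" unfolding ab(3) using ab(2) by (simp add: mult_inv_cancel)
  thus "\<exists>v\<in>S. v \<noteq> \<zero> \<and> v \<otimes> z \<in> S" using ab by auto
qed

text \<open>Otherwise the centre of \<open>g\<close> on \<open>S\<close> has height one, and then the maximal ideal of \<open>g\<close>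
  would be principal.\<close>

lemma regular2_dominates:
  assumes S: "regular2 S" and g: "regular2 g" and Sg: "S \<subseteq> g" and q: "quotient_field_in S"
    and x: "x \<in> S" "x \<in> nonunits g" "x \<noteq> \<zero>"
  shows "nonunits S \<subseteq> nonunits g"
proof -
  note s = regular2_D[OF S] and h = regular2_D[OF g]
  note c = subring_simps[OF s(1)] and ch = subring_simps[OF h(1)] and m = ideal_in_simps[OF h(1,4)]
  define Q where "Q = nonunits g \<inter> S"
  have Q: "prime_in S Q"
  proof -
    have "ideal_in S Q" unfolding ideal_in_def Q_def using m c Sg by auto
    thus ?thesis
      unfolding prime_in_def Q_def
      using prime_in_D(2,3)[OF prime_in_nonunits[OF h(2)]] Sg by blast
  qed
  show ?thesis
  proof (cases "Q = nonunits S")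
    case False
    have "Q \<noteq> {\<zero>}" using x by (auto simp: Q_def)
    then obtain p where p: "p \<in> Q" "p \<noteq> \<zero>" "Q = multiples S p"
      using S prime_principal Q False unfolding regular2_def by blast
    have pg: "p \<in> nonunits g" "p \<in> g" "p \<in> S" "p \<in> carrier R" using p(1) m ch(8) by (auto simp: Q_def)
    have pn: "p \<in> nonunits S" using p(1) prime_in_local[OF s(1) Q] by blast
    have "z \<in> multiples g p" if z: "z \<in> nonunits g" for z
    proof -
      have zc: "z \<in> carrier R" using m(8)[OF z] .
      \<comment> \<open>The denominators of z. If v and v z always lay in Q = pS, dividing both by p
        would make this set indefinitely divisible by p and therefore zero, although z has a nonzero
        denominator.\<close>
      define I where "I = {v \<in> S. v \<otimes> z \<in> S}"
      have "\<exists>v\<in>I. \<not> (v \<in> Q \<and> v \<otimes> z \<in> Q)"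
      proof (rule ccontr)
        assume n: "\<not> (\<exists>v\<in>I. \<not> (v \<in> Q \<and> v \<otimes> z \<in> Q))"
        have "I \<subseteq> {\<zero>}"
        proof (rule ideal_zero_if_divisible[OF s(2,3) pn])
          show "I \<subseteq> S" by (auto simp: I_def)
          fix v assume v: "v \<in> I"
          hence "v \<in> multiples S p" "v \<otimes> z \<in> multiples S p" using n p(3) by blast+
          then obtain v' w where v': "v' \<in> S" "v = p \<otimes> v'" "w \<in> S" "v \<otimes> z = p \<otimes> w" by (auto simp: multiples_def)
          hence "p \<otimes> (v' \<otimes> z) = p \<otimes> w" using pg zc by (simp add: c m_assoc)
          hence "v' \<otimes> z = w" using m_lcancel[of p "v' \<otimes> z" w] p(2) pg(4) v' zc by (simp add: c)
          thus "\<exists>w\<in>I. v = p \<otimes> w" using v' unfolding I_def by blast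
        qed
        moreover obtain v where "v \<in> S" "v \<noteq> \<zero>" "v \<otimes> z \<in> S" using q zc unfolding quotient_field_in_def by blast
        ultimately show False unfolding I_def by blast
      qed
      then obtain v where v: "v \<in> S" "v \<otimes> z \<in> S" "\<not> (v \<in> Q \<and> v \<otimes> z \<in> Q)" by (auto simp: I_def)
      have vz: "v \<otimes> z \<in> Q" using v(2) m(4)[OF subsetD[OF Sg v(1)] z] by (simp add: Q_def)
      hence "v \<notin> nonunits g" using v(1,3) by (simp add: Q_def)
      hence u: "v \<noteq> \<zero>" "inv v \<in> g" using unit_D[OF h(1)] v(1) Sg by blast+
      obtain t where t: "t \<in> S" "v \<otimes> z = p \<otimes> t" using vz p(3) by (auto simp: multiples_def)
      have vt: "v \<in> carrier R" "t \<in> carrier R" using v t by (auto simp: c)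
      have "z = inv v \<otimes> (v \<otimes> z)" using zc u vt by (simp add: mult_inv_cancel)
      also have "\<dots> = p \<otimes> (t \<otimes> inv v)" unfolding t(2) using vt u pg by (simp add: m_ac)
      finally show ?thesis using multiplesI[OF ch(4)[OF subsetD[OF Sg t(1)] u(2)], of p] by simp
    qed
    hence eq: "nonunits g = multiples g p" using multiples_subset[OF h(1,4) pg(1)] by blast
    obtain y z where yz: "regular_pair g y z" using g by (auto simp: regular2_def)
    note r = regular_pair_D[OF yz]
    \<comment> \<open>With a principal maximal ideal, the nonzero prime generated by y in
      \<open>g\<close> would have to be maximal, which the pair excludes.\<close>
    show ?thesis using principal_prime_unique[OF h(2,3) pg(2) eq r(4) r(6)] r(5) by blast
  qed (auto simp: Q_def)
qed

abbreviation quadratic_rel :: "('a set \<times> 'a set) set" where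
  "quadratic_rel \<equiv> {(S, T). quadratic S T}"

lemma quadratic_chain:
  assumes "(S, T) \<in> quadratic_rel ^^ n" "regular2 S"
  shows "regular2 T" "S \<subseteq> T" "nonunits S \<subseteq> nonunits T"
proof -
  have "regular2 T \<and> S \<subseteq> T \<and> nonunits S \<subseteq> nonunits T" using assms
  proof (induction n arbitrary: T)
    case (Suc n)
    then obtain T' where "(S, T') \<in> quadratic_rel ^^ n" "quadratic T' T" by auto
    thus ?case using Suc(1)[of T'] Suc(3) quadratic_D(1-3)[of T' T] by blast
  qed simp
  thus "regular2 T" "S \<subseteq> T" "nonunits S \<subseteq> nonunits T" by auto
qed

text \<open>The tree property: the path to b is an initial segment of the path to g. Inclusion
  already implies domination, so the first steps of both paths are dominated by g and coincide.
  Strict growth of paths yields i \<le> l.\<close>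

lemma quadratic_chain_factor:
  assumes "regular2 D" "quotient_field_in D" "(D, b) \<in> quadratic_rel ^^ i" "(D, g) \<in> quadratic_rel ^^ l" "b \<subseteq> g"
  shows "i \<le> l \<and> (b, g) \<in> quadratic_rel ^^ (l - i)"
  using assms
proof (induction i arbitrary: D l)
  case (Suc i)
  obtain T where T: "quadratic D T" "(T, b) \<in> quadratic_rel ^^ i" using relpow_Suc_D2[OF Suc(4)] by auto
  note t = quadratic_D[OF T(1)]
  note tb = quadratic_chain[OF T(2) t(1)] and dg = quadratic_chain[OF Suc(5,2)]
  have "l \<noteq> 0"
  proof
    assume "l = 0"
    hence "g = D" using Suc(5) by simp
    thus False using t(4) tb(2) Suc(6) by blast
  qed
  then obtain l' where l: "l = Suc l'" by (cases l) auto
  obtain T' where T': "quadratic D T'" "(T', g) \<in> quadratic_rel ^^ l'"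
    using relpow_Suc_D2[OF Suc(5)[unfolded l]] by auto
  note t' = quadratic_D[OF T'(1)]
  note tg = quadratic_chain[OF T'(2) t'(1)]
  obtain a where a: "a \<in> nonunits D" "a \<noteq> \<zero>" using t(5) by blast
  have aD: "a \<in> D" using a by (simp add: nonunits_def)
  have "nonunits b \<subseteq> nonunits g"
    using regular2_dominates[OF tb(1) dg(1) Suc(6), of a] quotient_field_in_mono[OF _ Suc(3)] aD a dg(3) t(2) tb(2) by blast
  hence "T = T'"
    using quadratic_subset_if_dominated[OF regular2_D(1)[OF Suc(2)] T(1) T'(1), of g]
      quadratic_subset_if_dominated[OF regular2_D(1)[OF Suc(2)] T'(1) T(1), of g] tb tg Suc(6) by blast
  hence "(T, g) \<in> quadratic_rel ^^ l'" using T' by simp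
  thus ?case using Suc(1)[OF t(1) quotient_field_in_mono[OF t(2) Suc(3)] T(2) _ Suc(6)] by (auto simp: l)
qed simp

text \<open>\<open>G r\<close> and \<open>q i r\<close> are the degree \<open>r\<close> parts of a graded ring and of homogeneous primes \<open>q i\<close>.\<close>

lemma graded_prime_avoidance:
  fixes G :: "nat \<Rightarrow> 'a set" and q :: "'i \<Rightarrow> nat \<Rightarrow> 'a set"
  assumes "finite N" "N \<noteq> {}"
    and carr: "\<And>r. G r \<subseteq> carrier R"
    and add: "\<And>x y r. x \<in> G r \<Longrightarrow> y \<in> G r \<Longrightarrow> x \<oplus> y \<in> G r"
    and mult: "\<And>x y r s. x \<in> G r \<Longrightarrow> y \<in> G s \<Longrightarrow> x \<otimes> y \<in> G (r + s)"
    and sub: "\<And>i r. i \<in> N \<Longrightarrow> q i r \<subseteq> G r"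
    and qadd: "\<And>i x y r. i \<in> N \<Longrightarrow> x \<in> q i r \<Longrightarrow> y \<in> G r \<Longrightarrow> x \<oplus> y \<in> q i r \<longleftrightarrow> y \<in> q i r"
    and qmult: "\<And>i x y r s. i \<in> N \<Longrightarrow> x \<in> G r \<Longrightarrow> y \<in> G s \<Longrightarrow> x \<otimes> y \<in> q i (r + s) \<longleftrightarrow> x \<in> q i r \<or> y \<in> q i s"
    and ex: "\<And>i. i \<in> N \<Longrightarrow> \<exists>r\<ge>1. \<exists>x\<in>G r. x \<notin> q i r"
  shows "\<exists>r\<ge>1. \<exists>c\<in>G r. \<forall>i\<in>N. c \<notin> q i r"
  using assms(1,2,6-9)
proof (induction N rule: finite_psubset_induct)
  case (psubset N)
  note sub = psubset(4) and qadd = psubset(5) and qmult = psubset(6) and ex = psubset(7)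
  show ?case
  proof (cases "\<exists>i\<in>N. \<exists>j\<in>N. i \<noteq> j \<and> (\<forall>r. q i r \<subseteq> q j r)")
    case True
    then obtain i j where ij: "i \<in> N" "j \<in> N" "i \<noteq> j" "\<And>r. q i r \<subseteq> q j r" by blast
    \<comment> \<open>A prime contained in another one is avoided along with it and may be
      dropped.\<close>
    have "\<exists>r\<ge>1. \<exists>c\<in>G r. \<forall>k\<in>N - {i}. c \<notin> q k r"
      by (rule psubset(2)) (use ij sub qadd qmult ex in auto)
    then obtain r c where "r \<ge> 1" "c \<in> G r" "\<forall>k\<in>N - {i}. c \<notin> q k r" by blast
    moreover from this have "c \<notin> q i r" using ij by blast
    ultimately show ?thesis by blast
  next
    case False
    \<comment> \<open>Without containments, a product of one homogeneous element from each
      \<open>q i\<close> outside \<open>q j\<close> separates j from the others.\<close>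
    have sep: "\<exists>r\<ge>1. \<exists>e\<in>G r. e \<notin> q j r \<and> (\<forall>i\<in>M. e \<in> q i r)" if j: "j \<in> N" and M: "finite M" "M \<subseteq> N - {j}" for j M
      using M
    proof (induction M)
      case empty
      thus ?case using ex[OF j] by blast
    next
      case (insert i M)
      then obtain r e where e: "r \<ge> 1" "e \<in> G r" "e \<notin> q j r" "\<forall>i\<in>M. e \<in> q i r" by auto
      obtain s d where d: "d \<in> q i s" "d \<notin> q j s" using False j insert(4) by blast
      have dG: "d \<in> G s" using d sub insert(4) by blast
      have "e \<otimes> d \<in> G (r + s)" using mult e dG by blast
      moreover have "e \<otimes> d \<notin> q j (r + s)" using qmult[OF j e(2) dG] e d by blast
      moreover have "\<forall>k\<in>insert i M. e \<otimes> d \<in> q k (r + s)"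
        using qmult[OF _ e(2) dG] e(4) d(1) insert(4) by blast
      ultimately show ?case using e(1) by (metis le_add1 le_trans)
    qed
    \<comment> \<open>Only positive powers are formed, as nothing assumed here puts
      \<open>\<one>\<close> into \<open>G 0\<close>.\<close>
    have powG: "x \<in> G r \<Longrightarrow> x [^] Suc n \<in> G (Suc n * r)" for x r n
    proof (induction n)
      case 0
      hence "x \<in> carrier R" using carr by blast
      thus ?case using 0 by simp
    next
      case (Suc n)
      thus ?case using mult[of "x [^] Suc n" "Suc n * r" x r] by (simp add: add.commute)
    qed
    have powq: "x [^] Suc n \<in> q i (Suc n * r) \<longleftrightarrow> x \<in> q i r" if "i \<in> N" "x \<in> G r" for x r n i
    proof (induction n)
      case 0
      have "x \<in> carrier R" using carr that by blast
      thus ?case by simp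
    next
      case (Suc n)
      thus ?case using qmult[OF that(1) powG[OF that(2), of n] that(2)] by (simp add: add.commute)
    qed
    have "\<exists>r\<ge>1. \<exists>c\<in>G r. (\<forall>i\<in>M. c \<notin> q i r) \<and> (\<forall>i\<in>N - M. c \<in> q i r)" if M: "finite M" "M \<noteq> {}" "M \<subseteq> N" for M
      using M
    proof (induction M rule: finite_ne_induct)
      case (singleton j)
      thus ?case using sep[of j "N - {j}"] psubset(1) by simp
    next
      case (insert j M)
      then obtain r c where c: "r \<ge> 1" "c \<in> G r" "\<forall>i\<in>M. c \<notin> q i r" "\<forall>i\<in>N - M. c \<in> q i r" by auto
      obtain s e where e: "s \<ge> 1" "e \<in> G s" "e \<notin> q j s" "\<forall>i\<in>N - {j}. e \<in> q i s"
        using sep[of j "N - {j}"] psubset(1) insert(5) by auto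
      obtain r' s' where rs: "r = Suc r'" "s = Suc s'" using c(1) e(1) by (metis Suc_le_D One_nat_def)
      \<comment> \<open>The exponents bring both elements to degree r s. Each \<open>q i\<close>
        with i in \<open>insert j M\<close> contains exactly one of \<open>C\<close> and
        \<open>E\<close>, so it misses their sum; every other \<open>q i\<close> contains
        both.\<close>
      define C where "C = c [^] s" define E where "E = e [^] r"
      have CG: "C \<in> G (r * s)" "E \<in> G (r * s)"
        using powG[OF c(2), of s'] powG[OF e(2), of r'] by (simp_all only: C_def E_def rs mult.commute)
      have Cq: "C \<in> q i (r * s) \<longleftrightarrow> c \<in> q i r" and Eq: "E \<in> q i (r * s) \<longleftrightarrow> e \<in> q i s" if "i \<in> N" for i
        using powq[OF that c(2), of s'] powq[OF that e(2), of r'] by (simp_all only: C_def E_def rs mult.commute)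
      have comm: "C \<oplus> E = E \<oplus> C" using CG carr by (simp add: a_comm subset_iff)
      have "C \<oplus> E \<in> G (r * s)" using add CG by blast
      moreover have "\<forall>i\<in>insert j M. C \<oplus> E \<notin> q i (r * s)"
      proof
        fix i assume i: "i \<in> insert j M"
        hence iN: "i \<in> N" using insert(5) by blast
        show "C \<oplus> E \<notin> q i (r * s)"
        proof (cases "i = j")
          case True
          have "c \<in> q j r" using c(4) insert(3,5) by blast
          thus ?thesis using qadd[OF iN _ CG(2), of C] Cq[OF iN] Eq[OF iN] e(3) True by blast
        next
          case False
          hence "e \<in> q i s" "c \<notin> q i r" using e(4) i iN c(3) by blast+
          thus ?thesis unfolding comm using qadd[OF iN _ CG(1), of E] Cq[OF iN] Eq[OF iN] by blast
        qed
      qed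
      moreover have "\<forall>i\<in>N - insert j M. C \<oplus> E \<in> q i (r * s)"
      proof
        fix i assume i: "i \<in> N - insert j M"
        hence "e \<in> q i s" "c \<in> q i r" "i \<in> N" using e(4) c(4) by blast+
        thus "C \<oplus> E \<in> q i (r * s)" using qadd[OF _ _ CG(2), of i C] Cq[of i] Eq[of i] by blast
      qed
      moreover have "r * s \<ge> 1" using rs by simp
      ultimately show ?case by blast
    qed
    from this[of N] psubset(1,3) show ?thesis by auto
  qed
qed

subsection \<open>Intersections of antichains\<close>

text \<open>Elementwise form of being a localization: the denominators are the elements of the
  intersection that are units in \<open>\<alpha>\<close>, which means those outside the centre of
  \<open>\<alpha>\<close>.\<close>

definition essential :: "'a set set \<Rightarrow> bool" where
  "essential U \<longleftrightarrow> (\<forall>\<alpha>\<in>U. \<forall>z\<in>\<alpha>. \<exists>s\<in>ring_inter R U. s \<noteq> \<zero> \<and> inv s \<in> \<alpha> \<and> s \<otimes> z \<in> ring_inter R U)"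

lemma ring_inter_subring:
  assumes "\<And>\<alpha>. \<alpha> \<in> U \<Longrightarrow> subring \<alpha> R"
  shows "subring (ring_inter R U) R"
proof -
  have "ring_inter R U = \<Inter>(insert (carrier R) U)" by (simp add: ring_inter_def)
  thus ?thesis using assms carrier_is_subring subring_Inter[of "insert (carrier R) U"] by auto
qed

lemma ring_inter_subset: "\<alpha> \<in> U \<Longrightarrow> ring_inter R U \<subseteq> \<alpha>"
  by (auto simp: ring_inter_def)

lemma ring_interI:
  assumes "U \<noteq> {}" "\<And>\<alpha>. \<alpha> \<in> U \<Longrightarrow> subring \<alpha> R" "\<And>\<alpha>. \<alpha> \<in> U \<Longrightarrow> x \<in> \<alpha>"
  shows "x \<in> ring_inter R U"
  using assms subring_carrier by (auto simp: ring_inter_def)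

text \<open>Take z in \<open>\<alpha>\<close> but not in \<open>\<beta>\<close> and a denominator s
  of z that is a unit in \<open>\<alpha>\<close>. Were s a unit in \<open>\<beta>\<close> as well, z
  would lie in \<open>\<beta>\<close>.\<close>

lemma essential_separates:
  assumes U: "\<And>\<alpha>. \<alpha> \<in> U \<Longrightarrow> subring \<alpha> R" and E: "essential U" and ab: "\<alpha> \<in> U" "\<beta> \<in> U" "\<not> \<alpha> \<subseteq> \<beta>"
  shows "\<exists>s\<in>ring_inter R U. s \<in> nonunits \<beta> \<and> s \<notin> nonunits \<alpha>"
proof -
  obtain z where z: "z \<in> \<alpha>" "z \<notin> \<beta>" using ab by blast
  then obtain s where s: "s \<in> ring_inter R U" "s \<noteq> \<zero>" "inv s \<in> \<alpha>" "s \<otimes> z \<in> ring_inter R U"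
    using E ab(1) unfolding essential_def by blast
  have "s \<in> \<beta>" "s \<otimes> z \<in> \<beta>" using s ring_inter_subset[OF ab(2)] by auto
  note c = subring_simps[OF U[OF ab(2)]] subring_simps[OF U[OF ab(1)]]
  have "inv s \<notin> \<beta>"
  proof
    assume "inv s \<in> \<beta>"
    hence "inv s \<otimes> (s \<otimes> z) \<in> \<beta>" using \<open>s \<otimes> z \<in> \<beta>\<close> c(4) by blast
    moreover have "inv s \<otimes> (s \<otimes> z) = z" using s(2) c(8)[OF \<open>s \<in> \<beta>\<close>] c(16)[OF z(1)] by (simp add: mult_inv_cancel)
    ultimately show False using z by simp
  qed
  thus ?thesis using s \<open>s \<in> \<beta>\<close> by (auto simp: nonunits_def)
qed

text \<open>Old members keep their denominators because the intersection only grows. For a transform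
  of \<open>\<beta>\<close>, the elements possessing a denominator form a subring, and the
  generation property reduces the claim to the quotients z/a. The hypothesis \<open>inc\<close>
  ensures that p contains a unit of each remaining old member, so p is principal there too.\<close>

lemma essential_step:
  assumes U: "finite U" "\<And>\<alpha>. \<alpha> \<in> U \<Longrightarrow> regular2 \<alpha>" and E: "essential U" and b: "\<beta> \<in> U"
    and V: "finite V" "\<And>\<gamma>. \<gamma> \<in> V \<Longrightarrow> quadratic \<beta> \<gamma>"
    and inc: "\<And>\<alpha>. \<alpha> \<in> U \<Longrightarrow> \<alpha> \<noteq> \<beta> \<Longrightarrow> \<not> \<alpha> \<subseteq> \<beta>"
  shows "essential ((U - {\<beta>}) \<union> V)"
proof (cases "(U - {\<beta>}) \<union> V = {}")
  case True
  show ?thesis unfolding True by (simp add: essential_def)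
next
  case ne: False
  define U' where "U' = (U - {\<beta>}) \<union> V"
  define N where "N = ring_inter R U" define N' where "N' = ring_inter R U'"
  have reg': "regular2 \<delta>" if "\<delta> \<in> U'" for \<delta> using that U(2) V(2) quadratic_D(1) by (auto simp: U'_def)
  note r' = regular2_D[OF reg']
  have sU: "\<alpha> \<in> U \<Longrightarrow> subring \<alpha> R" for \<alpha> using regular2_D(1) U(2) by blast
  have sN: "subring N R" unfolding N_def using sU by (rule ring_inter_subring)
  have sN': "subring N' R" unfolding N'_def using r'(1) by (rule ring_inter_subring)
  have N'I: "x \<in> N'" if "\<And>\<delta>. \<delta> \<in> U' \<Longrightarrow> x \<in> \<delta>" for x
    unfolding N'_def using ne r'(1) that by (intro ring_interI) (auto simp: U'_def)
  have N'D: "x \<in> \<delta>" if "x \<in> N'" "\<delta> \<in> U'" for x \<delta> using that ring_inter_subset unfolding N'_def by blast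
  have NN': "N \<subseteq> N'"
  proof
    fix x assume x: "x \<in> N"
    show "x \<in> N'"
    proof (rule N'I)
      fix \<delta> assume "\<delta> \<in> U'"
      then obtain \<epsilon> where "\<epsilon> \<in> U" "\<epsilon> \<subseteq> \<delta>" using quadratic_D(2)[OF V(2)] b by (auto simp: U'_def)
      thus "x \<in> \<delta>" using x ring_inter_subset unfolding N_def by blast
    qed
  qed
  note cN = subring_simps[OF sN] and cN' = subring_simps[OF sN']
  have sb: "subring \<beta> R" "ideal_in \<beta> (nonunits \<beta>)" "N \<subseteq> \<beta>"
    using sU[OF b] regular2_D(4)[OF U(2)[OF b]] ring_inter_subset[OF b] by (simp_all add: N_def)
  note cb = subring_simps[OF sb(1)] and mb = ideal_in_simps[OF sb(1,2)]
  have Eb: "\<exists>s\<in>N. s \<noteq> \<zero> \<and> inv s \<in> \<alpha> \<and> s \<otimes> z \<in> N" if "\<alpha> \<in> U" "z \<in> \<alpha>" for \<alpha> z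
    using E that unfolding essential_def N_def by blast
  define p where "p = nonunits \<beta> \<inter> N"
  \<comment> \<open>A generator of p in each new member, chosen inside p. Over
    \<open>\<beta>\<close> it is the element a of the transform multiplied by a denominator that is
    a unit of \<open>\<beta>\<close>; in an old member it is an element of p that becomes a
    unit.\<close>
  have "\<exists>d\<in>p. d \<noteq> \<zero> \<and> (\<forall>z\<in>p. z \<otimes> inv d \<in> \<delta>)" if d: "\<delta> \<in> U'" for \<delta>
  proof (cases "\<delta> \<in> V")
    case True
    then obtain a where a: "a \<in> nonunits \<beta>" "a \<noteq> \<zero>" "\<forall>z\<in>nonunits \<beta>. z \<otimes> inv a \<in> \<delta>"
      using quadratic_D(5)[OF V(2)] by blast
    have ab: "a \<in> \<beta>" using a by (simp add: nonunits_def)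
    then obtain s where s: "s \<in> N" "s \<noteq> \<zero>" "inv s \<in> \<beta>" "s \<otimes> a \<in> N" using Eb[OF b] by blast
    have sb': "s \<in> \<beta>" using s sb(3) by blast
    have sd: "inv s \<in> \<delta>" using quadratic_D(2)[OF V(2)[OF True]] s by blast
    show ?thesis
    proof (intro bexI[of _ "s \<otimes> a"] conjI ballI)
      show "s \<otimes> a \<in> p" unfolding p_def using s mb(4)[OF sb' a(1)] by blast
      show "s \<otimes> a \<noteq> \<zero>" using s(2) a(2) cb(8)[OF sb'] cb(8)[OF ab] by simp
      fix z assume z: "z \<in> p"
      hence zb: "z \<in> nonunits \<beta>" by (simp add: p_def)
      have "z \<otimes> inv (s \<otimes> a) = inv s \<otimes> (z \<otimes> inv a)"
        using s(2) a(2) cb(8)[OF sb'] cb(8)[OF ab] mb(8)[OF zb] by (simp add: field_arith)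
      thus "z \<otimes> inv (s \<otimes> a) \<in> \<delta>" using subring_simps(4)[OF r'(1)[OF d] sd] a(3) zb by auto
    qed
  next
    case False
    hence dU: "\<delta> \<in> U" "\<delta> \<noteq> \<beta>" using d by (auto simp: U'_def)
    obtain s where s: "s \<in> N" "s \<in> nonunits \<beta>" "s \<notin> nonunits \<delta>"
      using essential_separates[OF sU E dU(1) b inc[OF dU]] unfolding N_def by blast
    have "N \<subseteq> \<delta>" unfolding N_def using ring_inter_subset dU by blast
    hence u: "s \<noteq> \<zero>" "inv s \<in> \<delta>" using unit_D[OF r'(1)[OF d]] s by blast+
    show ?thesis
      using s u \<open>N \<subseteq> \<delta>\<close> subring_simps(4)[OF r'(1)[OF d]] by (intro bexI[of _ s]) (auto simp: p_def)
  qed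
  then obtain d where d: "\<And>\<delta>. \<delta> \<in> U' \<Longrightarrow> d \<delta> \<in> p" "\<And>\<delta>. \<delta> \<in> U' \<Longrightarrow> d \<delta> \<noteq> \<zero>"
    "\<And>\<delta> z. \<delta> \<in> U' \<Longrightarrow> z \<in> p \<Longrightarrow> z \<otimes> inv (d \<delta>) \<in> \<delta>" by metis
  have pN: "z \<in> p \<Longrightarrow> z \<in> N" for z by (simp add: p_def)
  have pc: "z \<in> p \<Longrightarrow> z \<in> carrier R" for z using pN cN(8) by blast
  define e where "e \<delta> r = d \<delta> [^] r" for \<delta> and r :: nat
  have e: "e \<delta> r \<in> carrier R" "e \<delta> r \<noteq> \<zero>" "e \<delta> (r + s) = e \<delta> r \<otimes> e \<delta> s" "inv (e \<delta> r) \<in> carrier R"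
    if "\<delta> \<in> U'" for \<delta> r s
  proof -
    have dc: "d \<delta> \<in> carrier R" using pc d(1) that by blast
    show ec: "e \<delta> r \<in> carrier R" using dc by (simp add: e_def)
    show ez: "e \<delta> r \<noteq> \<zero>" unfolding e_def using dc d(2)[OF that] by (induction r) auto
    show "inv (e \<delta> r) \<in> carrier R" using ec ez by simp
    show "e \<delta> (r + s) = e \<delta> r \<otimes> e \<delta> s" using dc by (simp add: e_def nat_pow_mult)
  qed
  text \<open>\<open>G r\<close> consists of the elements of \<open>F\<close> that lie in \<open>p\<^sup>r \<delta>\<close> for every new member \<open>\<delta>\<close>.\<close>
  define G where "G r = {c \<in> carrier R. \<forall>\<delta>\<in>U'. c \<otimes> inv (e \<delta> r) \<in> \<delta>}" for r
  define q where "q \<delta> r = {c \<in> G r. c \<otimes> inv (e \<delta> r) \<in> nonunits \<delta>}" for \<delta> r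
  have Gc: "x \<in> G r \<Longrightarrow> x \<in> carrier R" for x r by (simp add: G_def)
  have Gd: "x \<in> G r \<Longrightarrow> \<delta> \<in> U' \<Longrightarrow> x \<otimes> inv (e \<delta> r) \<in> \<delta>" for x r \<delta> by (simp add: G_def)
  have prod: "(x \<otimes> y) \<otimes> inv (e \<delta> (r + s)) = (x \<otimes> inv (e \<delta> r)) \<otimes> (y \<otimes> inv (e \<delta> s))"
    if "\<delta> \<in> U'" "x \<in> carrier R" "y \<in> carrier R" for x y \<delta> r s
    using that e(1,2,4)[OF that(1)] by (simp add: e(3)[OF that(1)] field_arith)
  have pG: "z \<in> p \<Longrightarrow> z \<in> G 1" for z
    unfolding G_def e_def using pc d(1,3) by auto
  have multG: "x \<otimes> y \<in> G (r + s)" if "x \<in> G r" "y \<in> G s" for x y r s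
    unfolding G_def using Gc[OF that(1)] Gc[OF that(2)] Gd[OF that(1)] Gd[OF that(2)]
      subring_simps(4)[OF r'(1)] by (auto simp: prod)
  \<comment> \<open>Avoiding \<open>q \<delta>\<close> in degree r means that c/(d \<delta>)^r is a
    unit of \<open>\<delta>\<close>, so that c generates p^r there. In degree one,
    \<open>d \<delta>\<close> itself avoids \<open>q \<delta>\<close>.\<close>
  have "\<exists>r\<ge>1. \<exists>c\<in>G r. \<forall>\<delta>\<in>U'. c \<notin> q \<delta> r"
  proof (rule graded_prime_avoidance)
    show "finite U'" "U' \<noteq> {}" using U V ne by (auto simp: U'_def)
    show "G r \<subseteq> carrier R" for r by (auto simp: G_def)
    show "x \<otimes> y \<in> G (r + s)" if "x \<in> G r" "y \<in> G s" for x y r s using multG that .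
    show "x \<oplus> y \<in> G r" if x: "x \<in> G r" "y \<in> G r" for x y r
      unfolding G_def using Gc[OF x(1)] Gc[OF x(2)] Gd[OF x(1)] Gd[OF x(2)] subring_simps(5)[OF r'(1)] e(4)
      by (auto simp: l_distr)
    show "q \<delta> r \<subseteq> G r" for \<delta> r by (auto simp: q_def)
    fix \<delta> assume dU: "\<delta> \<in> U'"
    note m = ideal_in_simps[OF r'(1)[OF dU] r'(4)[OF dU]]
    show "x \<oplus> y \<in> q \<delta> r \<longleftrightarrow> y \<in> q \<delta> r" if x: "x \<in> q \<delta> r" "y \<in> G r" for x y r
    proof -
      have xG: "x \<in> G r" "x \<otimes> inv (e \<delta> r) \<in> nonunits \<delta>" using x by (auto simp: q_def)
      have eq: "(x \<oplus> y) \<otimes> inv (e \<delta> r) = y \<otimes> inv (e \<delta> r) \<oplus> x \<otimes> inv (e \<delta> r)"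
        using Gc[OF xG(1)] Gc[OF x(2)] e(4)[OF dU] by (simp add: l_distr a_comm)
      have "x \<oplus> y \<in> G r"
        unfolding G_def using Gc[OF xG(1)] Gc[OF x(2)] Gd[OF xG(1)] Gd[OF x(2)] subring_simps(5)[OF r'(1)] e(4)
        by (auto simp: l_distr)
      moreover have "(x \<oplus> y) \<otimes> inv (e \<delta> r) \<in> nonunits \<delta> \<longleftrightarrow> y \<otimes> inv (e \<delta> r) \<in> nonunits \<delta>"
        unfolding eq
        using ideal_in_add_cancel[OF r'(1)[OF dU] r'(4)[OF dU] _ xG(2) Gd[OF x(2) dU]] m(3)[OF _ xG(2)] by blast
      ultimately show ?thesis using x(2) by (simp add: q_def)
    qed
    show "x \<otimes> y \<in> q \<delta> (r + s) \<longleftrightarrow> x \<in> q \<delta> r \<or> y \<in> q \<delta> s" if x: "x \<in> G r" "y \<in> G s" for x y r s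
    proof -
      have "(x \<otimes> y) \<otimes> inv (e \<delta> (r + s)) \<in> nonunits \<delta> \<longleftrightarrow> x \<otimes> inv (e \<delta> r) \<in> nonunits \<delta> \<or> y \<otimes> inv (e \<delta> s) \<in> nonunits \<delta>"
        unfolding prod[OF dU Gc[OF x(1)] Gc[OF x(2)]]
        using unit_mult[OF r'(1)[OF dU] Gd[OF x(1) dU] Gd[OF x(2) dU]] m(4)[OF Gd[OF x(1) dU]] m(5)[OF Gd[OF x(2) dU]] by blast
      thus ?thesis using x multG[OF x] by (simp add: q_def)
    qed
    have "d \<delta> \<otimes> inv (e \<delta> 1) = \<one>" using d(2)[OF dU] pc[OF d(1)[OF dU]] by (simp add: e_def)
    hence "d \<delta> \<notin> q \<delta> 1" using one_notin_nonunits[OF r'(1)[OF dU]] by (simp add: q_def)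
    thus "\<exists>r\<ge>1. \<exists>x\<in>G r. x \<notin> q \<delta> r" using pG[OF d(1)[OF dU]] by blast
  qed
  then obtain r c where c: "r \<ge> 1" "c \<in> G r" "\<forall>\<delta>\<in>U'. c \<notin> q \<delta> r" by blast
  have cc: "c \<in> carrier R" using c by (simp add: G_def)
  have cu: "c \<otimes> inv (e \<delta> r) \<notin> nonunits \<delta>" "c \<otimes> inv (e \<delta> r) \<in> \<delta>" if "\<delta> \<in> U'" for \<delta>
    using c that Gd by (auto simp: q_def)
  have c0: "c \<noteq> \<zero>"
  proof -
    obtain \<delta> where dU: "\<delta> \<in> U'" using ne by (auto simp: U'_def)
    have "\<zero> \<in> nonunits \<delta>" using ideal_in_D(3)[OF r'(4)[OF dU]] .
    thus ?thesis using cu[OF dU] e(4)[OF dU] by auto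
  qed
  have quot: "w \<otimes> inv c \<in> N'" if w: "w \<in> G r" for w
  proof (rule N'I)
    fix \<delta> assume dU: "\<delta> \<in> U'"
    have "inv (c \<otimes> inv (e \<delta> r)) \<in> \<delta>" using unit_D[OF r'(1)[OF dU] cu(2,1)[OF dU]] by blast
    hence "(w \<otimes> inv (e \<delta> r)) \<otimes> inv (c \<otimes> inv (e \<delta> r)) \<in> \<delta>"
      using Gd[OF w dU] subring_simps(4)[OF r'(1)[OF dU]] by blast
    moreover have "(w \<otimes> inv (e \<delta> r)) \<otimes> inv (c \<otimes> inv (e \<delta> r)) = w \<otimes> inv c"
      using Gc[OF w] cc c0 e[OF dU] by (simp add: field_arith)
    ultimately show "w \<otimes> inv c \<in> \<delta>" by simp
  qed
  obtain r' where r'': "r = Suc r'" using c(1) by (cases r) auto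
  have powG: "x \<in> G 1 \<Longrightarrow> x [^] n \<in> G n" if "n \<ge> 1" for x n
    using that
  proof (induction n rule: nat_induct_at_least)
    case base
    thus ?case using Gc by simp
  next
    case (Suc n)
    thus ?case using multG[of "x [^] n" n x 1] by simp
  qed
  \<comment> \<open>One factor x of x^r is traded for z, where r' = r - 1.\<close>
  have mulG: "z \<otimes> x [^] r' \<in> G r" if "z \<in> G 1" "x \<in> G 1" for z x
  proof (cases "r' = 0")
    case True
    thus ?thesis using that Gc by (simp add: r'')
  next
    case False
    thus ?thesis using multG[OF that(1) powG[OF _ that(2), of r']] by (simp add: r'')
  qed
  have "\<exists>s\<in>N'. s \<noteq> \<zero> \<and> inv s \<in> \<delta> \<and> s \<otimes> z \<in> N'" if dU: "\<delta> \<in> U'" and z: "z \<in> \<delta>" for \<delta> z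
  proof (cases "\<delta> \<in> V")
    case False
    hence "\<delta> \<in> U" using dU by (auto simp: U'_def)
    thus ?thesis using Eb z NN' by blast
  next
    case True
    note t = quadratic_D[OF V(2)[OF True]]
    note sd = r'(1)[OF dU]
    note cd = subring_simps[OF sd]
    \<comment> \<open>The part of \<open>\<delta>\<close> that has admissible denominators; it
      serves as the test ring in the generation property of \<open>\<delta>\<close>.\<close>
    define L where "L = {z \<in> \<delta>. \<exists>s\<in>N'. s \<noteq> \<zero> \<and> inv s \<in> \<delta> \<and> s \<otimes> z \<in> N'}"
    have LI: "z \<in> L" if "z \<in> \<delta>" "s \<in> N'" "s \<noteq> \<zero>" "inv s \<in> \<delta>" "s \<otimes> z \<in> N'" for z s using that by (auto simp: L_def)
    have N'L: "N' \<subseteq> L"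
    proof
      fix x assume x: "x \<in> N'"
      have "\<one> \<otimes> x \<in> N'" using x cN'(8) by simp
      thus "x \<in> L" using LI[of x \<one>] N'D[OF x dU] cN'(2) cd(2) by simp
    qed
    have sL: "subring L R"
    proof (rule subringI)
      show "L \<subseteq> carrier R" using cd(8) by (auto simp: L_def)
      show "\<one> \<in> L" using N'L cN'(2) by blast
      fix x assume "x \<in> L"
      then obtain s where s: "x \<in> \<delta>" "s \<in> N'" "s \<noteq> \<zero>" "inv s \<in> \<delta>" "s \<otimes> x \<in> N'" by (auto simp: L_def)
      have xc: "x \<in> carrier R" "s \<in> carrier R" using s cd(8) cN'(8) by blast+
      have "s \<otimes> (\<ominus> x) \<in> N'" using xc cN'(3)[OF s(5)] by (simp add: r_minus)
      thus "\<ominus> x \<in> L" using LI[OF cd(3)[OF s(1)] s(2-4)] by blast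
      fix y assume "y \<in> L"
      then obtain u where u: "y \<in> \<delta>" "u \<in> N'" "u \<noteq> \<zero>" "inv u \<in> \<delta>" "u \<otimes> y \<in> N'" by (auto simp: L_def)
      have yc: "y \<in> carrier R" "u \<in> carrier R" using u cd(8) cN'(8) by blast+
      have su: "s \<otimes> u \<in> N'" "s \<otimes> u \<noteq> \<zero>" "inv (s \<otimes> u) \<in> \<delta>"
        using cN'(4)[OF s(2) u(2)] xc yc s(3) u(3) cd(4)[OF s(4) u(4)] by (simp_all add: inv_mult_nonzero)
      have "(s \<otimes> u) \<otimes> (x \<otimes> y) = (s \<otimes> x) \<otimes> (u \<otimes> y)" "(s \<otimes> u) \<otimes> (x \<oplus> y) = u \<otimes> (s \<otimes> x) \<oplus> s \<otimes> (u \<otimes> y)"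
        using xc yc by (simp_all add: field_arith)
      hence "(s \<otimes> u) \<otimes> (x \<otimes> y) \<in> N'" "(s \<otimes> u) \<otimes> (x \<oplus> y) \<in> N'"
        using s u by (simp_all add: cN')
      thus "x \<otimes> y \<in> L" "x \<oplus> y \<in> L" using LI su cd(4)[OF s(1) u(1)] cd(5)[OF s(1) u(1)] by blast+
    qed
    note cL = subring_simps[OF sL]
    have invL: "inv v \<in> L" if v: "v \<in> L" "v \<noteq> \<zero>" "inv v \<in> \<delta>" for v
    proof -
      obtain s where s: "v \<in> \<delta>" "s \<in> N'" "s \<noteq> \<zero>" "inv s \<in> \<delta>" "s \<otimes> v \<in> N'" using v by (auto simp: L_def)
      have vc: "v \<in> carrier R" "s \<in> carrier R" using s cd(8) cN'(8) by blast+
      have "(s \<otimes> v) \<otimes> inv v \<in> N'" "inv (s \<otimes> v) \<in> \<delta>" "s \<otimes> v \<noteq> \<zero>"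
        using vc s v cd(4)[OF s(4) v(3)] by (simp_all add: mult_inv_cancel inv_mult_nonzero)
      thus ?thesis using LI[OF v(3) s(5)] by blast
    qed
    have bL: "\<beta> \<subseteq> L"
    proof
      fix x assume x: "x \<in> \<beta>"
      then obtain s where s: "s \<in> N" "s \<noteq> \<zero>" "inv s \<in> \<beta>" "s \<otimes> x \<in> N" using Eb[OF b] by blast
      thus "x \<in> L" using LI[of x s] x t(2) NN' by blast
    qed
    obtain a where a: "a \<in> nonunits \<beta>" "a \<noteq> \<zero>" "\<forall>z\<in>nonunits \<beta>. z \<otimes> inv a \<in> \<delta>"
      "\<forall>L. subring L R \<and> \<beta> \<subseteq> L \<and> (\<forall>z\<in>nonunits \<beta>. z \<otimes> inv a \<in> L) \<and>
         (\<forall>v\<in>L. v \<in> \<delta> \<and> v \<notin> nonunits \<delta> \<longrightarrow> inv v \<in> L) \<longrightarrow> \<delta> \<subseteq> L"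
      using t(5) by blast
    define D where "D = d \<delta>"
    have D: "D \<in> p" "D \<in> carrier R" "D \<noteq> \<zero>" "D \<in> nonunits \<beta>" "D \<in> G 1" "D [^] r' \<in> carrier R"
      using d(1,2)[OF dU] pc pG by (auto simp: D_def p_def)
    have Dr: "D \<otimes> D [^] r' = e \<delta> r" using D(2) by (simp add: e_def D_def[symmetric] r'' m_comm)
    have frac: "x \<otimes> inv D \<in> L" if x: "x \<in> nonunits \<beta>" for x
    proof -
      have xb: "x \<in> \<beta>" using x mb by blast
      obtain s where s: "s \<in> N" "s \<noteq> \<zero>" "inv s \<in> \<beta>" "s \<otimes> x \<in> N" using Eb[OF b xb] by blast
      have car: "s \<in> carrier R" "x \<in> carrier R" using cN(8)[OF s(1)] mb(8)[OF x] by auto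
      have sx: "s \<otimes> x \<in> p" unfolding p_def using s mb(4)[OF subsetD[OF sb(3) s(1)] x] by blast
      \<comment> \<open>The common denominator: D^r/c lies in the new intersection and is a unit of
        \<open>\<delta>\<close>. Multiplying (s x)/D by it gives s x D^(r-1)/c, whose numerator
        again has degree r.\<close>
      let ?u = "(D \<otimes> D [^] r') \<otimes> inv c"
      have u: "?u \<in> N'" using quot[OF mulG[OF D(5,5)]] .
      have u0: "?u \<noteq> \<zero>" using D cc c0 e(2)[OF dU] by (simp add: Dr e(1)[OF dU])
      have "inv ?u = c \<otimes> inv (e \<delta> r)" unfolding Dr using cc c0 e(1,2)[OF dU] by (simp add: inv_mult_nonzero m_comm)
      hence iu: "inv ?u \<in> \<delta>" using cu(2)[OF dU] by simp
      have "((s \<otimes> x) \<otimes> D [^] r') \<otimes> inv c \<in> N'" using quot[OF mulG[OF pG[OF sx] D(5)]] .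
      moreover have "?u \<otimes> ((s \<otimes> x) \<otimes> inv D) = ((s \<otimes> x) \<otimes> D [^] r') \<otimes> inv c"
        using D(2,3,6) car cc c0 by (simp add: field_arith mult_inv_cancel3)
      ultimately have 1: "(s \<otimes> x) \<otimes> inv D \<in> L" using LI[OF _ u u0 iu] d(3)[OF dU sx] by (simp add: D_def)
      have "inv s \<in> L" using s(3) bL by blast
      hence "inv s \<otimes> ((s \<otimes> x) \<otimes> inv D) \<in> L" using 1 cL(4) by blast
      moreover have "inv s \<otimes> ((s \<otimes> x) \<otimes> inv D) = x \<otimes> inv D" using car s(2) D(2,3) by (simp add: field_arith)
      ultimately show ?thesis by simp
    qed
    \<comment> \<open>The generation property is tied to its own a. It is compared with D: a/D lies
      in \<open>L\<close>, its inverse D/a lies in \<open>\<delta>\<close>, and \<open>L\<close>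
      contains inverses of its elements whenever \<open>\<delta>\<close> does.\<close>
    have ac: "a \<in> carrier R" using mb(8)[OF a(1)] .
    have "inv (a \<otimes> inv D) = D \<otimes> inv a" using ac a(2) D(2,3) by (simp add: inv_mult_nonzero m_comm)
    moreover have "a \<otimes> inv D \<noteq> \<zero>" using ac a(2) D(2,3) by simp
    ultimately have Da: "D \<otimes> inv a \<in> L" using invL[OF frac[OF a(1)]] a(3) D(4) by simp
    have "\<delta> \<subseteq> L"
    proof (rule a(4)[rule_format], intro conjI ballI impI sL bL)
      fix x assume x: "x \<in> nonunits \<beta>"
      have "(x \<otimes> inv D) \<otimes> (D \<otimes> inv a) \<in> L" using frac[OF x] Da cL(4) by blast
      moreover have "(x \<otimes> inv D) \<otimes> (D \<otimes> inv a) = x \<otimes> inv a" using mb(8)[OF x] D(2,3) ac a(2) by (simp add: field_arith)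
      ultimately show "x \<otimes> inv a \<in> L" by simp
    next
      fix v assume "v \<in> L" "v \<in> \<delta> \<and> v \<notin> nonunits \<delta>"
      thus "inv v \<in> L" using invL by (auto simp: nonunits_def)
    qed
    thus ?thesis using z by (auto simp: L_def)
  qed
  thus ?thesis unfolding essential_def U'_def[symmetric] N'_def[symmetric] by blast
qed

text \<open>The sum of the depths decreases when a deepest member and its siblings in
  \<open>U\<close> are replaced by their common parent \<open>\<beta>\<close>. The smaller family is
  again an antichain, and \<open>essential_step\<close> restores \<open>U\<close> from it.\<close>

lemma antichain_essential:
  assumes D: "regular2 D" "quotient_field_in D" and U: "finite U" "\<And>\<alpha>. \<alpha> \<in> U \<Longrightarrow> \<exists>n. (D, \<alpha>) \<in> quadratic_rel ^^ n"
    and anti: "\<And>\<alpha> \<beta>. \<alpha> \<in> U \<Longrightarrow> \<beta> \<in> U \<Longrightarrow> \<alpha> \<subseteq> \<beta> \<Longrightarrow> \<alpha> = \<beta>"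
  shows "essential U"
proof -
  \<comment> \<open>The depth in the tree; taking the least length spares a proof that the length is
    unique.\<close>
  define h where "h \<alpha> = (LEAST n. (D, \<alpha>) \<in> quadratic_rel ^^ n)" for \<alpha>
  have h: "(D, \<alpha>) \<in> quadratic_rel ^^ h \<alpha>" if "(D, \<alpha>) \<in> quadratic_rel ^^ n" for \<alpha> n
    unfolding h_def using that by (rule LeastI)
  have h_le: "h \<alpha> \<le> n" if "(D, \<alpha>) \<in> quadratic_rel ^^ n" for \<alpha> n
    unfolding h_def using that by (rule Least_le)
  show ?thesis using U anti
  proof (induction "sum h U" arbitrary: U rule: less_induct)
    case less
    have hU: "(D, \<alpha>) \<in> quadratic_rel ^^ h \<alpha>" if "\<alpha> \<in> U" for \<alpha> using less(3)[OF that] h by blast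
    note ch = quadratic_chain[OF hU D(1)]
    show ?case
    proof (cases "\<forall>\<alpha>\<in>U. h \<alpha> = 0")
      case True
      hence "\<alpha> = D" if "\<alpha> \<in> U" for \<alpha> using hU[OF that] that by auto
      hence UD: "U \<subseteq> {D}" by blast
      note c = subring_simps[OF regular2_D(1)[OF D(1)]]
      have "\<exists>s\<in>ring_inter R U. s \<noteq> \<zero> \<and> inv s \<in> \<alpha> \<and> s \<otimes> z \<in> ring_inter R U" if "\<alpha> \<in> U" "z \<in> \<alpha>" for \<alpha> z
      proof -
        have U: "U = {D}" "\<alpha> = D" "z \<in> D" using UD that by auto
        have "ring_inter R U = D" unfolding ring_inter_def U(1) using c(8) by blast
        moreover have "\<one> \<noteq> \<zero> \<and> inv \<one> \<in> D \<and> \<one> \<otimes> z \<in> D" using c(2) c(8)[OF U(3)] U(3) by simp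
        ultimately show ?thesis using c(2) U(2) by metis
      qed
      thus ?thesis unfolding essential_def by blast
    next
      case False
      hence "Max (h ` U) \<in> h ` U" using less(2) by (intro Max_in) auto
      then obtain \<alpha> where \<alpha>: "\<alpha> \<in> U" "h \<alpha> = Max (h ` U)" by auto
      have hmax: "h \<gamma> \<le> h \<alpha>" if "\<gamma> \<in> U" for \<gamma> unfolding \<alpha>(2) using less(2) that by simp
      have "h \<alpha> \<noteq> 0" using False hmax by fastforce
      then obtain k where k: "h \<alpha> = Suc k" by (cases "h \<alpha>") auto
      obtain \<beta> where \<beta>: "(D, \<beta>) \<in> quadratic_rel ^^ k" "quadratic \<beta> \<alpha>" using hU[OF \<alpha>(1)] unfolding k by auto
      note qd = quadratic_D[OF \<beta>(2)]
      define V where "V = {\<gamma> \<in> U. quadratic \<beta> \<gamma>}"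
      define U' where "U' = insert \<beta> (U - V)"
      have \<alpha>V: "\<alpha> \<in> V" using \<alpha> \<beta> by (simp add: V_def)
      have b_notin: "\<beta> \<notin> U" using less(4)[of \<beta> \<alpha>] \<alpha> qd(2,4) by blast
      \<comment> \<open>By the tree property such a member is reached from \<open>\<beta>\<close>.
        Maximal depth of \<open>\<alpha>\<close> allows at most one step, and
        \<open>\<beta> \<notin> U\<close> requires at least one.\<close>
      have up: "\<gamma> \<in> V" if g: "\<gamma> \<in> U" "\<beta> \<subseteq> \<gamma>" for \<gamma>
      proof -
        have f: "k \<le> h \<gamma>" "(\<beta>, \<gamma>) \<in> quadratic_rel ^^ (h \<gamma> - k)"
          using quadratic_chain_factor[OF D \<beta>(1) hU[OF g(1)] g(2)] by auto
        have "h \<gamma> - k \<noteq> 0" using f(2) b_notin g(1) by (metis relpow_0_E)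
        hence "h \<gamma> - k = 1" using hmax[OF g(1)] k by simp
        thus ?thesis using f(2) g(1) by (simp add: V_def)
      qed
      \<comment> \<open>Such a member would lie inside \<open>\<alpha>\<close> and hence equal
        it.\<close>
      have down: "\<gamma> \<in> V" if g: "\<gamma> \<in> U" "\<gamma> \<subseteq> \<beta>" for \<gamma>
        using less(4)[OF g(1) \<alpha>(1)] g(2) qd(2) \<alpha>V by blast
      have hb: "h \<beta> < h \<alpha>" using h_le[OF \<beta>(1)] k by simp
      have fin: "finite (U - V)" "finite V" using less(2) by (auto simp: V_def)
      have "sum h U' \<le> h \<beta> + sum h (U - V)"
        unfolding U'_def using sum.insert_if[OF fin(1), of h \<beta>] by simp
      also have "\<dots> < h \<alpha> + sum h (U - V)" using hb by simp
      also have "\<dots> \<le> sum h V + sum h (U - V)" using member_le_sum[OF \<alpha>V _ fin(2), of h] by simp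
      also have "\<dots> = sum h U" using sum.subset_diff[of V U h] less(2) by (auto simp: V_def)
      finally have lt: "sum h U' < sum h U" .
      have E: "essential U'"
      proof (rule less(1)[OF lt])
        show "finite U'" using fin by (simp add: U'_def)
        show "\<exists>n. (D, \<gamma>) \<in> quadratic_rel ^^ n" if "\<gamma> \<in> U'" for \<gamma> using that \<beta>(1) hU by (auto simp: U'_def)
        show "\<gamma> = \<gamma>'" if "\<gamma> \<in> U'" "\<gamma>' \<in> U'" "\<gamma> \<subseteq> \<gamma>'" for \<gamma> \<gamma>'
          using that up down less(4) unfolding U'_def by blast
      qed
      have "essential ((U' - {\<beta>}) \<union> V)"
      proof (rule essential_step[OF _ _ E])
        show "finite U'" "finite V" using fin by (simp_all add: U'_def)
        show "\<beta> \<in> U'" by (simp add: U'_def)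
        show "regular2 \<gamma>" if "\<gamma> \<in> U'" for \<gamma> using that ch(1) quadratic_chain(1)[OF \<beta>(1) D(1)] by (auto simp: U'_def)
        show "quadratic \<beta> \<gamma>" if "\<gamma> \<in> V" for \<gamma> using that by (simp add: V_def)
        show "\<not> \<gamma> \<subseteq> \<beta>" if "\<gamma> \<in> U'" "\<gamma> \<noteq> \<beta>" for \<gamma> using that down by (auto simp: U'_def)
      qed
      moreover have "(U' - {\<beta>}) \<union> V = U" using b_notin by (auto simp: U'_def V_def)
      ultimately show ?thesis by simp
    qed
  qed
qed

section \<open>Maximal ideals, chain condition and regularity of the intersection\<close>

definition centre :: "'a set set \<Rightarrow> 'a set \<Rightarrow> 'a set" where
  "centre U \<alpha> = nonunits \<alpha> \<inter> ring_inter R U"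

context
  fixes U :: "'a set set"
  assumes fin: "finite U" and ne: "U \<noteq> {}" and reg: "\<And>\<alpha>. \<alpha> \<in> U \<Longrightarrow> regular2 \<alpha>" and ess: "essential U"
    and anti: "\<And>\<alpha> \<beta>. \<alpha> \<in> U \<Longrightarrow> \<beta> \<in> U \<Longrightarrow> \<alpha> \<subseteq> \<beta> \<Longrightarrow> \<alpha> = \<beta>"
begin

lemma intersection_subring: "subring (ring_inter R U) R"
  using ring_inter_subring regular2_D(1)[OF reg] by blast

lemma centre_prime:
  assumes a: "\<alpha> \<in> U"
  shows "prime_in (ring_inter R U) (centre U \<alpha>)"
proof -
  note r = regular2_D[OF reg[OF a]]
  note m = ideal_in_simps[OF r(1,4)] and c = subring_simps[OF intersection_subring]
  have "ideal_in (ring_inter R U) (centre U \<alpha>)"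
    unfolding ideal_in_def centre_def using m c ring_inter_subset[OF a] by auto
  thus ?thesis
    unfolding prime_in_def centre_def
    using prime_in_D(2,3)[OF prime_in_nonunits[OF r(2)]] ring_inter_subset[OF a] by blast
qed

lemma localization_at_centre:
  assumes a: "\<alpha> \<in> U"
  shows "localization_at R (ring_inter R U) (centre U \<alpha>) = \<alpha>"
proof
  note r = regular2_D[OF reg[OF a]]
  note ca = subring_simps[OF r(1)]
  show "localization_at R (ring_inter R U) (centre U \<alpha>) \<subseteq> \<alpha>"
  proof
    fix z assume "z \<in> localization_at R (ring_inter R U) (centre U \<alpha>)"
    then obtain u v where uv: "u \<in> ring_inter R U" "v \<in> ring_inter R U - centre U \<alpha>" "z = u \<otimes> inv v"
      unfolding localization_at_def by (rule fractionsE)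
    hence "u \<in> \<alpha>" "v \<in> \<alpha>" "v \<notin> nonunits \<alpha>" using ring_inter_subset[OF a] by (auto simp: centre_def)
    thus "z \<in> \<alpha>" using unit_D(2)[OF r(1)] ca(4) uv(3) by blast
  qed
  show "\<alpha> \<subseteq> localization_at R (ring_inter R U) (centre U \<alpha>)"
  proof
    fix z assume z: "z \<in> \<alpha>"
    then obtain s where s: "s \<in> ring_inter R U" "s \<noteq> \<zero>" "inv s \<in> \<alpha>" "s \<otimes> z \<in> ring_inter R U"
      using ess a unfolding essential_def by blast
    have "s \<in> ring_inter R U - centre U \<alpha>" using s by (simp add: centre_def nonunits_def)
    moreover have "z = (s \<otimes> z) \<otimes> inv s"
      using ca(8)[OF z] s(2) subring_simps(8)[OF intersection_subring s(1)] by (simp add: mult_inv_cancel)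
    ultimately show "z \<in> localization_at R (ring_inter R U) (centre U \<alpha>)"
      unfolding localization_at_def using fractionsI s(4) by metis
  qed
qed

text \<open>Without inclusions among the members, a separating element exists for every ordered
  pair, so distinct centres are incomparable.\<close>

lemma centre_mono:
  assumes "\<alpha> \<in> U" "\<beta> \<in> U" "centre U \<alpha> \<subseteq> centre U \<beta>"
  shows "\<alpha> = \<beta>"
proof (rule ccontr)
  assume "\<alpha> \<noteq> \<beta>"
  hence "\<not> \<beta> \<subseteq> \<alpha>" using anti assms by blast
  then obtain s where "s \<in> ring_inter R U" "s \<in> nonunits \<alpha>" "s \<notin> nonunits \<beta>"
    using essential_separates[OF regular2_D(1)[OF reg] ess assms(2,1)] by blast
  thus False using assms(3) by (auto simp: centre_def)
qed

text \<open>By prime avoidance, an ideal inside no centre contains an element that is a unit in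
  every member. Its inverse then lies in the intersection.\<close>

lemma proper_ideal_in_centre:
  assumes I: "ideal_in (ring_inter R U) I" "\<one> \<notin> I"
  shows "\<exists>\<alpha>\<in>U. I \<subseteq> centre U \<alpha>"
proof (rule ccontr)
  assume n: "\<not> (\<exists>\<alpha>\<in>U. I \<subseteq> centre U \<alpha>)"
  note i = ideal_in_simps[OF intersection_subring I(1)]
  \<comment> \<open>Ordinary prime avoidance is the graded version with a family constant in the
    degree.\<close>
  have "\<exists>r\<ge>1::nat. \<exists>c\<in>I. \<forall>\<alpha>\<in>U. c \<notin> I \<inter> centre U \<alpha>"
  proof (rule graded_prime_avoidance[where G = "\<lambda>_. I" and q = "\<lambda>\<alpha> _. I \<inter> centre U \<alpha>"])
    fix \<alpha> assume a: "\<alpha> \<in> U"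
    note pr = centre_prime[OF a] and p = ideal_in_simps[OF intersection_subring prime_in_D(1)[OF centre_prime[OF a]]]
    show "x \<oplus> y \<in> I \<inter> centre U \<alpha> \<longleftrightarrow> y \<in> I \<inter> centre U \<alpha>" if x: "x \<in> I \<inter> centre U \<alpha>" "y \<in> I" for x y
    proof -
      have "x \<oplus> y = y \<oplus> x" using x i(8) by (simp add: a_comm)
      hence "x \<oplus> y \<in> centre U \<alpha> \<Longrightarrow> y \<in> centre U \<alpha>"
        using ideal_in_add_cancel[OF intersection_subring prime_in_D(1)[OF pr], of y x] x i(1) by simp
      thus ?thesis using x p(3) i(3) by blast
    qed
    show "x \<otimes> y \<in> I \<inter> centre U \<alpha> \<longleftrightarrow> x \<in> I \<inter> centre U \<alpha> \<or> y \<in> I \<inter> centre U \<alpha>" if x: "x \<in> I" "y \<in> I" for x y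
      using prime_in_D(3)[OF pr i(1)[OF x(1)] i(1)[OF x(2)]] p(4)[OF i(1)[OF x(1)]] p(5)[OF i(1)[OF x(2)]]
        i(4)[OF i(1)[OF x(1)] x(2)] x by blast
    show "\<exists>r\<ge>1::nat. \<exists>x\<in>I. x \<notin> I \<inter> centre U \<alpha>" using n a by blast
  qed (use fin ne i in auto)
  then obtain c where c: "c \<in> I" "\<forall>\<alpha>\<in>U. c \<notin> centre U \<alpha>" by blast
  have cN: "c \<in> ring_inter R U" using c i by blast
  have u: "c \<noteq> \<zero>" "inv c \<in> \<alpha>" if a: "\<alpha> \<in> U" for \<alpha>
    using unit_D[OF regular2_D(1)[OF reg[OF a]], of c] c(2) cN ring_inter_subset[OF a] a by (auto simp: centre_def)
  have "inv c \<in> ring_inter R U" using ring_interI[OF ne regular2_D(1)[OF reg]] u by blast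
  hence "inv c \<otimes> c \<in> I" using i(4) c by blast
  moreover have "inv c \<otimes> c = \<one>" using u(1) ne i(8)[OF c(1)] by (intro mult_inv) auto
  ultimately show False using I(2) by simp
qed

lemma maximal_in_intersection: "{M. maximal_in (ring_inter R U) M} = centre U ` U"
proof (intro equalityI subsetI)
  fix M assume "M \<in> {M. maximal_in (ring_inter R U) M}"
  hence M: "maximal_in (ring_inter R U) M" by simp
  then obtain \<alpha> where a: "\<alpha> \<in> U" "M \<subseteq> centre U \<alpha>"
    using proper_ideal_in_centre[of M] by (auto simp: maximal_in_def)
  hence "centre U \<alpha> = M" using M prime_in_D(1,2)[OF centre_prime[OF a(1)]] unfolding maximal_in_def by blast
  thus "M \<in> centre U ` U" using a by blast
next
  fix M assume "M \<in> centre U ` U"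
  then obtain \<alpha> where a: "\<alpha> \<in> U" "M = centre U \<alpha>" by blast
  have "J = M" if J: "ideal_in (ring_inter R U) J \<and> M \<subseteq> J \<and> \<one> \<notin> J" for J
  proof -
    obtain \<beta> where b: "\<beta> \<in> U" "J \<subseteq> centre U \<beta>" using proper_ideal_in_centre J by blast
    hence "\<alpha> = \<beta>" using centre_mono[OF a(1) b(1)] a(2) J by blast
    thus ?thesis using a(2) b J by blast
  qed
  thus "M \<in> {M. maximal_in (ring_inter R U) M}"
    unfolding maximal_in_def using prime_in_D(1,2)[OF centre_prime[OF a(1)]] a(2) by blast
qed

text \<open>Generators of the extensions of \<open>I\<close> to the finitely many members are
  cleared of denominators. Together they generate \<open>I\<close>, since membership in an ideal can
  be tested at the centres.\<close>

lemma intersection_noetherian: "noetherian_in (ring_inter R U)"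
  unfolding noetherian_in_def
proof (intro allI impI)
  let ?N = "ring_inter R U"
  note sN = intersection_subring
  note c = subring_simps[OF sN]
  \<comment> \<open>The extension of \<open>J\<close> to the localization \<open>\<alpha>\<close>,
    described by denominators instead of sums.\<close>
  define ext where "ext J \<alpha> = {z \<in> \<alpha>. \<exists>s\<in>?N - centre U \<alpha>. s \<otimes> z \<in> J}" for J \<alpha>
  have ext: "ideal_in \<alpha> (ext J \<alpha>)" if J: "ideal_in ?N J" and a: "\<alpha> \<in> U" for J \<alpha>
    unfolding ideal_in_def
  proof (intro conjI ballI)
    note j = ideal_in_simps[OF sN J]
    note ca = subring_simps[OF regular2_D(1)[OF reg[OF a]]]
    show "ext J \<alpha> \<subseteq> \<alpha>" by (auto simp: ext_def)
    have "\<one> \<otimes> \<zero> \<in> J" using j by simp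
    thus "\<zero> \<in> ext J \<alpha>" unfolding ext_def using denominator_one[OF sN centre_prime[OF a]] ca(1) by blast
    fix x assume "x \<in> ext J \<alpha>"
    then obtain s where s: "x \<in> \<alpha>" "s \<in> ?N - centre U \<alpha>" "s \<otimes> x \<in> J" by (auto simp: ext_def)
    have xc: "x \<in> carrier R" "s \<in> carrier R" using ca(8)[OF s(1)] c(8)[of s] s(2) by simp_all
    {
      fix y assume "y \<in> ext J \<alpha>"
      then obtain t where t: "y \<in> \<alpha>" "t \<in> ?N - centre U \<alpha>" "t \<otimes> y \<in> J" by (auto simp: ext_def)
      have yc: "y \<in> carrier R" "t \<in> carrier R" using ca(8)[OF t(1)] c(8)[of t] t(2) by simp_all
      have "(s \<otimes> t) \<otimes> (x \<oplus> y) = t \<otimes> (s \<otimes> x) \<oplus> s \<otimes> (t \<otimes> y)" using xc yc by (simp add: field_arith)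
      hence "(s \<otimes> t) \<otimes> (x \<oplus> y) \<in> J" using s t by (simp add: j)
      thus "x \<oplus> y \<in> ext J \<alpha>"
        unfolding ext_def using denominator_mult[OF sN centre_prime[OF a] s(2) t(2)] ca(5)[OF s(1) t(1)] by blast
    }
    fix r assume r: "r \<in> \<alpha>"
    then obtain t where t: "t \<in> ?N" "t \<noteq> \<zero>" "inv t \<in> \<alpha>" "t \<otimes> r \<in> ?N"
      using ess a unfolding essential_def by blast
    have t': "t \<in> ?N - centre U \<alpha>" using t by (simp add: centre_def nonunits_def)
    have tc: "r \<in> carrier R" "t \<in> carrier R" using ca(8)[OF r] c(8)[OF t(1)] by simp_all
    have "(s \<otimes> t) \<otimes> (r \<otimes> x) = (t \<otimes> r) \<otimes> (s \<otimes> x)" using xc tc by (simp add: field_arith)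
    hence "(s \<otimes> t) \<otimes> (r \<otimes> x) \<in> J" using s(3) t(4) by (simp add: j)
    thus "r \<otimes> x \<in> ext J \<alpha>"
      unfolding ext_def using denominator_mult[OF sN centre_prime[OF a] s(2) t'] ca(4)[OF r s(1)] by blast
  qed
  fix I assume I: "ideal_in ?N I"
  note i = ideal_in_simps[OF sN I]
  have "\<exists>A. finite A \<and> A \<subseteq> ext I \<alpha> \<and> (\<forall>J. ideal_in \<alpha> J \<and> A \<subseteq> J \<longrightarrow> ext I \<alpha> \<subseteq> J)" if "\<alpha> \<in> U" for \<alpha>
    using regular2_D(3)[OF reg[OF that]] ext[OF I that] unfolding noetherian_in_def by blast
  then obtain A where A: "\<And>\<alpha>. \<alpha> \<in> U \<Longrightarrow> finite (A \<alpha>)" "\<And>\<alpha>. \<alpha> \<in> U \<Longrightarrow> A \<alpha> \<subseteq> ext I \<alpha>"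
    "\<And>\<alpha> J. \<alpha> \<in> U \<Longrightarrow> ideal_in \<alpha> J \<Longrightarrow> A \<alpha> \<subseteq> J \<Longrightarrow> ext I \<alpha> \<subseteq> J" by metis
  have "\<exists>s. \<alpha> \<in> U \<longrightarrow> x \<in> A \<alpha> \<longrightarrow> s \<in> ?N - centre U \<alpha> \<and> s \<otimes> x \<in> I" for \<alpha> x
    using A(2)[of \<alpha>] by (auto simp: ext_def)
  then obtain f where f: "\<And>\<alpha> x. \<alpha> \<in> U \<Longrightarrow> x \<in> A \<alpha> \<Longrightarrow> f \<alpha> x \<in> ?N - centre U \<alpha> \<and> f \<alpha> x \<otimes> x \<in> I" by metis
  define B where "B = (\<Union>\<alpha>\<in>U. (\<lambda>x. f \<alpha> x \<otimes> x) ` A \<alpha>)"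
  show "\<exists>A. finite A \<and> A \<subseteq> I \<and> (\<forall>J. ideal_in ?N J \<and> A \<subseteq> J \<longrightarrow> I \<subseteq> J)"
  proof (intro exI[of _ B] conjI allI impI)
    show "finite B" using fin A(1) by (auto simp: B_def)
    show "B \<subseteq> I" using f by (auto simp: B_def)
    fix J assume "ideal_in ?N J \<and> B \<subseteq> J"
    hence J: "ideal_in ?N J" "B \<subseteq> J" by auto
    note j = ideal_in_simps[OF sN J(1)]
    have le: "ext I \<alpha> \<subseteq> ext J \<alpha>" if a: "\<alpha> \<in> U" for \<alpha>
    proof (rule A(3)[OF a ext[OF J(1) a]])
      show "A \<alpha> \<subseteq> ext J \<alpha>"
      proof
        fix x assume x: "x \<in> A \<alpha>"
        have "f \<alpha> x \<otimes> x \<in> J" using x a J(2) by (auto simp: B_def)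
        moreover have "x \<in> \<alpha>" using x A(2)[OF a] by (auto simp: ext_def)
        ultimately show "x \<in> ext J \<alpha>" unfolding ext_def using f[OF a x] by blast
      qed
    qed
    show "I \<subseteq> J"
    proof
      fix z assume z: "z \<in> I"
      have zN: "z \<in> ?N" using i(1)[OF z] .
      \<comment> \<open>The colon ideal of \<open>J\<close> and z. Local membership of z keeps it
        out of every centre, so it contains one.\<close>
      define K where "K = {s \<in> ?N. s \<otimes> z \<in> J}"
      have "ideal_in ?N K"
        unfolding ideal_in_def K_def using c j zN by (auto simp: l_distr m_assoc)
      moreover have "\<not> K \<subseteq> centre U \<alpha>" if a: "\<alpha> \<in> U" for \<alpha>
      proof -
        have "\<one> \<otimes> z \<in> I" using z i(8) by simp
        hence "z \<in> ext I \<alpha>"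
          unfolding ext_def using denominator_one[OF sN centre_prime[OF a]] zN ring_inter_subset[OF a] by blast
        hence "z \<in> ext J \<alpha>" using le[OF a] by blast
        thus ?thesis by (auto simp: ext_def K_def)
      qed
      ultimately have "\<one> \<in> K" using proper_ideal_in_centre by blast
      thus "z \<in> J" using c(8)[OF zN] by (simp add: K_def)
    qed
  qed
qed

text \<open>A prime is a centre, zero, or in between. A centre gives one of the given rings, and
  zero gives the whole field because the intersection has it as quotient field. In the remaining
  case the extension to some member is principal, and the localization gets a principal maximal
  ideal.\<close>

lemma intersection_regular:
  assumes qf: "quotient_field_in (ring_inter R U)" and P: "prime_in (ring_inter R U) P"
  shows "regular_local_ring (R\<lparr>carrier := localization_at R (ring_inter R U) P\<rparr>)"
proof -
  let ?N = "ring_inter R U" let ?L = "localization_at R (ring_inter R U) P"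
  note sN = intersection_subring
  note c = subring_simps[OF sN]
  note p = ideal_in_simps[OF sN prime_in_D(1)[OF P]]
  obtain \<alpha> where a: "\<alpha> \<in> U" "P \<subseteq> centre U \<alpha>" using proper_ideal_in_centre prime_in_D(1,2)[OF P] by blast
  note pa = centre_prime[OF a(1)]
  note la = localization_at_centre[OF a(1)]
  obtain x y where xy: "regular_pair \<alpha> x y" using reg[OF a(1)] by (auto simp: regular2_def)
  consider "P = centre U \<alpha>" | "P = {\<zero>}" | "P \<noteq> centre U \<alpha>" "P \<noteq> {\<zero>}" by blast
  thus ?thesis
  proof cases
    case 1
    thus ?thesis using regular_pair_imp_regular_local_ring[OF xy] la by simp
  next
    case 2
    have "carrier R \<subseteq> ?L"
    proof
      fix z assume z: "z \<in> carrier R"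
      then obtain v where v: "v \<in> ?N" "v \<noteq> \<zero>" "v \<otimes> z \<in> ?N" using qf by (auto simp: quotient_field_in_def)
      have "z = (v \<otimes> z) \<otimes> inv v" using z v(2) c(8)[OF v(1)] by (simp add: mult_inv_cancel)
      thus "z \<in> ?L" unfolding localization_at_def 2 using fractionsI[OF v(3), of v "?N - {\<zero>}"] v by simp
    qed
    hence "?L = carrier R" using subringE(1)[OF localization_subring[OF sN P]] by blast
    thus ?thesis using carrier_regular_local_ring by simp
  next
    case 3
    define Q where "Q = fractions R P (?N - centre U \<alpha>)"
    have Q: "prime_in \<alpha> Q" using fractions_prime[OF sN pa P a(2)] unfolding la Q_def .
    have con: "w \<in> P" if "w \<in> ?N" "w \<in> Q" for w
      using fractions_contract[OF sN pa P a(2) that(1) denominator_one[OF sN pa]] that(2) c(8)[OF that(1)] by (simp add: Q_def)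
    have PQ: "P \<subseteq> Q" unfolding Q_def using fractions_incl[OF sN pa] p(1) by blast
    have "Q \<noteq> nonunits \<alpha>" using con 3(1) a(2) by (auto simp: centre_def)
    moreover have "Q \<noteq> {\<zero>}" using PQ 3(2) p(2) by blast
    ultimately obtain w where w: "w \<in> Q" "w \<noteq> \<zero>" "Q = multiples \<alpha> w" using prime_principal[OF xy Q] by blast
    obtain u v where uv: "u \<in> P" "v \<in> ?N - centre U \<alpha>" "w = u \<otimes> inv v" using w(1) unfolding Q_def by (rule fractionsE)
    note dv = denominator[OF sN pa uv(2)]
    have uc: "u \<in> carrier R" "u \<in> ?N" using uv(1) p by auto
    have u0: "u \<noteq> \<zero>" using w(2) uv(3) dv by auto
    note sL = localization_subring[OF sN P] and lL = localization_local[OF sN P] and NL = localization_superset[OF sN P]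
    \<comment> \<open>The numerator u of the generator w = u/v already belongs to \<open>P\<close>.
      All denominators involved avoid the larger centre, hence avoid \<open>P\<close>, so u still
      generates after localizing at \<open>P\<close>.\<close>
    have "nonunits ?L \<subseteq> multiples ?L u"
    proof
      fix z assume "z \<in> nonunits ?L"
      then obtain x b where xb: "x \<in> P" "b \<in> ?N - P" "z = x \<otimes> inv b"
        unfolding localization_nonunits[OF sN P] by (rule fractionsE)
      note db = denominator[OF sN P xb(2)]
      obtain t where t: "t \<in> \<alpha>" "x = w \<otimes> t" using PQ xb(1) w(3) by (auto simp: multiples_def)
      have "t \<in> localization_at R ?N (centre U \<alpha>)" using t la by simp
      then obtain r s where rs: "r \<in> ?N" "s \<in> ?N - centre U \<alpha>" "t = r \<otimes> inv s"
        unfolding localization_at_def by (rule fractionsE)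
      note ds = denominator[OF sN pa rs(2)]
      have vs: "v \<otimes> s \<in> ?N - centre U \<alpha>" using denominator_mult[OF sN pa uv(2) rs(2)] .
      hence den: "(v \<otimes> s) \<otimes> b \<in> ?N - P" using denominator_mult[OF sN P _ xb(2)] a(2) by blast
      have "z = u \<otimes> (r \<otimes> inv ((v \<otimes> s) \<otimes> b))"
        unfolding xb(3) t(2) uv(3) rs(3) using uc dv ds db c(8)[OF rs(1)] by (simp add: field_arith)
      moreover have "r \<otimes> inv ((v \<otimes> s) \<otimes> b) \<in> ?L" unfolding localization_at_def using fractionsI[OF rs(1) den] .
      ultimately show "z \<in> multiples ?L u" using multiplesI by metis
    qed
    moreover have "u \<in> nonunits ?L" using localization_contract[OF sN P uc(2)] uv(1) by blast
    ultimately have "nonunits ?L = multiples ?L u"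
      using multiples_subset[OF sL local_in_D(2)[OF lL]] by blast
    thus ?thesis
      using principal_imp_regular_local_ring[OF lL localization_noetherian[OF sN P intersection_noetherian]] NL uc(2) u0 by blast
  qed
qed

end

section \<open>The given finite antichain in the tree\<close>

lemma quadratic_tree_imp_chain:
  assumes D: "regular2 D" and S: "S \<in> quadratic_tree R D"
  shows "\<exists>n. (D, S) \<in> quadratic_rel ^^ n"
  using S
proof induction
  case base
  show ?case by (rule exI[of _ 0]) simp
next
  case (step S T)
  then obtain n where n: "(D, S) \<in> quadratic_rel ^^ n" by blast
  obtain x y where "regular_pair S x y" using quadratic_chain(1)[OF n D] by (auto simp: regular2_def)
  hence "quadratic S T" using local_quadratic_transform_imp_quadratic step by blast
  thus ?case using n by (intro exI[of _ "Suc n"]) auto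
qed

end

theorem corollary6p5:
  fixes F :: "('a, 'b) ring_scheme" and D :: "'a set"
    and n :: nat and \<alpha> :: "nat \<Rightarrow> 'a set" and U :: "'a set set"
  assumes "field F"
    and "two_dim_regular_local_ring F D"
    and "has_quotient_field F D"
    and "n \<ge> 1"
    and "U = \<alpha> ` {1..n}"
    and "U \<subseteq> quadratic_tree F D"
    and "\<And>i j. i \<in> {1..n} \<Longrightarrow> j \<in> {1..n} \<Longrightarrow> i \<noteq> j \<Longrightarrow> \<not> \<alpha> i \<subseteq> \<alpha> j"
  shows "regular_noetherian_domain F (ring_inter F U)
    \<and> card {M. maximalideal M (F\<lparr>carrier := ring_inter F U\<rparr>)} = n
    \<and> (\<exists>\<mm>. bij_betw \<mm> {1..n} {M. maximalideal M (F\<lparr>carrier := ring_inter F U\<rparr>)}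
          \<and> (\<forall>i\<in>{1..n}. localization_at F (ring_inter F U) (\<mm> i) = \<alpha> i))
    \<and> essential_representation F U
    \<and> irredundant_representation F U"
proof -
  interpret F: field F by fact
  have D: "F.regular2 D" using F.two_dim_imp_regular_pair[OF assms(2)] by (simp add: F.regular2_def)
  have qD: "F.quotient_field_in D" using F.has_quotient_field_imp[OF assms(3)] .
  have chain: "\<exists>n. (D, \<beta>) \<in> {(S, T). F.quadratic S T} ^^ n" if "\<beta> \<in> U" for \<beta>
    using F.quadratic_tree_imp_chain[OF D] assms(6) that by blast
  have anti: "\<beta> = \<gamma>" if "\<beta> \<in> U" "\<gamma> \<in> U" "\<beta> \<subseteq> \<gamma>" for \<beta> \<gamma> using that assms(5,7) by blast
  have fin: "finite U" and ne: "U \<noteq> {}" using assms(4,5) by auto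
  have inj: "inj_on \<alpha> {1..n}" using assms(7) by (intro inj_onI) (metis order_refl)
  have reg: "F.regular2 \<beta>" "D \<subseteq> \<beta>" if "\<beta> \<in> U" for \<beta> using chain[OF that] F.quadratic_chain[OF _ D] by blast+
  \<comment> \<open>Stated for all subfamilies, because irredundancy compares \<open>U\<close> with
    the smaller antichain left after removing one member.\<close>
  have ess: "F.essential W" if "W \<subseteq> U" for W
    using that finite_subset[OF that fin] chain anti by (intro F.antichain_essential[OF D qD]) blast+
  note A = fin ne reg(1) ess[OF order_refl] anti
  let ?N = "ring_inter F U"
  have sub: "subring ?N F" by (rule F.intersection_subring[OF A])
  have DN: "D \<subseteq> ?N"
    using F.ring_interI[OF ne F.regular2_D(1)[OF reg(1)]] reg(2) by blast
  have cinj: "inj_on (F.centre U) U" using F.centre_mono[OF A] by (intro inj_onI) simp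
  have maxs: "{M. maximalideal M (F\<lparr>carrier := ?N\<rparr>)} = F.centre U ` U"
    unfolding F.maximalideal_iff[OF sub] by (rule F.maximal_in_intersection[OF A])
  have "noetherian_domain (F\<lparr>carrier := ?N\<rparr>)"
    using F.noetherian_iff[OF sub] F.intersection_noetherian[OF A] F.domain_sub[OF sub] noetherian_domain.intro by blast
  moreover have "regular_local_ring (F\<lparr>carrier := localization_at F ?N P\<rparr>)"
    if "primeideal P (F\<lparr>carrier := ?N\<rparr>)" for P
    using F.intersection_regular[OF A F.quotient_field_in_mono[OF DN qD]] that F.primeideal_iff[OF sub] by blast
  ultimately have 1: "regular_noetherian_domain F ?N" unfolding regular_noetherian_domain_def using sub by blast
  have 2: "card {M. maximalideal M (F\<lparr>carrier := ?N\<rparr>)} = n"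
    unfolding maxs using card_image[OF cinj] card_image[OF inj] by (simp add: assms(5))
  have "bij_betw (F.centre U \<circ> \<alpha>) {1..n} (F.centre U ` U)"
    unfolding bij_betw_def using comp_inj_on[OF inj] cinj assms(5) by (simp add: image_comp)
  moreover have "localization_at F ?N ((F.centre U \<circ> \<alpha>) i) = \<alpha> i" if "i \<in> {1..n}" for i
    using F.localization_at_centre[OF A, of "\<alpha> i"] that assms(5) by simp
  ultimately have 3: "\<exists>\<mm>. bij_betw \<mm> {1..n} {M. maximalideal M (F\<lparr>carrier := ?N\<rparr>)}
          \<and> (\<forall>i\<in>{1..n}. localization_at F ?N (\<mm> i) = \<alpha> i)"
    unfolding maxs by blast
  have "is_localization_of F \<beta> ?N" if b: "\<beta> \<in> U" for \<beta>
    unfolding is_localization_of_def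
  \<comment> \<open>The multiplicative set is the complement of the prime centre.\<close>
  proof (intro exI[of _ "?N - F.centre U \<beta>"] conjI)
    note pr = F.centre_prime[OF A b]
    show "submonoid (?N - F.centre U \<beta>) (F\<lparr>carrier := ?N\<rparr>)"
      using F.denominator_one[OF sub pr] F.denominator_mult[OF sub pr] by unfold_locales auto
    show "\<zero>\<^bsub>F\<^esub> \<notin> ?N - F.centre U \<beta>" using F.denominator(2)[OF sub pr] by blast
    show "\<beta> = fractions F ?N (?N - F.centre U \<beta>)"
      using F.localization_at_centre[OF A b] by (simp add: localization_at_def)
  qed
  hence 4: "essential_representation F U" unfolding essential_representation_def by blast
  have "?N \<noteq> ring_inter F (U - {\<beta>})" if b: "\<beta> \<in> U" for \<beta>
  proof
    assume eq: "?N = ring_inter F (U - {\<beta>})"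
    show False
    proof (cases "U - {\<beta>} = {}")
      case True
      \<comment> \<open>The empty intersection is the whole field, whereas \<open>\<beta>\<close>
        contains a nonzero nonunit.\<close>
      have "?N = carrier F" unfolding eq True by (simp add: ring_inter_def)
      hence "carrier F \<subseteq> \<beta>" using F.ring_inter_subset[OF b] by simp
      moreover obtain x y where "F.regular_pair \<beta> x y" using reg(1)[OF b] by (auto simp: F.regular2_def)
      hence "x \<in> F.nonunits \<beta>" "x \<in> \<beta>" "x \<noteq> \<zero>\<^bsub>F\<^esub>" using F.regular_pair_D(1,2) F.two_generated_D(3,7) by blast+
      ultimately show False
        using F.inv_carrier[of x] F.subring_carrier[OF F.regular2_D(1)[OF reg(1)[OF b]], of x] by (auto simp: F.nonunits_def)
    next
      case False
      have A': "finite (U - {\<beta>})" "U - {\<beta>} \<noteq> {}" "\<And>\<gamma>. \<gamma> \<in> U - {\<beta>} \<Longrightarrow> F.regular2 \<gamma>" "F.essential (U - {\<beta>})"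
        "\<And>\<gamma> \<delta>. \<gamma> \<in> U - {\<beta>} \<Longrightarrow> \<delta> \<in> U - {\<beta>} \<Longrightarrow> \<gamma> \<subseteq> \<delta> \<Longrightarrow> \<gamma> = \<delta>"
        using fin False reg(1) ess[of "U - {\<beta>}"] anti by auto
      \<comment> \<open>If removing \<open>\<beta>\<close> left the ring unchanged, its maximal
        ideals could be described by both families, against injectivity of the centres.\<close>
      have "F.centre U ` U = F.centre (U - {\<beta>}) ` (U - {\<beta>})"
        using F.maximal_in_intersection[OF A] F.maximal_in_intersection[OF A'] eq by simp
      also have "\<dots> = F.centre U ` (U - {\<beta>})" unfolding F.centre_def eq ..
      finally have "F.centre U \<beta> \<in> F.centre U ` (U - {\<beta>})" using b by blast
      then obtain \<gamma> where "\<gamma> \<in> U - {\<beta>}" "F.centre U \<beta> = F.centre U \<gamma>" by blast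
      thus False using cinj b by (auto dest: inj_onD)
    qed
  qed
  moreover have "?N \<subseteq> ring_inter F (U - {\<beta>})" for \<beta> by (auto simp: ring_inter_def)
  ultimately have 5: "irredundant_representation F U" unfolding irredundant_representation_def by blast
  show ?thesis using 1 2 3 4 5 by blast
qed

end
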